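(* Let $n\ge 4$ be even, let $p\ge n+1$ be an integer, let $c_1$ be a positive integer, and define $a_k=pc_k$, $c_{k+1}=pa_k=p^2c_k$ for $k\ge1$. Let $T$ be an interval exchange transformation of $[0,1)$ with permutation $\pi$ whose right Rauzy induction path is the infinite concatenation $\gamma_{a_1,c_1}\gamma_{a_2,c_2}\gamma_{a_3,c_3}\cdots$ (notation in the context). Then for every $j\in S=\{3,5,\dots,n-1,n\}$ the limit $$L_j=\lim_{m\to\infty}\overline{\Theta_{1}\Theta_{2}\cdots\Theta_{m}e_j}$$ exists, $T$ is not uniquely ergodic, and $T$ possesses $n/2$ pairwise distinct invariant ergodic probability measures $\lambda_j$, $j\in S$, where $\lambda_j$ is the $T$-invariant measure whose vector of values $(\lambda_j(X_1),\dots,\lambda_j(X_n))$ on the initial subintervals is $L_j$.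
   Context: An interval exchange transformation (IET) $T$ of $[0,1)$ is given by a permutation and a length vector: $[0,1)$ is cut into consecutive intervals $X_1,\dots,X_n$ (left to right) which are translated and reordered. Here $\pi$ is the permutation with top row $1,2,3,\dots,n$ and bottom row $n,3,2,5,4,\dots,n-1,n-2,1$ (i.e. $1$ and $n$ are exchanged and $2i\leftrightarrow 2i+1$ for $1\le i\le (n-2)/2$). Right Rauzy induction: compare the rightmost interval of the domain (top) and of the image (bottom); step "0" is when the top one is longer, step "1" when the bottom one is longer; one induces $T$ on the interval obtained by removing the shorter of the two lengths from the right. For $a,c>0$ set $\dot\gamma_{m,a}=1^{n-1-m}0^a10^2$ and $\gamma_{a,c}=0\,\dot\gamma_{n-2,a}\cdots\dot\gamma_{2,a}\,1^{c(n-1)}$, a closed path in the Rauzy diagram at $\pi$. Its transition matrix (old length vector $=\Theta_{a,c}\cdot$ new length vector) is the $n\times n$ matrix $\Theta_{a,c}$ with: row $1$ equal to $(1,c,c,\dots,c)$; row $n$ equal to $(1,c+1,\dots,c+1)$; for $1\le i\le (n-2)/2$, row $2i$ has $0$ in column $1$, $2$ in columns $2i$ and $2i+1$, and $1$ in all other columns among $2,\dots,n$; row $2i+1$ has $a$ in column $2i$, $a+1$ in column $2i+1$ and $0$ elsewhere. Write $\Theta_k=\Theta_{a_k,c_k}$. For a nonnegative vector $v$, $|v|$ is the sum of its entries and $\overline{v}=v/|v|$; $e_j$ is the $j$-th standard basis vector. *)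

theory Defs
  imports "HOL-Probability.Probability"
begin

text \<open>A permutation is given by its top row and bottom row (lists of letters).
  The subinterval X_i of the domain is placed according to the top row, its image
  according to the bottom row.\<close>

definition ts :: "nat list \<Rightarrow> (nat \<Rightarrow> real) \<Rightarrow> nat \<Rightarrow> real" where
  "ts rw lam i = sum_list (map lam (takeWhile (\<lambda>j. j \<noteq> i) rw))"

definition Xint :: "nat list \<Rightarrow> (nat \<Rightarrow> real) \<Rightarrow> nat \<Rightarrow> real set" where
  "Xint tp lam i = {ts tp lam i ..< ts tp lam i + lam i}"

definition iet_map :: "nat list \<Rightarrow> nat list \<Rightarrow> (nat \<Rightarrow> real) \<Rightarrow> real \<Rightarrow> real" where
  "iet_map tp bt lam x =
     x + (\<Sum>i\<in>set tp. indicator (Xint tp lam i) x * (ts bt lam i - ts tp lam i))"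

fun ins_after :: "nat \<Rightarrow> nat \<Rightarrow> nat list \<Rightarrow> nat list" where
  "ins_after x y [] = []"
| "ins_after x y (z # zs) = (if z = x then z # y # zs else z # ins_after x y zs)"

definition rv_step :: "nat list \<times> nat list \<times> (nat \<Rightarrow> real) \<Rightarrow> nat list \<times> nat list \<times> (nat \<Rightarrow> real)" where
  "rv_step s = (case s of (tp, bt, lam) \<Rightarrow>
     (let al = last tp; be = last bt in
      if lam al > lam be then (tp, ins_after al be (butlast bt), lam(al := lam al - lam be))
      else (ins_after be al (butlast tp), bt, lam(be := lam be - lam al))))"

definition rv_type :: "nat list \<times> nat list \<times> (nat \<Rightarrow> real) \<Rightarrow> nat option" where
  "rv_type s = (case s of (tp, bt, lam) \<Rightarrow>
     (if lam (last tp) > lam (last bt) then Some 0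
      else if lam (last bt) > lam (last tp) then Some 1 else None))"

text \<open>k-th letter of the right Rauzy induction path (None: induction undefined, tie).\<close>
definition rauzy_path :: "nat list \<Rightarrow> nat list \<Rightarrow> (nat \<Rightarrow> real) \<Rightarrow> nat \<Rightarrow> nat option" where
  "rauzy_path tp bt lam k = rv_type ((rv_step ^^ k) (tp, bt, lam))"

definition top_row :: "nat \<Rightarrow> nat list" where
  "top_row n = [1..<n+1]"

definition bot_row :: "nat \<Rightarrow> nat list" where
  "bot_row n = [n] @ concat (map (\<lambda>i. [2*i+1, 2*i]) [1..<n div 2]) @ [1]"

definition gamma_dot :: "nat \<Rightarrow> nat \<Rightarrow> nat \<Rightarrow> nat list" where
  "gamma_dot n m a = replicate (n - 1 - m) 1 @ replicate a 0 @ [1] @ [0, 0]"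

definition gamma :: "nat \<Rightarrow> nat \<Rightarrow> nat \<Rightarrow> nat list" where
  "gamma n a c = [0] @ concat (map (\<lambda>i. gamma_dot n (n - 2*i) a) [1..<n div 2])
                   @ replicate (c * (n - 1)) 1"

definition Theta :: "nat \<Rightarrow> nat \<Rightarrow> nat \<Rightarrow> nat \<Rightarrow> nat \<Rightarrow> real" where
  "Theta n a c i j =
    (if i = 1 then (if j = 1 then 1 else real c)
     else if i = n then (if j = 1 then 1 else real c + 1)
     else if even i then (if j = 1 then 0 else if j = i \<or> j = i + 1 then 2 else 1)
     else (if j = i - 1 then real a else if j = i then real a + 1 else 0))"

definition mat_vec :: "nat \<Rightarrow> (nat \<Rightarrow> nat \<Rightarrow> real) \<Rightarrow> (nat \<Rightarrow> real) \<Rightarrow> nat \<Rightarrow> real" where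
  "mat_vec n M v i = (\<Sum>k=1..n. M i k * v k)"

fun theta_prod :: "nat \<Rightarrow> (nat \<Rightarrow> nat) \<Rightarrow> (nat \<Rightarrow> nat) \<Rightarrow> nat \<Rightarrow> (nat \<Rightarrow> real) \<Rightarrow> nat \<Rightarrow> real" where
  "theta_prod n a c 0 v = v"
| "theta_prod n a c (Suc m) v = theta_prod n a c m (mat_vec n (Theta n (a (Suc m)) (c (Suc m))) v)"

definition std_basis :: "nat \<Rightarrow> nat \<Rightarrow> real" where
  "std_basis j = (\<lambda>i. if i = j then 1 else 0)"

definition normalize_vec :: "nat \<Rightarrow> (nat \<Rightarrow> real) \<Rightarrow> nat \<Rightarrow> real" where
  "normalize_vec n v i = v i / (\<Sum>k=1..n. v k)"

definition inv_prob :: "(real \<Rightarrow> real) \<Rightarrow> real measure \<Rightarrow> bool" where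
  "inv_prob T M \<longleftrightarrow>
     sets M = sets (restrict_space borel {0..<1::real}) \<and> prob_space M \<and>
     T \<in> measurable M M \<and>
     (\<forall>A\<in>sets M. emeasure M (T -` A \<inter> space M) = emeasure M A)"

definition ergodic_inv_prob :: "(real \<Rightarrow> real) \<Rightarrow> real measure \<Rightarrow> bool" where
  "ergodic_inv_prob T M \<longleftrightarrow> inv_prob T M \<and>
     (\<forall>A\<in>sets M. T -` A \<inter> space M = A \<longrightarrow> emeasure M A = 0 \<or> emeasure M A = 1)"

definition uniquely_ergodic :: "(real \<Rightarrow> real) \<Rightarrow> bool" where
  "uniquely_ergodic T \<longleftrightarrow> (\<exists>!M. inv_prob T M)"

end

theory Submission
  imports Defs
begin

text \<open>Running Rauzy induction for k steps cuts [0,1) into floors, each carrying the letter of the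
  interval of the k-th induced map it is a translate of. If the winner is w and the loser l, every
  floor of w splits into a left floor of w and a right floor of l, and nothing else changes. An
  invariant measure gives all floors of a letter the same mass, so it corresponds to a sequence of
  nonnegative weights on the letters satisfying the same linear recursion as the lengths; since
  lengths and weights tend to 0, this correspondence is bijective (the measure is recovered through
  its distribution function).

  Along the given path the recursion is the multiplication by the matrices \<open>\<Theta>\<^sub>k\<close>. Let
  \<open>N\<^sub>m(j)\<close> be the column sums of \<open>\<Theta>\<^sub>1\<dots>\<Theta>\<^sub>m\<close>. Group the columns into the classes {1,n} and
  {2i,2i+1}, with heads n and 2i+1. The ratios \<open>N\<^sub>m(2i+1) / N\<^sub>m(n)\<close> grow geometrically, at a rate
  between 5/4 and p + 3, while \<open>c\<^sub>m\<close> grows like \<open>p\<^sup>2\<^sup>m\<close>. Hence a column is, up to a summable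
  relative error, a multiple of the previous column of its head. This makes the normalised columns
  converge and keeps almost all of the mass of the limit \<open>L\<^sub>j\<close> in the class of j, so a measure
  dominated by a multiple of the one with vector \<open>L\<^sub>j\<close> has vector \<open>L\<^sub>j\<close> as well: this is
  ergodicity.\<close>


section \<open>Rows under a Rauzy step\<close>

text \<open>Both bounds on the growth of \<open>N m (e + 1) / N m n\<close> are needed, and they
  pull in opposite directions. Column \<open>n\<close> is fed by \<open>c (Suc m) * N m n\<close>
  and by all even columns with coefficient 1. It stays close to a multiple of its predecessor only
  if the ratio grows more slowly than \<open>c\<close>, which \<open>p + 3 < p ^ 2\<close> ensures.
  Columns \<open>e\<close> and \<open>e + 1\<close> contain the whole new column \<open>n\<close>
  besides a multiple of the old column \<open>e + 1\<close>; the first part is negligible only if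
  the ratio grows fast enough, which is the effect of \<open>a = p * c\<close>.

  The passage to measures meets the obstacle that \<open>L j\<close> is only a limit of columns.
  Nonnegativity of its weights on all levels and the estimate of the mass outside its class are
  therefore first proved for \<open>dir m j\<close>, up to the end of the m-th block, with bounds
  that do not depend on \<open>m\<close>.\<close>

lemma ts_append:
  assumes "i \<notin> set A" shows "ts (A @ i # B) lam i = sum_list (map lam A)"
proof -
  have "takeWhile (\<lambda>j. j \<noteq> i) (A @ i # B) = A"
    using assms by (subst takeWhile_append2) auto
  then show ?thesis by (simp add: ts_def)
qed

lemma ins_after_append:
  "w \<notin> set P \<Longrightarrow> ins_after w l (P @ w # Q) = P @ w # l # Q"
  by (induction P) auto

lemma sum_list_map_fun_upd:
  "w \<notin> set A \<Longrightarrow> map (lam(w := v)) A = map lam A"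
  by (induction A) auto

text \<open>Both types of a Rauzy step have the same shape: the row ending in the winner is kept,
  in the other row the loser moves from the end to the place behind the winner.\<close>

lemma ts_rauzy_step:
  fixes lam :: "nat \<Rightarrow> real"
  assumes r1: "r1 = A @ [w]" and r2: "r2 = P @ w # Q @ [l]" and r3: "r3 = P @ w # l # Q"
    and d: "distinct r1" "distinct r2" and s: "set r1 = set r2"
    and lam': "lam' = lam(w := lam w - lam l)"
  shows "i \<in> set r1 \<Longrightarrow> ts r1 lam' i = ts r1 lam i"
    and "i \<in> set r1 \<Longrightarrow> i \<noteq> l \<Longrightarrow> ts r3 lam' i = ts r2 lam i"
    and "ts r3 lam' l = ts r2 lam w + lam' w"
    and "ts r2 lam l = ts r1 lam w + lam' w"
proof -
  have wA: "w \<notin> set A" "w \<notin> set P" "w \<notin> set Q" "w \<noteq> l" "l \<notin> set P" "l \<notin> set Q"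
    using d r1 r2 by auto
  have upd: "map lam' xs = map lam xs" if "w \<notin> set xs" for xs
    using that lam' by (simp add: sum_list_map_fun_upd)
  show "ts r1 lam' i = ts r1 lam i" if i: "i \<in> set r1"
  proof -
    obtain B C where B: "r1 = B @ i # C" "i \<notin> set B"
      using i by (meson split_list_first)
    then have "w \<notin> set B"
      using d(1) r1 by (metis butlast_append butlast_snoc in_set_butlastD list.distinct(1)
          append_is_Nil_conv wA(1) UnI1 set_append)
    then show ?thesis unfolding B(1) ts_append[OF B(2)] by (simp add: upd)
  qed
  show "ts r3 lam' l = ts r2 lam w + lam' w"
  proof -
    have "ts ((P @ [w]) @ l # Q) lam' l = sum_list (map lam' (P @ [w]))"
      using wA by (subst ts_append) auto
    then show ?thesis using wA by (simp add: r2 r3 ts_append upd)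
  qed
  \<comment> \<open>Both rows have the same total length, so the intervals of the two last letters
    end at the same point; \<open>lam' w\<close> is what remains of \<open>w\<close> once
    \<open>lam l\<close> is removed.\<close>
  show "ts r2 lam l = ts r1 lam w + lam' w"
  proof -
    have "ts ((P @ w # Q) @ [l]) lam l = sum_list (map lam (P @ w # Q))"
      using wA by (subst ts_append) auto
    moreover have "sum_list (map lam r1) = sum_list (map lam r2)"
      using d s by (simp add: sum_list_distinct_conv_sum_set)
    ultimately show ?thesis using wA by (simp add: r1 r2 ts_append lam')
  qed
  show "ts r3 lam' i = ts r2 lam i" if i: "i \<in> set r1" "i \<noteq> l"
  proof -
    have "i \<in> set P \<or> i = w \<or> i \<in> set Q" using i s r2 by auto
    then consider "i \<in> set P" | "i = w" | "i \<in> set Q" by blast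
    then show ?thesis
    proof cases
      case 1
      then obtain B C where B: "P = B @ i # C" "i \<notin> set B"
        by (meson split_list_first)
      have "w \<notin> set B" using B wA by auto
      then show ?thesis using B by (simp add: r2 r3 ts_append upd)
    next
      case 2 then show ?thesis using wA by (simp add: r2 r3 ts_append upd)
    next
      case 3
      then obtain B C where B: "Q = B @ i # C" "i \<notin> set B"
        by (meson split_list_first)
      have n: "i \<notin> set P" "i \<noteq> w" using 3 d(2) r2 by auto
      have "ts ((P @ w # l # B) @ i # C) lam' i = sum_list (map lam' (P @ w # l # B))"
        using n i B by (subst ts_append) auto
      moreover have "ts ((P @ w # B) @ i # C @ [l]) lam i = sum_list (map lam (P @ w # B))"
        using n i B by (subst ts_append) auto
      moreover have "w \<notin> set B" using B wA by auto
      ultimately show ?thesis using wA B by (simp add: r2 r3 upd) (simp add: lam')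
    qed
  qed
qed

lemma Xint_partition:
  fixes lam :: "nat \<Rightarrow> real"
  assumes "distinct rw" "\<And>i. i \<in> set rw \<Longrightarrow> lam i > 0"
  shows "(\<Union>i\<in>set rw. Xint rw lam i) = {0..<sum_list (map lam rw)}"
    and "disjoint_family_on (Xint rw lam) (set rw)"
  using assms
proof (induction rw rule: rev_induct)
  case Nil
  { case 1 then show ?case by simp next
    case 2 then show ?case by (simp add: disjoint_family_on_def) }
next
  case (snoc z xs)
  have eq: "Xint (xs @ [z]) lam i = Xint xs lam i" if i: "i \<in> set xs" for i
  proof -
    obtain B C where B: "xs = B @ i # C" "i \<notin> set B"
      using split_list_first[OF i] by blast
    then show ?thesis by (simp add: Xint_def ts_append)
  qed
  have eqz: "Xint (xs @ [z]) lam z = {sum_list (map lam xs)..<sum_list (map lam xs) + lam z}"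
    if "z \<notin> set xs"
    using that by (simp add: Xint_def ts_append)
  { case 1
    have "sum_list (map lam xs) \<ge> 0"
      using 1(2) by (intro sum_list_nonneg) (auto intro!: less_imp_le)
    moreover have "lam z > 0" using 1(2) by simp
    moreover have "(\<Union>i\<in>set xs. Xint xs lam i) = {0..<sum_list (map lam xs)}"
      using 1 by (intro snoc(1)) auto
    ultimately show ?case using eqz 1(1) eq by (auto)
  next
    case 2
    have u: "(\<Union>i\<in>set xs. Xint xs lam i) = {0..<sum_list (map lam xs)}"
      using 2 by (intro snoc(1)) auto
    have d: "disjoint_family_on (Xint xs lam) (set xs)"
      using 2 by (intro snoc(2)) auto
    have zx: "z \<notin> set xs" using 2(1) by simp
    have "Xint xs lam i \<inter> Xint (xs @ [z]) lam z = {}" if "i \<in> set xs" for i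
    proof -
      have "Xint xs lam i \<subseteq> {0..<sum_list (map lam xs)}" using u that by blast
      then show ?thesis unfolding eqz[OF zx] by fastforce
    qed
    then show ?case using d zx eq unfolding disjoint_family_on_def
      by (auto simp: Int_commute)  }
qed

section \<open>Floors\<close>

text \<open>\<open>b k i\<close> and \<open>d k i\<close> stand for the left end points of the i-th interval of the
  k-th induced map and of its image. The two cases of \<open>step\<close> are the two types of a Rauzy step.\<close>

locale tower =
  fixes I :: "'a set" and lam b d :: "nat \<Rightarrow> 'a \<Rightarrow> real" and w l :: "nat \<Rightarrow> 'a"
    and T :: "real \<Rightarrow> real"
  assumes fin: "finite I"
    and pos: "i \<in> I \<Longrightarrow> 0 < lam k i"
    and wI: "w k \<in> I" and lI: "l k \<in> I" and wl: "w k \<noteq> l k"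
    and lam_Suc: "lam (Suc k) = (lam k)(w k := lam k (w k) - lam k (l k))"
    and step:
      "((\<forall>i\<in>I. b (Suc k) i = b k i) \<and> (\<forall>i\<in>I - {l k}. d (Suc k) i = d k i) \<and>
         d (Suc k) (l k) = d k (w k) + lam (Suc k) (w k) \<and>
         d k (l k) = b k (w k) + lam (Suc k) (w k)) \<or>
       ((\<forall>i\<in>I. d (Suc k) i = d k i) \<and> (\<forall>i\<in>I - {l k}. b (Suc k) i = b k i) \<and>
         b (Suc k) (l k) = b k (w k) + lam (Suc k) (w k) \<and>
         b k (l k) = d k (w k) + lam (Suc k) (w k))"
    and dom: "(\<Union>i\<in>I. {b 0 i..<b 0 i + lam 0 i}) = {0..<1}"
      "disjoint_family_on (\<lambda>i. {b 0 i..<b 0 i + lam 0 i}) I"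
    and img: "(\<Union>i\<in>I. {d 0 i..<d 0 i + lam 0 i}) = {0..<1}"
      "disjoint_family_on (\<lambda>i. {d 0 i..<d 0 i + lam 0 i}) I"
    and T: "i \<in> I \<Longrightarrow> x \<in> {b 0 i..<b 0 i + lam 0 i} \<Longrightarrow> T x = x + (d 0 i - b 0 i)"
    and small: "i \<in> I \<Longrightarrow> (\<lambda>k. lam k i) \<longlonglongrightarrow> 0"
begin

lemma lam_other: "j \<noteq> w k \<Longrightarrow> lam (Suc k) j = lam k j"
  by (simp add: lam_Suc)

lemma lam_split: "lam k (w k) = lam (Suc k) (w k) + lam (Suc k) (l k)"
  using wl[of k] by (simp add: lam_Suc)

lemma lam_Suc_le: "lam (Suc k) i \<le> lam k i"
  using pos[OF lI, of k k] by (simp add: lam_Suc)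

text \<open>A pair \<open>(u, j)\<close> stands for the floor from \<open>u\<close> to
  \<open>u + lam k j\<close>. The length is not stored, so the left part of a split floor keeps its
  old pair and shrinks with \<open>lam\<close>; only the right part, now of the loser, has to be
  added.\<close>

primrec fl :: "nat \<Rightarrow> (real \<times> 'a) set" where
  "fl 0 = (\<lambda>i. (b 0 i, i)) ` I"
| "fl (Suc k) = fl k \<union> (\<lambda>f. (fst f + lam (Suc k) (w k), l k)) ` {f \<in> fl k. snd f = w k}"

lemma fl_mono: "f \<in> fl k \<Longrightarrow> f \<in> fl (Suc k)"
  by simp

lemma fl_new: "(u, w k) \<in> fl k \<Longrightarrow> (u + lam (Suc k) (w k), l k) \<in> fl (Suc k)"
  by force

lemma fl_Suc_cases:
  assumes "(u, j) \<in> fl (Suc k)"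
  obtains "(u, j) \<in> fl k"
  | v where "(v, w k) \<in> fl k" "u = v + lam (Suc k) (w k)" "j = l k"
  using assms by auto

lemma fl_I: "(u, j) \<in> fl k \<Longrightarrow> j \<in> I"
  by (induction k arbitrary: u j) (auto simp: lI)

lemma finite_fl: "finite (fl k)"
  by (induction k) (auto simp: fin)

lemma fl_bounds: "(u, j) \<in> fl k \<Longrightarrow> 0 \<le> u \<and> u + lam k j \<le> 1"
proof (induction k arbitrary: u j)
  case 0
  then have j: "j \<in> I" "u = b 0 j" by auto
  then have "{u..<u + lam 0 j} \<subseteq> {0..<1}" using dom by blast
  moreover have "u < u + lam 0 j" using pos[OF j(1)] by simp
  ultimately show ?case by (simp add: atLeastLessThan_subset_iff)
next
  case (Suc k)
  from Suc.prems show ?case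
  proof (cases rule: fl_Suc_cases)
    case 1 then show ?thesis using Suc.IH[OF 1] lam_Suc_le[of k j] by simp
  next
    case (2 v) then show ?thesis
      using Suc.IH[OF 2(1)] lam_split[of k] pos[OF wI, of "Suc k" k] pos[OF lI, of "Suc k" k] by simp
  qed
qed

lemma fl_cover: "x \<in> {0..<1} \<Longrightarrow> \<exists>u j. (u, j) \<in> fl k \<and> u \<le> x \<and> x < u + lam k j"
proof (induction k)
  case 0
  then have "x \<in> (\<Union>i\<in>I. {b 0 i..<b 0 i + lam 0 i})" unfolding dom(1) .
  then obtain i where "i \<in> I" "b 0 i \<le> x" "x < b 0 i + lam 0 i" by auto
  then show ?case by (intro exI[of _ "b 0 i"] exI[of _ i]) simp
next
  case (Suc k)
  then obtain u j where uj: "(u, j) \<in> fl k" "u \<le> x" "x < u + lam k j" by blast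
  show ?case
  proof (cases "j = w k \<and> u + lam (Suc k) (w k) \<le> x")
    case True
    then have "(u + lam (Suc k) (w k), l k) \<in> fl (Suc k)" using fl_new uj by blast
    then show ?thesis using True uj lam_split[of k] by (intro exI[of _ "u + lam (Suc k) (w k)"] exI[of _ "l k"]) auto
  next
    case False
    then have "x < u + lam (Suc k) j" using uj lam_other[of j k] by (cases "j = w k") auto
    then show ?thesis using uj fl_mono by blast
  qed
qed

lemma fl_disj:
  assumes "(u, j) \<in> fl k" "(v, i) \<in> fl k" "u \<le> x" "x < u + lam k j" "v \<le> x" "x < v + lam k i"
  shows "u = v \<and> j = i"
  using assms
proof (induction k arbitrary: u j v i)
  case 0
  then have j: "j \<in> I" "i \<in> I" "u = b 0 j" "v = b 0 i" by auto
  have "j = i"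
  proof (rule ccontr)
    assume "j \<noteq> i"
    then have "{b 0 j..<b 0 j + lam 0 j} \<inter> {b 0 i..<b 0 i + lam 0 i} = {}"
      using dom(2) j unfolding disjoint_family_on_def by blast
    moreover have "x \<in> {b 0 j..<b 0 j + lam 0 j} \<inter> {b 0 i..<b 0 i + lam 0 i}"
      using 0 j by auto
    ultimately show False by blast
  qed
  then show ?case using j by simp
next
  case (Suc k)
  note sp = lam_split[of k] and p = pos[OF wI, of "Suc k" k] pos[OF lI, of "Suc k" k]
  from Suc.prems(1) show ?case
  proof (cases rule: fl_Suc_cases)
    case 1
    have xu: "x < u + lam k j" using Suc.prems lam_Suc_le[of k j] by simp
    from Suc.prems(2) show ?thesis
    proof (cases rule: fl_Suc_cases)
      case 1
      then show ?thesis using Suc.IH[of u j v i] Suc.prems xu \<open>(u, j) \<in> fl k\<close> lam_Suc_le[of k i]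
        by simp
    next
      case (2 v')
      then have "u = v' \<and> j = w k"
        using Suc.IH[of u j v' "w k"] Suc.prems xu \<open>(u, j) \<in> fl k\<close> sp p by simp
      then show ?thesis using 2 Suc.prems by simp
    qed
  next
    case (2 u')
    from Suc.prems(2) show ?thesis
    proof (cases rule: fl_Suc_cases)
      case 1
      then have "u' = v \<and> i = w k"
        using Suc.IH[of u' "w k" v i] Suc.prems 2 sp p lam_Suc_le[of k i] by simp
      then show ?thesis using 2 Suc.prems by simp
    next
      case (2 v')
      then show ?thesis
        using Suc.IH[of u' "w k" v' "w k"] Suc.prems \<open>(u', w k) \<in> fl k\<close> sp p \<open>u = _\<close> \<open>j = l k\<close> by simp
    qed
  qed
qed

lemma fl_order:
  assumes "(u, j) \<in> fl k" "(v, i) \<in> fl k"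
  shows "(u = v \<and> j = i) \<or> u + lam k j \<le> v \<or> v + lam k i \<le> u"
  using fl_disj[OF assms, of "max u v"] pos[OF fl_I[OF assms(1)], of k] pos[OF fl_I[OF assms(2)], of k]
  by (auto simp: max_def split: if_splits)

lemma sum_fl_Suc:
  fixes g :: "real \<times> 'a \<Rightarrow> real"
  shows "(\<Sum>f\<in>fl (Suc k). g f) =
    (\<Sum>(u,j)\<in>fl k. g (u, j) + (if j = w k then g (u + lam (Suc k) (w k), l k) else 0))"
proof -
  let ?h = "\<lambda>f. (fst f + lam (Suc k) (w k), l k)"
  have inj: "inj_on ?h {f \<in> fl k. snd f = w k}"
    by (auto simp: inj_on_def)
  \<comment> \<open>A new left end point lies in the interior of an old floor, so no old floor can
    start there.\<close>
  have dis: "fl k \<inter> ?h ` {f \<in> fl k. snd f = w k} = {}"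
  proof (rule ccontr)
    assume "\<not> ?thesis"
    then obtain u where u: "(u, w k) \<in> fl k" "(u + lam (Suc k) (w k), l k) \<in> fl k" by auto
    show False
      using fl_order[OF u] wl[of k] lam_split[of k] pos[OF wI, of "Suc k" k] pos[OF lI, of "Suc k" k]
        lam_other[of "l k" k] pos[OF lI, of k k] by auto
  qed
  have "(\<Sum>f\<in>fl (Suc k). g f) = (\<Sum>f\<in>fl k. g f) + (\<Sum>f\<in>?h ` {f \<in> fl k. snd f = w k}. g f)"
    using dis finite_fl by (simp add: sum.union_disjoint)
  also have "(\<Sum>f\<in>?h ` {f \<in> fl k. snd f = w k}. g f) = (\<Sum>f\<in>{f \<in> fl k. snd f = w k}. g (?h f))"
    using inj by (simp add: sum.reindex)
  also have "\<dots> = (\<Sum>f\<in>fl k. if snd f = w k then g (?h f) else 0)"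
    using finite_fl by (simp add: sum.inter_filter)
  finally show ?thesis by (simp add: sum.distrib split_def)
qed

lemma base_fl: "i \<in> I \<Longrightarrow> (b k i, i) \<in> fl k"
proof (induction k arbitrary: i)
  case (Suc k)
  show ?case
  proof (cases "b (Suc k) i = b k i")
    case True then show ?thesis using Suc fl_mono by metis
  next
    case False
    then have "i = l k" "b (Suc k) (l k) = b k (w k) + lam (Suc k) (w k)"
      using step[of k] Suc.prems by auto
    then show ?thesis using fl_new[of "b k (w k)" k] Suc.IH[OF wI] by simp
  qed
qed simp

text \<open>The recursion of the lengths, run from an arbitrary start vector. Nothing keeps it
  nonnegative: nonnegativity at every level is the condition under which
  \<open>exists_inv_prob\<close> produces a measure.\<close>

primrec sub :: "nat \<Rightarrow> ('a \<Rightarrow> real) \<Rightarrow> 'a \<Rightarrow> real" where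
  "sub 0 y = y"
| "sub (Suc k) y = (sub k y)(w k := sub k y (w k) - sub k y (l k))"

lemma sub_split: "sub k y (w k) = sub (Suc k) y (w k) + sub (Suc k) y (l k)"
  using wl[of k] by simp

lemma sub_other: "j \<noteq> w k \<Longrightarrow> sub (Suc k) y j = sub k y j"
  by simp

lemma sub_cong: "(\<And>i. i \<in> I \<Longrightarrow> y i = z i) \<Longrightarrow> i \<in> I \<Longrightarrow> sub k y i = sub k z i"
  by (induction k arbitrary: i) (auto simp: wI lI)

lemma sub_tendsto:
  "(\<And>i. i \<in> I \<Longrightarrow> ((\<lambda>m. y m i) \<longlongrightarrow> z i) F) \<Longrightarrow> i \<in> I \<Longrightarrow> ((\<lambda>m. sub k (y m) i) \<longlongrightarrow> sub k z i) F"
  by (induction k arbitrary: i) (auto simp: wI lI intro!: tendsto_diff)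

text \<open>A step is undone by adding the loser's entry to the winner's, and this keeps nonnegative
  entries nonnegative. It provides start vectors whose weights are prescribed at a late level, as
  needed for the columns in \<open>sub_dir\<close>.\<close>

lemma sub_surj:
  "\<exists>y. sub K y = x \<and> ((\<forall>i\<in>I. 0 \<le> x i) \<longrightarrow> (\<forall>k\<le>K. \<forall>i\<in>I. 0 \<le> sub k y i))"
proof (induction K arbitrary: x)
  case (Suc K)
  define x' where "x' = x(w K := x (w K) + x (l K))"
  obtain y where y: "sub K y = x'" "(\<forall>i\<in>I. 0 \<le> x' i) \<longrightarrow> (\<forall>k\<le>K. \<forall>i\<in>I. 0 \<le> sub k y i)"
    using Suc.IH by blast
  have x: "sub (Suc K) y = x"
    using y(1) wl[of K] by (auto simp: x'_def)
  have "\<forall>k\<le>Suc K. \<forall>i\<in>I. 0 \<le> sub k y i" if nn: "\<forall>i\<in>I. 0 \<le> x i"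
  proof -
    have "\<forall>i\<in>I. 0 \<le> x' i" using nn wI lI by (auto simp: x'_def)
    then show ?thesis using y(2) x nn by (auto simp only: le_Suc_eq)
  qed
  then show ?case using x by blast
qed auto

end

section \<open>Invariant measures and their weights\<close>

context tower begin

abbreviation "U01 \<equiv> restrict_space borel {0..<1::real}"

lemma U01_sets: "A \<in> sets U01 \<longleftrightarrow> A \<in> sets borel \<and> A \<subseteq> {0..<1}"
  by (auto simp: sets_restrict_space_iff)

lemma T_maps: "x \<in> {0..<1} \<Longrightarrow> T x \<in> {0..<1}"
proof -
  assume "x \<in> {0..<1}"
  then have "x \<in> (\<Union>i\<in>I. {b 0 i..<b 0 i + lam 0 i})" unfolding dom(1) .
  then obtain i where i: "i \<in> I" "x \<in> {b 0 i..<b 0 i + lam 0 i}" by blast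
  then have "T x \<in> {d 0 i..<d 0 i + lam 0 i}" by (subst T[OF i]) auto
  then show ?thesis using i img(1) by blast
qed

lemma T_measurable: "T \<in> measurable U01 U01"
proof -
  let ?f = "\<lambda>x. x + (\<Sum>i\<in>I. indicator {b 0 i..<b 0 i + lam 0 i} x * (d 0 i - b 0 i))"
  have eq: "T x = ?f x" if x: "x \<in> {0..<1}" for x
  proof -
    have "x \<in> (\<Union>i\<in>I. {b 0 i..<b 0 i + lam 0 i})" using x unfolding dom(1) .
    then obtain i where i: "i \<in> I" "x \<in> {b 0 i..<b 0 i + lam 0 i}" by blast
    have "(\<Sum>j\<in>I. indicator {b 0 j..<b 0 j + lam 0 j} x * (d 0 j - b 0 j)) =
        (\<Sum>j\<in>I. if j = i then d 0 j - b 0 j else 0)"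
    proof (rule sum.cong)
      fix j assume j: "j \<in> I"
      have "x \<notin> {b 0 j..<b 0 j + lam 0 j}" if "j \<noteq> i"
        using dom(2) i j that unfolding disjoint_family_on_def by blast
      then show "indicator {b 0 j..<b 0 j + lam 0 j} x * (d 0 j - b 0 j) =
          (if j = i then d 0 j - b 0 j else 0)"
        using i by auto
    qed simp
    then show ?thesis using T[OF i] i(1) fin by simp
  qed
  have "?f \<in> measurable U01 borel"
    by (intro measurable_restrict_space1) measurable
  then have "T \<in> measurable U01 borel"
    by (subst measurable_cong[of _ _ ?f]) (auto simp: eq space_restrict_space)
  then show ?thesis
    by (intro measurable_restrict_space2) (use T_maps in \<open>auto simp: space_restrict_space\<close>)
qed

lemma T_preimage:
  assumes i: "i \<in> I" and st: "0 \<le> s" "t \<le> lam 0 i"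
  shows "T -` {d 0 i + s..<d 0 i + t} \<inter> {0..<1} = {b 0 i + s..<b 0 i + t}"
proof (intro equalityI subsetI)
  fix x assume x: "x \<in> T -` {d 0 i + s..<d 0 i + t} \<inter> {0..<1}"
  then have "x \<in> (\<Union>i\<in>I. {b 0 i..<b 0 i + lam 0 i})" unfolding dom(1) by simp
  then obtain j where j: "j \<in> I" "x \<in> {b 0 j..<b 0 j + lam 0 j}" by blast
  then have Tx: "T x = x + (d 0 j - b 0 j)" "T x \<in> {d 0 j..<d 0 j + lam 0 j}"
    using T[OF j] by auto
  moreover have "T x \<in> {d 0 i..<d 0 i + lam 0 i}" using x st by auto
  ultimately have "i = j"
    using img(2) i j unfolding disjoint_family_on_def by blast
  then show "x \<in> {b 0 i + s..<b 0 i + t}" using Tx x by auto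
next
  fix x assume x: "x \<in> {b 0 i + s..<b 0 i + t}"
  then have xi: "x \<in> {b 0 i..<b 0 i + lam 0 i}" using st by auto
  then have "x \<in> {0..<1}" using dom(1) i by blast
  then show "x \<in> T -` {d 0 i + s..<d 0 i + t} \<inter> {0..<1}" using T[OF i xi] x by auto
qed

context
  fixes \<nu> :: "real measure"
  assumes inv: "inv_prob T \<nu>"
begin

lemma sets_\<nu>: "sets \<nu> = sets U01" and space_\<nu>: "space \<nu> = {0..<1}"
  using inv sets_eq_imp_space_eq[of \<nu> U01] by (auto simp: inv_prob_def space_restrict_space)

lemma prob_\<nu>: "prob_space \<nu>"
  using inv by (simp add: inv_prob_def)

lemma interval_in_\<nu>: "0 \<le> x \<Longrightarrow> y \<le> 1 \<Longrightarrow> {x..<y} \<in> sets \<nu>"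
  by (auto simp: sets_\<nu> U01_sets)

text \<open>Induction on the level: the measure is invariant under the map induced on the base of level
  k, which translates the base interval at \<^term>\<open>b k i\<close> to the one at \<^term>\<open>d k i\<close>.\<close>

lemma measure_induced:
  assumes "i \<in> I" "0 \<le> s" "t \<le> lam k i"
  shows "measure \<nu> {b k i + s..<b k i + t} = measure \<nu> {d k i + s..<d k i + t}"
  using assms
proof (induction k arbitrary: i s t)
  case 0
  have "{d 0 i + s..<d 0 i + t} \<subseteq> {d 0 i..<d 0 i + lam 0 i}" using 0 by auto
  also have "\<dots> \<subseteq> {0..<1}" using img(1) 0 by blast
  finally have "{d 0 i + s..<d 0 i + t} \<in> sets \<nu>" by (auto simp: sets_\<nu> U01_sets)
  then have "emeasure \<nu> (T -` {d 0 i + s..<d 0 i + t} \<inter> space \<nu>) = emeasure \<nu> {d 0 i + s..<d 0 i + t}"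
    using inv by (simp add: inv_prob_def)
  then show ?case using T_preimage[OF 0] by (simp add: space_\<nu> measure_def)
next
  case (Suc k)
  note sp = lam_split[of k] and p = pos[OF wI, of "Suc k" k] pos[OF lI, of "Suc k" k]
  show ?case
  proof (cases "i = l k")
    case False
    then have "b (Suc k) i = b k i" "d (Suc k) i = d k i" using step[of k] Suc.prems by auto
    then show ?thesis using Suc.IH[of i s t] Suc.prems lam_Suc_le[of k i] by simp
  next
    case True
    \<comment> \<open>The translation of the loser's new interval is composed of two translations of
      level \<open>k\<close>: in the first case that of the loser, which lands at
      \<open>b k (w k) + ?c\<close>, followed by that of the winner; in the second case the winner's
      comes first.\<close>
    let ?c = "lam (Suc k) (w k)"
    have lk: "lam (Suc k) (l k) = lam k (l k)" using lam_other[of "l k" k] wl[of k] by auto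
    have 1: "measure \<nu> {b k (l k) + s..<b k (l k) + t} = measure \<nu> {d k (l k) + s..<d k (l k) + t}"
      using Suc.IH[OF lI, of s t] Suc.prems True lk by simp
    have 2: "measure \<nu> {b k (w k) + (?c + s)..<b k (w k) + (?c + t)} =
        measure \<nu> {d k (w k) + (?c + s)..<d k (w k) + (?c + t)}"
      using Suc.IH[OF wI, of "?c + s" "?c + t"] Suc.prems True sp p by simp
    from step[of k] show ?thesis
      by (elim disjE conjE) (use 1 2 True lI[of k] in \<open>simp_all add: add.assoc\<close>)
  qed
qed

text \<open>Iterates of \<open>T\<close> are avoided: a new floor of the loser is the right part of
  a floor of the winner, so by induction it has the mass of the right part of the winner's base, and
  \<open>measure_induced\<close> compares this part with the loser's base.\<close>

lemma measure_floor:
  assumes "(u, j) \<in> fl k" "0 \<le> s" "t \<le> lam k j"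
  shows "measure \<nu> {u + s..<u + t} = measure \<nu> {b k j + s..<b k j + t}"
  using assms
proof (induction k arbitrary: u j s t)
  case 0
  then show ?case by auto
next
  case (Suc k)
  let ?c = "lam (Suc k) (w k)"
  note sp = lam_split[of k] and p = pos[OF wI, of "Suc k" k] pos[OF lI, of "Suc k" k]
  have lk: "lam (Suc k) (l k) = lam k (l k)" using lam_other[of "l k" k] wl[of k] by auto
  have l': "measure \<nu> {b k (w k) + (?c + s)..<b k (w k) + (?c + t)} =
      measure \<nu> {b (Suc k) (l k) + s..<b (Suc k) (l k) + t}"
    "measure \<nu> {b k (l k) + s..<b k (l k) + t} =
      measure \<nu> {b (Suc k) (l k) + s..<b (Suc k) (l k) + t}"
    if st: "0 \<le> s" "t \<le> lam (Suc k) (l k)"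
  proof -
    have 1: "measure \<nu> {b k (l k) + s..<b k (l k) + t} = measure \<nu> {d k (l k) + s..<d k (l k) + t}"
      using measure_induced[OF lI, of s t k k] st lk by simp
    have 2: "measure \<nu> {b k (w k) + (?c + s)..<b k (w k) + (?c + t)} =
        measure \<nu> {d k (w k) + (?c + s)..<d k (w k) + (?c + t)}"
      using measure_induced[OF wI, of "?c + s" "?c + t" k k] st sp p by simp
    have 3: "measure \<nu> {b k (w k) + (?c + s)..<b k (w k) + (?c + t)} =
      measure \<nu> {b (Suc k) (l k) + s..<b (Suc k) (l k) + t} \<and>
     measure \<nu> {b k (l k) + s..<b k (l k) + t} =
      measure \<nu> {b (Suc k) (l k) + s..<b (Suc k) (l k) + t}"
      using step[of k]
      by (elim disjE conjE) (use 1 2 lI[of k] in \<open>simp_all add: add.assoc\<close>)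
    then show "measure \<nu> {b k (w k) + (?c + s)..<b k (w k) + (?c + t)} =
      measure \<nu> {b (Suc k) (l k) + s..<b (Suc k) (l k) + t}"
    "measure \<nu> {b k (l k) + s..<b k (l k) + t} =
      measure \<nu> {b (Suc k) (l k) + s..<b (Suc k) (l k) + t}" by blast+
  qed
  from Suc.prems(1) show ?case
  proof (cases rule: fl_Suc_cases)
    case 1
    have IH: "measure \<nu> {u + s..<u + t} = measure \<nu> {b k j + s..<b k j + t}"
      using Suc.IH[OF 1, of s t] Suc.prems lam_Suc_le[of k j] by simp
    show ?thesis
    proof (cases "j = l k")
      case True then show ?thesis using IH l' Suc.prems by simp
    next
      case False
      then have "b (Suc k) j = b k j" using step[of k] fl_I[OF 1] by auto
      then show ?thesis using IH by simp
    qed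
  next
    case (2 v)
    then show ?thesis using Suc.IH[OF 2(1), of "?c + s" "?c + t"] l' Suc.prems sp p
      by (simp add: add.assoc)
  qed
qed

lemma measure_base:
  "i \<in> I \<Longrightarrow> measure \<nu> {b k i..<b k i + lam k i} = sub k (\<lambda>i. measure \<nu> {b 0 i..<b 0 i + lam 0 i}) i"
proof (induction k arbitrary: i)
  case (Suc k)
  interpret prob_space \<nu> by (rule prob_\<nu>)
  let ?y = "\<lambda>i. measure \<nu> {b 0 i..<b 0 i + lam 0 i}"
  have other: "measure \<nu> {b (Suc k) i..<b (Suc k) i + lam (Suc k) i} = sub k ?y i"
    if "i \<in> I" "i \<noteq> w k" for i
  proof -
    have "measure \<nu> {b k i + 0..<b k i + lam (Suc k) i} =
        measure \<nu> {b (Suc k) i + 0..<b (Suc k) i + lam (Suc k) i}"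
      by (rule measure_floor) (use base_fl that fl_mono in auto)
    then show ?thesis using Suc.IH[OF that(1)] lam_other[OF that(2)] by simp
  qed
  show ?case
  proof (cases "i = w k")
    case False then show ?thesis using other[of i] Suc.prems by simp
  next
    case True
    note p = pos[OF wI, of "Suc k" k] pos[OF lI, of "Suc k" k] and sp = lam_split[of k]
    let ?u = "b k (w k)" and ?c = "lam (Suc k) (w k)"
    have m1: "(?u, w k) \<in> fl (Suc k)" "(?u + ?c, l k) \<in> fl (Suc k)"
      using base_fl[OF wI, of k k] fl_new fl_mono by blast+
    have fb: "0 \<le> ?u" "?u + lam k (w k) \<le> 1" using fl_bounds[OF base_fl[OF wI, of k k]] by auto
    have "sub k ?y (w k) = measure \<nu> {?u..<?u + lam k (w k)}"
      using Suc.IH[OF wI] by simp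
    also have "{?u..<?u + lam k (w k)} = {?u..<?u + ?c} \<union> {?u + ?c..<?u + ?c + lam (Suc k) (l k)}"
      using p sp by auto
    also have "measure \<nu> \<dots> = measure \<nu> {?u..<?u + ?c} + measure \<nu> {?u + ?c..<?u + ?c + lam (Suc k) (l k)}"
      using fb sp p by (intro finite_measure_Union interval_in_\<nu>) auto
    also have "measure \<nu> {?u + ?c..<?u + ?c + lam (Suc k) (l k)} = sub k ?y (l k)"
      using measure_floor[OF m1(2), of 0 "lam (Suc k) (l k)"] other[OF lI] wl[of k] by simp
    also have "measure \<nu> {?u..<?u + ?c} = measure \<nu> {b (Suc k) i..<b (Suc k) i + lam (Suc k) i}"
      using measure_floor[OF m1(1), of 0 ?c] True by simp
    finally show ?thesis using True by simp
  qed
qed simp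

lemma measure_floor_sub:
  "(u, j) \<in> fl k \<Longrightarrow>
    measure \<nu> {u..<u + lam k j} = sub k (\<lambda>i. measure \<nu> {b 0 i..<b 0 i + lam 0 i}) j"
  using measure_floor[of u j k 0 "lam k j"] measure_base[of j k] fl_I by simp

end

lemma floors_small:
  assumes "e > 0" shows "\<forall>\<^sub>F k in sequentially. \<forall>i\<in>I. lam k i < e"
  using fin small assms by (auto intro!: eventually_ball_finite order_tendstoD(2))

text \<open>Half-lines determine a measure, and the part of the unit interval to the right of
  \<open>x\<close> is the increasing union of the floors that start to the right of
  \<open>x\<close>, because the floor lengths tend to 0.\<close>

lemma measure_eqI_floors:
  assumes M: "sets M = sets U01" "sets N = sets U01" and f: "finite_measure M" "finite_measure N"
    and eq: "\<And>k u j. (u, j) \<in> fl k \<Longrightarrow> measure M {u..<u + lam k j} = measure N {u..<u + lam k j}"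
  shows "M = N"
proof -
  define A where "A x k = (\<Union>(u,j)\<in>{f \<in> fl k. x < fst f}. {u..<u + lam k j})" for x k
  have sp: "space M = {0..<1}" "space N = {0..<1}"
    using sets_eq_imp_space_eq[OF M(1)] sets_eq_imp_space_eq[OF M(2)]
    by (auto simp: space_restrict_space)
  have A_sum: "measure P (A x k) = (\<Sum>(u,j)\<in>{f \<in> fl k. x < fst f}. measure P {u..<u + lam k j})"
    if P: "sets P = sets U01" "finite_measure P" for P x k
  proof -
    interpret finite_measure P by (rule P(2))
    have dj: "disjoint_family_on (\<lambda>(u, j). {u..<u + lam k j}) {f \<in> fl k. x < fst f}"
    proof (unfold disjoint_family_on_def, intro ballI impI)
      fix f g assume fg: "f \<in> {f \<in> fl k. x < fst f}" "g \<in> {f \<in> fl k. x < fst f}" "f \<noteq> g"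
      obtain u j v i where [simp]: "f = (u, j)" "g = (v, i)" by (cases f, cases g)
      show "(case f of (u, j) \<Rightarrow> {u..<u + lam k j}) \<inter> (case g of (u, j) \<Rightarrow> {u..<u + lam k j}) = {}"
        using fl_order[of u j k v i] fg by auto
    qed
    have "(\<lambda>(u, j). {u..<u + lam k j}) ` {f \<in> fl k. x < fst f} \<subseteq> sets P"
      using fl_bounds by (fastforce simp: P(1) U01_sets)
    then show ?thesis unfolding A_def
      using finite_measure_finite_Union[OF _ _ dj] finite_fl[of k] by (simp add: split_def)
  qed
  have A_lim: "(\<lambda>k. measure P (A x k)) \<longlonglongrightarrow> measure P ({x<..} \<inter> {0..<1})"
    if P: "sets P = sets U01" "finite_measure P" for P x
  proof -
    interpret finite_measure P by (rule P(2))
    have "range (A x) \<subseteq> sets P"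
    proof -
      have "A x k \<subseteq> {0..<1}" for k using fl_bounds unfolding A_def by fastforce
      moreover have "A x k \<in> sets borel" for k unfolding A_def using finite_fl[of k]
        by (intro sets.finite_UN) auto
      ultimately show ?thesis by (auto simp: P(1) U01_sets)
    qed
    moreover have "incseq (A x)"
    proof (rule incseq_SucI, rule subsetI)
      fix k y assume "y \<in> A x k"
      then obtain u j where uj: "(u, j) \<in> fl k" "x < u" "u \<le> y" "y < u + lam k j"
        by (auto simp: A_def)
      have "y \<in> {0..<1}" using fl_bounds[OF uj(1)] uj by auto
      then obtain v i where vi: "(v, i) \<in> fl (Suc k)" "v \<le> y" "y < v + lam (Suc k) i"
        using fl_cover by blast
      from vi(1) have "x < v"
      proof (cases rule: fl_Suc_cases)
        case 1
        then show ?thesis using fl_disj[OF uj(1) 1, of y] vi uj lam_Suc_le[of k i] by simp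
      next
        case (2 u')
        then show ?thesis using fl_disj[OF uj(1) 2(1), of y] vi uj lam_split[of k]
            pos[OF wI, of "Suc k" k] by simp
      qed
      then have "(v, i) \<in> {f \<in> fl (Suc k). x < fst f}" using vi(1) by (simp del: fl.simps)
      then show "y \<in> A x (Suc k)" using vi(2,3) unfolding A_def by (intro UN_I[of "(v, i)"]) auto
    qed
    moreover have "(\<Union>k. A x k) = {x<..} \<inter> {0..<1}"
    proof (intro equalityI subsetI)
      fix y assume "y \<in> (\<Union>k. A x k)"
      then show "y \<in> {x<..} \<inter> {0..<1}" using fl_bounds unfolding A_def by fastforce
    next
      fix y assume y: "y \<in> {x<..} \<inter> {0..<1}"
      then obtain k where k: "\<forall>i\<in>I. lam k i < y - x"
        using floors_small[of "y - x"] by (auto simp: eventually_sequentially)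
      obtain v i where vi: "(v, i) \<in> fl k" "v \<le> y" "y < v + lam k i"
        using fl_cover[of y k] y by auto
      then have "x < v" using k fl_I[OF vi(1)] by force
      then show "y \<in> (\<Union>k. A x k)" using vi unfolding A_def by force
    qed
    ultimately show ?thesis using finite_Lim_measure_incseq by metis
  qed
  have key: "measure M ({x<..} \<inter> {0..<1}) = measure N ({x<..} \<inter> {0..<1})" for x
  proof (rule LIMSEQ_unique[OF A_lim])
    have "measure M (A x k) = measure N (A x k)" for k
      using M f eq by (auto simp: A_sum split_def intro!: sum.cong)
    then show "(\<lambda>k. measure M (A x k)) \<longlonglongrightarrow> measure N ({x<..} \<inter> {0..<1})"
      using A_lim[OF M(2) f(2)] by simp
  qed (use M f in auto)
  have meas: "(\<lambda>x. x) \<in> measurable P borel" if "sets P = sets U01" for P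
    unfolding measurable_cong_sets[OF that refl] by (intro measurable_restrict_space1) simp
  let ?M = "distr M borel (\<lambda>x. x)" and ?N = "distr N borel (\<lambda>x. x)"
  have em: "emeasure (distr P borel (\<lambda>x. x)) A = emeasure P (A \<inter> space P)"
    if "sets P = sets U01" "A \<in> sets borel" for P A
    using meas[OF that(1)] that(2) by (simp add: emeasure_distr)
  interpret M: finite_measure M by fact
  interpret N: finite_measure N by fact
  have "?M = ?N"
  proof (rule measure_eqI_lessThan)
    fix x
    show "emeasure ?M {x<..} < \<infinity>"
      by (simp add: em[OF M(1)] M.emeasure_eq_measure)
    show "emeasure ?M {x<..} = emeasure ?N {x<..}"
      using key[of x] by (simp add: em[OF M(1)] em[OF M(2)] sp M.emeasure_eq_measure N.emeasure_eq_measure)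
  qed auto
  show "M = N"
  proof (rule measure_eqI)
    fix A assume A: "A \<in> sets M"
    then have "A \<in> sets borel" "A \<subseteq> {0..<1}" using M by (auto simp: U01_sets)
    then show "emeasure M A = emeasure N A"
      using em[OF M(1), of A] em[OF M(2), of A] \<open>?M = ?N\<close> sp by (simp add: Int_absorb2)
  qed (use M in simp)
qed

lemma inv_prob_eqI:
  assumes "inv_prob T M" "inv_prob T N"
    and eq: "\<And>i. i \<in> I \<Longrightarrow> measure M {b 0 i..<b 0 i + lam 0 i} = measure N {b 0 i..<b 0 i + lam 0 i}"
  shows "M = N"
proof (rule measure_eqI_floors)
  show "sets M = sets U01" "sets N = sets U01" "finite_measure M" "finite_measure N"
    using assms prob_space.finite_measure by (auto simp: inv_prob_def)
  fix k u j assume uj: "(u, j) \<in> fl k"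
  show "measure M {u..<u + lam k j} = measure N {u..<u + lam k j}"
    using measure_floor_sub[OF assms(1) uj] measure_floor_sub[OF assms(2) uj]
      sub_cong[of "\<lambda>i. measure M {b 0 i..<b 0 i + lam 0 i}" "\<lambda>i. measure N {b 0 i..<b 0 i + lam 0 i}" j k]
      eq fl_I[OF uj] by simp
qed

end

section \<open>Existence of the measure with given weights\<close>

context tower begin

section \<open>Motion of the floors under \<open>T\<close>\<close>

definition shifts :: "real \<Rightarrow> real \<Rightarrow> real \<Rightarrow> bool" where
  "shifts len v u \<longleftrightarrow> (\<forall>x. v \<le> x \<longrightarrow> x < v + len \<longrightarrow> T x = x - v + u)"

lemma shifts_left: "shifts len v u \<Longrightarrow> len' \<le> len \<Longrightarrow> shifts len' v u"
  by (auto simp: shifts_def)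

lemma shifts_right: "shifts len v u \<Longrightarrow> 0 \<le> s \<Longrightarrow> len' + s \<le> len \<Longrightarrow> shifts len' (v + s) (u + s)"
  by (auto simp: shifts_def)

text \<open>The interval at \<open>d k j\<close> is reached by one application of \<open>T\<close>
  from the last floor of the tower over \<open>j\<close>. When it changes, it becomes the right part
  of the winner's image, and the floor leading to it is the right part of the winner's top
  floor.\<close>

lemma top_floor: "j \<in> I \<Longrightarrow> \<exists>u. (u, j) \<in> fl k \<and> shifts (lam k j) u (d k j)"
proof (induction k arbitrary: j)
  case 0
  then show ?case using T by (intro exI[of _ "b 0 j"]) (auto simp: shifts_def)
next
  case (Suc k)
  note p = pos[OF wI, of "Suc k" k] and sp = lam_split[of k]
  show ?case
  proof (cases "d (Suc k) j = d k j")
    case True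
    then show ?thesis using Suc.IH[OF Suc.prems] fl_mono shifts_left lam_Suc_le by metis
  next
    case False
    then have j: "j = l k" "d (Suc k) (l k) = d k (w k) + lam (Suc k) (w k)"
      using step[of k] Suc.prems by auto
    obtain u where u: "(u, w k) \<in> fl k" "shifts (lam k (w k)) u (d k (w k))"
      using Suc.IH[OF wI] by blast
    have "shifts (lam (Suc k) (l k)) (u + lam (Suc k) (w k)) (d k (w k) + lam (Suc k) (w k))"
      by (rule shifts_right[OF u(2)]) (use p sp in auto)
    then show ?thesis using j fl_new[OF u(1)] by metis
  qed
qed

text \<open>\<open>T\<close> climbs each tower floor by floor, so only a base floor may fail to be
  the image of a floor of the same letter. In \<open>exists_inv_prob\<close> this confines a
  possible loss of mass to the bases.\<close>

lemma floor_base_or_shifted: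
  "(u, j) \<in> fl k \<Longrightarrow> u = b k j \<or> (\<exists>v. (v, j) \<in> fl k \<and> shifts (lam k j) v u)"
proof (induction k arbitrary: u j)
  case 0 then show ?case by auto
next
  case (Suc k)
  note p = pos[OF wI, of "Suc k" k] and sp = lam_split[of k]
  have lk: "lam (Suc k) (l k) = lam k (l k)" using lam_other[of "l k" k] wl[of k] by auto
  have topw: "\<exists>t. (t, l k) \<in> fl (Suc k) \<and> shifts (lam (Suc k) (l k)) t (d k (w k) + lam (Suc k) (w k))"
  proof -
    obtain u where u: "(u, w k) \<in> fl k" "shifts (lam k (w k)) u (d k (w k))"
      using top_floor[OF wI] by blast
    have "shifts (lam (Suc k) (l k)) (u + lam (Suc k) (w k)) (d k (w k) + lam (Suc k) (w k))"
      by (rule shifts_right[OF u(2)]) (use p sp in auto)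
    then show ?thesis using fl_new[OF u(1)] by metis
  qed
  from Suc.prems show ?case
  proof (cases rule: fl_Suc_cases)
    case 1
    from Suc.IH[OF 1] show ?thesis
    proof
      assume "\<exists>v. (v, j) \<in> fl k \<and> shifts (lam k j) v u"
      then show ?thesis using fl_mono shifts_left lam_Suc_le by metis
    next
      assume u: "u = b k j"
      show ?thesis
      proof (cases "b (Suc k) j = b k j")
        case False
        then have "j = l k" "b k (l k) = d k (w k) + lam (Suc k) (w k)"
          using step[of k] fl_I[OF 1] by auto
        then show ?thesis using topw u by metis
      qed (use u in simp)
    qed
  next
    case (2 v)
    from Suc.IH[OF 2(1)] show ?thesis
    proof
      assume "\<exists>v'. (v', w k) \<in> fl k \<and> shifts (lam k (w k)) v' v"
      then obtain v' where v': "(v', w k) \<in> fl k" "shifts (lam k (w k)) v' v" by blast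
      have "shifts (lam (Suc k) (l k)) (v' + lam (Suc k) (w k)) (v + lam (Suc k) (w k))"
        by (rule shifts_right[OF v'(2)]) (use p sp in auto)
      then show ?thesis using 2 fl_new[OF v'(1)] by metis
    next
      \<comment> \<open>The new floor is the right part of the winner's base: either the image
        \<open>d k (l k)\<close> of the loser's top floor, or itself the loser's new base.\<close>
      assume v: "v = b k (w k)"
      from step[of k] show ?thesis
      proof (elim disjE conjE)
        assume "d k (l k) = b k (w k) + lam (Suc k) (w k)"
        moreover obtain t where "(t, l k) \<in> fl k" "shifts (lam k (l k)) t (d k (l k))"
          using top_floor[OF lI] by blast
        ultimately show ?thesis using 2 v lk fl_mono by metis
      next
        assume "b (Suc k) (l k) = b k (w k) + lam (Suc k) (w k)"
        then show ?thesis using 2 v by simp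
      qed
    qed
  qed
qed

section \<open>The distribution function of the measure with given weights\<close>

context
  fixes y :: "'a \<Rightarrow> real"
  assumes y_nonneg: "\<And>k i. i \<in> I \<Longrightarrow> 0 \<le> sub k y i"
    and y_sum: "(\<Sum>i\<in>I. y i) = 1"
    and y_small: "\<And>i. i \<in> I \<Longrightarrow> (\<lambda>k. sub k y i) \<longlonglongrightarrow> 0"
begin

text \<open>A floor is counted only if all of it lies to the left of \<open>x\<close>. So
  \<open>G k x\<close> approximates the distribution function from below, increases with
  \<open>k\<close>, and becomes constant in \<open>k\<close> once \<open>x\<close> is not interior
  to any floor, which is what \<open>cut\<close> expresses.\<close>

definition G :: "nat \<Rightarrow> real \<Rightarrow> real" where
  "G k x = (\<Sum>(u,j)\<in>fl k. if u + lam k j \<le> x then sub k y j else 0)"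

definition cut :: "nat \<Rightarrow> real \<Rightarrow> bool" where
  "cut k x \<longleftrightarrow> (\<forall>u j. (u, j) \<in> fl k \<longrightarrow> x \<le> u \<or> u + lam k j \<le> x)"

lemma sum_weights: "(\<Sum>(u,j)\<in>fl k. sub k y j) = 1"
proof (induction k)
  case 0
  have "inj_on (\<lambda>i. (b 0 i, i)) I" by (auto simp: inj_on_def)
  then show ?case using y_sum by (simp add: sum.reindex)
next
  case (Suc k)
  have "(\<Sum>(u,j)\<in>fl (Suc k). sub (Suc k) y j) =
     (\<Sum>(u,j)\<in>fl k. sub (Suc k) y j + (if j = w k then sub (Suc k) y (l k) else 0))"
    by (subst sum_fl_Suc) (auto intro!: sum.cong simp del: sub.simps)
  also have "\<dots> = (\<Sum>(u,j)\<in>fl k. sub k y j)"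
    using wl[of k] by (intro sum.cong) auto
  finally show ?case using Suc by simp
qed

lemma G_Suc: "G (Suc k) x = (\<Sum>(u,j)\<in>fl k. (if u + lam (Suc k) j \<le> x then sub (Suc k) y j else 0) +
  (if j = w k then if u + lam k (w k) \<le> x then sub (Suc k) y (l k) else 0 else 0))"
proof -
  have eq: "u + (lam (Suc k) (w k) + lam (Suc k) (l k)) = u + lam k (w k)" for u
    by (simp only: lam_split[of k])
  show ?thesis
    unfolding G_def by (subst sum_fl_Suc, intro sum.cong refl) (auto simp del: sub.simps simp: eq add.assoc)
qed

lemma G_Suc_ge: "G k x \<le> G (Suc k) x"
  unfolding G_Suc unfolding G_def
proof (intro sum_mono, clarify)
  fix u j assume uj: "(u, j) \<in> fl k"
  show "(if u + lam k j \<le> x then sub k y j else 0) \<le> (if u + lam (Suc k) j \<le> x then sub (Suc k) y j else 0) +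
     (if j = w k then if u + lam k (w k) \<le> x then sub (Suc k) y (l k) else 0 else 0)"
    using lam_Suc_le[of k j] y_nonneg[OF fl_I[OF uj], of "Suc k"] y_nonneg[OF lI, of "Suc k" k]
      sub_split[of k y] sub_other[of j k y]
    by (auto simp del: sub.simps split: if_splits)
qed

lemma G_Suc_cut:
  assumes "cut k x" shows "G (Suc k) x = G k x"
  unfolding G_Suc unfolding G_def
proof (intro sum.cong, simp, clarify)
  fix u j assume uj: "(u, j) \<in> fl k"
  then have "x \<le> u \<or> u + lam k j \<le> x" using assms by (auto simp: cut_def)
  then show "(if u + lam (Suc k) j \<le> x then sub (Suc k) y j else 0) +
     (if j = w k then if u + lam k (w k) \<le> x then sub (Suc k) y (l k) else 0 else 0) =
     (if u + lam k j \<le> x then sub k y j else 0)"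
    using lam_Suc_le[of k j] pos[OF fl_I[OF uj], of "Suc k"]
      sub_split[of k y] sub_other[of j k y]
    by (auto simp del: sub.simps split: if_splits)
qed

lemma cut_Suc: "cut k x \<Longrightarrow> cut (Suc k) x"
  unfolding cut_def
proof (intro allI impI)
  fix u j assume c: "\<forall>u j. (u, j) \<in> fl k \<longrightarrow> x \<le> u \<or> u + lam k j \<le> x" and uj: "(u, j) \<in> fl (Suc k)"
  from uj show "x \<le> u \<or> u + lam (Suc k) j \<le> x"
  proof (cases rule: fl_Suc_cases)
    case 1 then show ?thesis using c lam_Suc_le[of k j] by force
  next
    case (2 v) then show ?thesis using c lam_split[of k] pos[OF wI, of "Suc k" k] by force
  qed
qed

lemma G_cut: "cut k x \<Longrightarrow> k \<le> m \<Longrightarrow> G m x = G k x"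
proof -
  assume x: "cut k x" and "k \<le> m"
  from \<open>k \<le> m\<close> have "cut m x \<and> G m x = G k x"
    by (induction rule: dec_induct) (auto simp: x cut_Suc G_Suc_cut)
  then show ?thesis by simp
qed

lemma
  assumes "(u, j) \<in> fl k"
  shows cut_left: "cut k u" and cut_right: "cut k (u + lam k j)"
  unfolding cut_def using fl_order[OF assms] pos[OF fl_I[OF assms], of k] by force+

lemma G_floor:
  assumes uj: "(u, j) \<in> fl k" shows "G k (u + lam k j) - G k u = sub k y j"
proof -
  have "G k (u + lam k j) - G k u = (\<Sum>f\<in>fl k. if f = (u, j) then sub k y j else 0)"
    unfolding G_def sum_subtractf[symmetric]
  proof (intro sum.cong, simp, clarify)
    fix v i assume "(v, i) \<in> fl k"
    then show "(if v + lam k i \<le> u + lam k j then sub k y i else 0) - (if v + lam k i \<le> u then sub k y i else 0) =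
       (if (v, i) = (u, j) then sub k y j else 0)"
      using fl_order[OF uj, of v i] pos[OF fl_I[OF uj], of k] pos[OF fl_I, of v i k k] by auto
  qed
  also have "\<dots> = sub k y j" using uj finite_fl by simp
  finally show ?thesis .
qed

lemma G_nonneg: "0 \<le> G k x" and G_le_1: "G k x \<le> 1"
proof -
  show "0 \<le> G k x" unfolding G_def using y_nonneg fl_I by (intro sum_nonneg) auto
  have "G k x \<le> (\<Sum>(u,j)\<in>fl k. sub k y j)"
    unfolding G_def using y_nonneg fl_I by (intro sum_mono) auto
  then show "G k x \<le> 1" by (simp add: sum_weights)
qed

lemma G_mono: "x \<le> x' \<Longrightarrow> G k x \<le> G k x'"
  unfolding G_def using y_nonneg fl_I by (intro sum_mono) auto

definition F :: "real \<Rightarrow> real" where "F x = lim (\<lambda>k. G k x)"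

lemma G_lim: "(\<lambda>k. G k x) \<longlonglongrightarrow> F x"
proof -
  have "incseq (\<lambda>k. G k x)" by (intro incseq_SucI G_Suc_ge)
  then have "convergent (\<lambda>k. G k x)"
    using G_le_1 by (intro Bseq_monoseq_convergent incseq_imp_monoseq BseqI'[of _ 1]) (auto simp: G_nonneg)
  then show ?thesis unfolding F_def using convergent_LIMSEQ_iff by blast
qed

lemma F_mono: "x \<le> x' \<Longrightarrow> F x \<le> F x'"
  using G_mono by (intro LIMSEQ_le[OF G_lim G_lim]) auto

lemma F_cut: "cut k x \<Longrightarrow> F x = G k x"
proof -
  assume "cut k x"
  have "\<forall>\<^sub>F m in sequentially. G m x = G k x"
    using eventually_ge_at_top[of k] by eventually_elim (rule G_cut[OF \<open>cut k x\<close>])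
  then show ?thesis by (intro LIMSEQ_unique[OF G_lim] tendsto_eventually)
qed

lemma F_floor: "(u, j) \<in> fl k \<Longrightarrow> F (u + lam k j) - F u = sub k y j"
  using F_cut[OF cut_left, of u j k] F_cut[OF cut_right, of u j k] G_floor[of u j k] by simp

lemma F_le_0: "x \<le> 0 \<Longrightarrow> F x = 0"
proof -
  assume x: "x \<le> 0"
  have "G k x = 0" for k
    unfolding G_def
  proof (intro sum.neutral ballI, clarify)
    fix u j assume uj: "(u, j) \<in> fl k"
    then show "(if u + lam k j \<le> x then sub k y j else 0) = 0"
      using fl_bounds[OF uj] pos[OF fl_I[OF uj], of k] x by auto
  qed
  then show ?thesis by (intro LIMSEQ_unique[OF G_lim]) simp
qed

lemma F_ge_1: "1 \<le> x \<Longrightarrow> F x = 1"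
proof -
  assume x: "1 \<le> x"
  have "G k x = (\<Sum>(u,j)\<in>fl k. sub k y j)" for k
    unfolding G_def
  proof (intro sum.cong, simp, clarify)
    fix u j assume uj: "(u, j) \<in> fl k"
    then show "(if u + lam k j \<le> x then sub k y j else 0) = sub k y j"
      using fl_bounds[OF uj] x by auto
  qed
  then show ?thesis by (intro LIMSEQ_unique[OF G_lim]) (simp add: sum_weights)
qed

text \<open>The counterpart of \<open>fl_cover\<close> for intervals open on the left, found through
  the largest left end point below \<open>x\<close>. It controls \<open>F\<close> to the left of
  \<open>x\<close>, where the floor containing \<open>x\<close> is of no help if it starts at
  \<open>x\<close>.\<close>

lemma floor_left:
  assumes "0 < x" "x \<le> 1" shows "\<exists>u j. (u, j) \<in> fl k \<and> u < x \<and> x \<le> u + lam k j"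
proof -
  define A where "A = {f \<in> fl k. fst f < x}"
  obtain u0 j0 where "(u0, j0) \<in> fl k" "u0 \<le> 0" using fl_cover[of 0 k] by auto
  then have ne: "(u0, j0) \<in> A" using assms by (simp add: A_def)
  have finA: "finite (fst ` A)" unfolding A_def using finite_fl by simp
  define u where "u = Max (fst ` A)"
  have "u \<in> fst ` A" unfolding u_def using finA ne by (intro Max_in) auto
  then obtain j where uj: "(u, j) \<in> fl k" "u < x" by (auto simp: A_def)
  have "x \<le> u + lam k j"
  proof (rule ccontr)
    assume n: "\<not> x \<le> u + lam k j"
    let ?e = "u + lam k j"
    have p: "lam k j > 0" using pos[OF fl_I[OF uj(1)]] .
    have "?e \<in> {0..<1}" using n assms fl_bounds[OF uj(1)] p by auto
    then obtain v i where vi: "(v, i) \<in> fl k" "v \<le> ?e" "?e < v + lam k i" using fl_cover by blast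
    then have "v \<in> fst ` A" using n by (force simp: A_def)
    then have "v \<le> u" unfolding u_def using finA by simp
    then show False using fl_disj[OF uj(1) vi(1), of u] vi p by auto
  qed
  then show ?thesis using uj by blast
qed

lemma weights_small: "e > 0 \<Longrightarrow> \<exists>k. \<forall>i\<in>I. sub k y i < e"
proof -
  assume "e > 0"
  then have "\<forall>\<^sub>F k in sequentially. \<forall>i\<in>I. sub k y i < e"
    using fin y_small by (auto intro!: eventually_ball_finite order_tendstoD(2))
  then show ?thesis by (auto simp: eventually_sequentially)
qed

text \<open>On either side of \<open>x\<close>, \<open>F\<close> varies by at most the weight of one
  floor, or is constant outside the unit interval. This is where \<open>y_small\<close> rules out
  atoms.\<close>

lemma F_gap: assumes "e > 0" shows "\<exists>s t. s < x \<and> x < t \<and> F t - F s < 2 * e"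
proof -
  obtain k where k: "\<forall>i\<in>I. sub k y i < e" using weights_small[OF assms] by blast
  have "\<exists>s<x. F x - F s < e"
  proof (cases "0 < x \<and> x \<le> 1")
    case True
    then obtain u j where uj: "(u, j) \<in> fl k" "u < x" "x \<le> u + lam k j" using floor_left by blast
    then have "F x - F u \<le> sub k y j" using F_floor[OF uj(1)] F_mono[OF uj(3)] by simp
    then show ?thesis using uj k fl_I[OF uj(1)] by force
  next
    case False
    then show ?thesis using assms F_le_0[of x] F_le_0[of "x - 1"] F_ge_1[of x] F_ge_1[of 1]
      by (intro exI[of _ "if x \<le> 0 then x - 1 else 1"]) auto
  qed
  moreover have "\<exists>t>x. F t - F x < e"
  proof (cases "0 \<le> x \<and> x < 1")
    case True
    then obtain u j where uj: "(u, j) \<in> fl k" "u \<le> x" "x < u + lam k j" using fl_cover[of x k] by auto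
    then have "F (u + lam k j) - F x \<le> sub k y j" using F_floor[OF uj(1)] F_mono[OF uj(2)] by simp
    then show ?thesis using uj k fl_I[OF uj(1)] by force
  next
    case False
    then show ?thesis using assms F_le_0[of x] F_le_0[of 0] F_ge_1[of x] F_ge_1[of "x + 1"]
      by (intro exI[of _ "if x < 0 then 0 else x + 1"]) auto
  qed
  ultimately show ?thesis by force
qed

lemma F_continuous: "continuous_on UNIV F"
proof -
  have "isCont F x" for x
    unfolding isCont_def
  proof (rule tendstoI)
    fix e :: real assume "e > 0"
    then obtain s t where st: "s < x" "x < t" "F t - F s < e" using F_gap[of "e/2" x] by auto
    have "\<forall>\<^sub>F z in at x. s < z \<and> z < t"
      using st by (intro eventually_conj order_tendstoD[OF tendsto_ident_at]) auto
    then show "\<forall>\<^sub>F z in at x. dist (F z) (F x) < e"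
    proof eventually_elim
      case (elim z)
      then have "F s \<le> F z" "F z \<le> F t" "F s \<le> F x" "F x \<le> F t" using st by (auto intro!: F_mono)
      then show ?case using st by (auto simp: dist_real_def)
    qed
  qed
  then show ?thesis by (simp add: continuous_on_eq_continuous_at)
qed

lemma F_Ico: "a \<le> c \<Longrightarrow> emeasure (interval_measure F) {a..<c} = ennreal (F c - F a)"
proof -
  assume ac: "a \<le> c"
  have Icc: "emeasure (interval_measure F) {a..c} = ennreal (F c - F a)" if "a \<le> c" for a c
    using that by (rule emeasure_interval_measure_Icc[OF _ F_mono F_continuous])
  have "emeasure (interval_measure F) ({a..c} - {c..c}) = emeasure (interval_measure F) {a..c} - emeasure (interval_measure F) {c..c}"
    using Icc[of c c] ac by (intro emeasure_Diff) auto
  moreover have "{a..c} - {c..c} = {a..<c}" by auto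
  ultimately show ?thesis using Icc[OF ac] Icc[of c c] by simp
qed

lemma exists_measure: "\<exists>M. sets M = sets U01 \<and> prob_space M \<and>
   (\<forall>k u j. (u, j) \<in> fl k \<longrightarrow> measure M {u..<u + lam k j} = sub k y j)"
proof -
  let ?M = "restrict_space (interval_measure F) {0..<1::real}"
  have sM: "sets ?M = sets U01" by (simp add: sets_restrict_space)
  have em: "emeasure ?M {s..<t} = ennreal (F t - F s)" if "0 \<le> s" "s \<le> t" "t \<le> 1" for s t
    using that by (subst emeasure_restrict_space) (auto simp: F_Ico)
  have "prob_space ?M"
    by (rule prob_spaceI) (use em[of 0 1] in \<open>simp add: space_restrict_space F_le_0 F_ge_1\<close>)
  moreover have "measure ?M {u..<u + lam k j} = sub k y j" if uj: "(u, j) \<in> fl k" for k u j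
  proof -
    have "emeasure ?M {u..<u + lam k j} = ennreal (sub k y j)"
      using em[of u "u + lam k j"] fl_bounds[OF uj] pos[OF fl_I[OF uj], of k] F_floor[OF uj] by simp
    then show ?thesis using y_nonneg[OF fl_I[OF uj], of k] by (simp add: measure_def)
  qed
  ultimately show ?thesis using sM by blast
qed

lemma fl_disjoint_family:
  "disjoint_family_on (\<lambda>(u, j). {u..<u + lam k j}) (fl k)"
proof (unfold disjoint_family_on_def, intro ballI impI)
  fix f g assume fg: "f \<in> fl k" "g \<in> fl k" "f \<noteq> g"
  obtain u j v i where [simp]: "f = (u, j)" "g = (v, i)" by (cases f, cases g)
  show "(case f of (u, j) \<Rightarrow> {u..<u + lam k j}) \<inter> (case g of (u, j) \<Rightarrow> {u..<u + lam k j}) = {}"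
    using fl_order[of u j k v i] fg by auto
qed

end

text \<open>The distribution function fixes the masses of the floors but says nothing about
  \<open>T\<close>. Invariance comes from comparing \<open>M\<close> with its push-forward
  \<open>N\<close>.\<close>

lemma exists_inv_prob:
  assumes nn: "\<And>k i. i \<in> I \<Longrightarrow> 0 \<le> sub k y i"
    and y_sum: "(\<Sum>i\<in>I. y i) = 1"
    and y_small: "\<And>i. i \<in> I \<Longrightarrow> (\<lambda>k. sub k y i) \<longlonglongrightarrow> 0"
  shows "\<exists>M. inv_prob T M \<and> (\<forall>i\<in>I. measure M {b 0 i..<b 0 i + lam 0 i} = y i)"
proof -
  obtain M where M: "sets M = sets U01" "prob_space M"
    and Mfl: "\<And>k u j. (u, j) \<in> fl k \<Longrightarrow> measure M {u..<u + lam k j} = sub k y j"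
    using exists_measure[OF assms] by blast
  interpret prob_space M by fact
  have spM: "space M = {0..<1}"
    using sets_eq_imp_space_eq[OF M(1)] by (simp add: space_restrict_space)
  have TM: "T \<in> measurable M M" using T_measurable measurable_cong_sets[OF M(1) M(1)] by blast
  define N where "N = distr M M T"
  have sN: "sets N = sets U01" by (simp add: N_def M)
  have pN: "prob_space N" unfolding N_def by (rule prob_space_distr[OF TM])
  interpret N: prob_space N by fact
  have N: "measure N A = measure M (T -` A \<inter> space M)" if "A \<in> sets M" for A
    unfolding N_def using measure_distr[OF TM that] .
  have Jm: "{u..<u + lam k j} \<in> sets M" if "(u, j) \<in> fl k" for u k j
    using fl_bounds[OF that] by (auto simp: M U01_sets)
  have sumfl: "(\<Sum>(u,j)\<in>fl k. measure P {u..<u + lam k j}) = measure P {0..<1}"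
    if P: "prob_space P" "sets P = sets U01" for P k
  proof -
    interpret P: prob_space P by (rule P)
    have "measure P (\<Union>f\<in>fl k. (\<lambda>(u, j). {u..<u + lam k j}) f) =
        (\<Sum>f\<in>fl k. measure P ((\<lambda>(u, j). {u..<u + lam k j}) f))"
      using finite_fl fl_disjoint_family[OF assms] Jm M(1) P(2)
      by (intro P.finite_measure_finite_Union) auto
    moreover have "(\<Union>f\<in>fl k. (\<lambda>(u, j). {u..<u + lam k j}) f) = {0..<1}"
      using fl_cover fl_bounds by fastforce
    ultimately show ?thesis by (simp add: split_def)
  qed
  \<comment> \<open>The preimage of a floor off the base contains a floor of the same letter, hence
    of the same weight. For a base floor the bound is trivial, since its whole weight is
    subtracted.\<close>
  have lower: "measure M {u..<u + lam m j} - (if u = b m j then sub m y j else 0) \<le> measure N {u..<u + lam m j}"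
    if uj: "(u, j) \<in> fl m" for m u j
    using floor_base_or_shifted[OF uj]
  proof
    assume "u = b m j"
    then show ?thesis using Mfl[OF uj] by simp
  next
    assume "\<exists>v. (v, j) \<in> fl m \<and> shifts (lam m j) v u"
    then obtain v where v: "(v, j) \<in> fl m" "shifts (lam m j) v u" by blast
    have "{v..<v + lam m j} \<subseteq> T -` {u..<u + lam m j} \<inter> space M"
      using v(2) fl_bounds[OF v(1)] by (auto simp: shifts_def spM)
    then have "measure M {v..<v + lam m j} \<le> measure N {u..<u + lam m j}"
      unfolding N[OF Jm[OF uj]] by (intro finite_measure_mono measurable_sets[OF TM] Jm[OF uj])
    then show ?thesis using Mfl[OF uj] Mfl[OF v(1)] nn[OF fl_I[OF uj], of m] by auto
  qed
  have total: "measure M {0..<1} = 1" "measure N {0..<1} = 1"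
    using prob_space N.prob_space spM by (auto simp: N_def)
  text \<open>Only the base floors of a level may lose mass, and their total mass tends to 0. Since both
    measures have mass 1, the deviation on every single set is controlled by this loss.\<close>
  have dev: "measure M A - measure N A \<le> (\<Sum>j\<in>I. sub m y j)"
    if "A = (\<Union>(u,j)\<in>B. {u..<u + lam m j})" "B \<subseteq> fl m" for A B m
  proof -
    have Bf: "finite B" using that finite_fl finite_subset by blast
    have mu: "measure P A = (\<Sum>(u,j)\<in>B. measure P {u..<u + lam m j})"
      if P: "prob_space P" "sets P = sets U01" for P
    proof -
      interpret P: prob_space P by (rule P)
      have "measure P (\<Union>f\<in>B. (\<lambda>(u, j). {u..<u + lam m j}) f) =
          (\<Sum>f\<in>B. measure P ((\<lambda>(u, j). {u..<u + lam m j}) f))"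
        using Bf disjoint_family_on_mono[OF \<open>B \<subseteq> fl m\<close> fl_disjoint_family[OF assms]] Jm M(1) P(2) \<open>B \<subseteq> fl m\<close>
        by (intro P.finite_measure_finite_Union) auto
      then show ?thesis by (simp add: \<open>A = _\<close> split_def)
    qed
    have "measure M A - measure N A = (\<Sum>(u,j)\<in>B. measure M {u..<u + lam m j} - measure N {u..<u + lam m j})"
      using mu[OF M(2,1)] mu[OF pN sN] by (simp add: sum_subtractf split_def)
    also have "\<dots> \<le> (\<Sum>(u,j)\<in>B. if u = b m j then sub m y j else 0)"
      using lower that(2) by (intro sum_mono) force
    also have "\<dots> \<le> (\<Sum>(u,j)\<in>fl m. if u = b m j then sub m y j else 0)"
      using that(2) finite_fl nn fl_I by (intro sum_mono2) auto
    also have "\<dots> = (\<Sum>f\<in>(\<lambda>j. (b m j, j)) ` I. sub m y (snd f))"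
      using base_fl finite_fl fl_I
      by (intro sum.mono_neutral_cong_right) (auto split: if_splits)
    also have "\<dots> = (\<Sum>j\<in>I. sub m y j)"
      by (subst sum.reindex) (auto simp: inj_on_def)
    finally show ?thesis .
  qed
  \<comment> \<open>This separates the level of the tested set from the level of the error: a fixed
    floor of level \<open>k\<close> is a union of floors of any later level \<open>m\<close>, so
    \<open>dev\<close> applies with \<open>m\<close> tending to infinity.\<close>
  have refine: "\<exists>B\<subseteq>fl m. {u..<u + lam k j} = (\<Union>(u,j)\<in>B. {u..<u + lam m j})"
    if uj: "(u, j) \<in> fl k" and "k \<le> m" for k m u j
    using that(2)
  proof (induction rule: dec_induct)
    case base then show ?case using uj by (intro exI[of _ "{(u, j)}"]) auto
  next
    case (step m)
    then obtain B where B: "B \<subseteq> fl m" "{u..<u + lam k j} = (\<Union>(u,j)\<in>B. {u..<u + lam m j})" by blast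
    have split: "\<exists>C\<subseteq>fl (Suc m). {v..<v + lam m i} = (\<Union>(u,j)\<in>C. {u..<u + lam (Suc m) j})"
      if "(v, i) \<in> fl m" for v i
    proof (cases "i = w m")
      case True
      have "{v..<v + lam m i} = {v..<v + lam (Suc m) (w m)} \<union>
          {v + lam (Suc m) (w m)..<v + lam (Suc m) (w m) + lam (Suc m) (l m)}"
        using True lam_split[of m] pos[OF wI, of "Suc m" m] pos[OF lI, of "Suc m" m] by auto
      then show ?thesis using that True fl_new[of v m] fl_mono
        by (intro exI[of _ "{(v, w m), (v + lam (Suc m) (w m), l m)}"]) auto
    next
      case False
      then show ?thesis using that lam_other[OF False] fl_mono by (intro exI[of _ "{(v, i)}"]) auto
    qed
    define C where "C f = (SOME C. C \<subseteq> fl (Suc m) \<and>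
        {fst f..<fst f + lam m (snd f)} = (\<Union>(u,j)\<in>C. {u..<u + lam (Suc m) j}))" for f
    have C: "C f \<subseteq> fl (Suc m) \<and>
        {fst f..<fst f + lam m (snd f)} = (\<Union>(u,j)\<in>C f. {u..<u + lam (Suc m) j})" if "f \<in> B" for f
    proof -
      have "(fst f, snd f) \<in> fl m" using B(1) that by auto
      from split[OF this] show ?thesis unfolding C_def by (rule someI_ex)
    qed
    have "{u..<u + lam k j} = (\<Union>f\<in>B. {fst f..<fst f + lam m (snd f)})"
      using B(2) by (simp add: split_def)
    also have "\<dots> = (\<Union>f\<in>B. \<Union>(u,j)\<in>C f. {u..<u + lam (Suc m) j})"
      by (rule SUP_cong) (use C in auto)
    also have "\<dots> = (\<Union>(u,j)\<in>(\<Union>f\<in>B. C f). {u..<u + lam (Suc m) j})" by blast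
    finally have "{u..<u + lam k j} = (\<Union>(u,j)\<in>(\<Union>f\<in>B. C f). {u..<u + lam (Suc m) j})" .
    moreover have "(\<Union>f\<in>B. C f) \<subseteq> fl (Suc m)" by (intro UN_least) (use C in blast)
    ultimately show ?case by blast
  qed
  have le: "measure M {u..<u + lam k j} \<le> measure N {u..<u + lam k j}"
    if uj: "(u, j) \<in> fl k" for k u j
  proof -
    have lim: "(\<lambda>m. \<Sum>j\<in>I. sub m y j) \<longlonglongrightarrow> 0"
      using y_small by (intro tendsto_null_sum) auto
    have "measure M {u..<u + lam k j} - measure N {u..<u + lam k j} \<le> (\<Sum>j\<in>I. sub m y j)" if "k \<le> m" for m
    proof -
      from refine[OF uj that] obtain B where B: "B \<subseteq> fl m" "{u..<u + lam k j} = (\<Union>(u,j)\<in>B. {u..<u + lam m j})"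
        by blast
      show ?thesis by (rule dev[OF B(2,1)])
    qed
    then have "measure M {u..<u + lam k j} - measure N {u..<u + lam k j} \<le> 0"
      by (intro LIMSEQ_le_const[OF lim]) auto
    then show ?thesis by simp
  qed
  have "M = N"
  proof (rule measure_eqI_floors)
    fix k u j assume uj: "(u, j) \<in> fl k"
    have "(\<Sum>(u,j)\<in>fl k. measure N {u..<u + lam k j} - measure M {u..<u + lam k j}) = 0"
      using sumfl[OF M(2,1), of k] sumfl[OF pN sN, of k] total by (simp add: sum_subtractf split_def)
    then have "\<forall>f\<in>fl k. (\<lambda>(u,j). measure N {u..<u + lam k j} - measure M {u..<u + lam k j}) f = 0"
      using finite_fl le by (subst (asm) sum_nonneg_eq_0_iff) auto
    then show "measure M {u..<u + lam k j} = measure N {u..<u + lam k j}" using uj by auto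
  qed (use M sN finite_measure_axioms N.finite_measure_axioms in auto)
  then have "emeasure M (T -` A \<inter> space M) = emeasure M A" if "A \<in> sets M" for A
    using emeasure_distr[OF TM that] unfolding N_def by simp
  then have "inv_prob T M" using M TM by (simp add: inv_prob_def)
  moreover have "measure M {b 0 i..<b 0 i + lam 0 i} = y i" if "i \<in> I" for i
    using Mfl[OF base_fl[OF that], of 0] by simp
  ultimately show ?thesis by blast
qed

end

section \<open>The loop in the Rauzy diagram\<close>

text \<open>The combinatorial part of \<open>rv_step\<close>, with the type given as a letter: the
  rows then evolve without knowledge of the lengths, and the loop can be evaluated once for all
  length vectors.\<close>

fun row_step :: "nat \<Rightarrow> nat list \<times> nat list \<Rightarrow> nat list \<times> nat list" where
  "row_step e (tp, bt) =
    (if e = 0 then (tp, ins_after (last tp) (last bt) (butlast bt))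
     else (ins_after (last bt) (last tp) (butlast tp), bt))"

fun winner :: "nat \<Rightarrow> nat list \<times> nat list \<Rightarrow> nat" where
  "winner e (tp, bt) = (if e = 0 then last tp else last bt)"

fun loser :: "nat \<Rightarrow> nat list \<times> nat list \<Rightarrow> nat" where
  "loser e (tp, bt) = (if e = 0 then last bt else last tp)"

fun row_steps :: "nat list \<Rightarrow> nat list \<times> nat list \<Rightarrow> nat list \<times> nat list" where
  "row_steps [] r = r"
| "row_steps (e # es) r = row_steps es (row_step e r)"

text \<open>Recovers the old length vector from the new one along a path.\<close>

fun pull_back :: "nat list \<Rightarrow> nat list \<times> nat list \<Rightarrow> (nat \<Rightarrow> real) \<Rightarrow> nat \<Rightarrow> real" where
  "pull_back [] r x = x"
| "pull_back (e # es) r x = (let y = pull_back es (row_step e r) x in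
     y(winner e r := y (winner e r) + y (loser e r)))"

lemma row_steps_append: "row_steps (xs @ ys) r = row_steps ys (row_steps xs r)"
  by (induction xs arbitrary: r) auto

lemma pull_back_append: "pull_back (xs @ ys) r x = pull_back xs r (pull_back ys (row_steps xs r) x)"
  by (induction xs arbitrary: r) (auto simp: Let_def)

text \<open>While \<open>e\<close> ends the bottom row and wins, the last top letter moves right
  behind \<open>e\<close>. Doing this for all of \<open>B2\<close> restores the order inside
  \<open>B2\<close>, so the letters behind \<open>e\<close> are rotated cyclically.\<close>

lemma rotate_top:
  fixes x :: "nat \<Rightarrow> real"
  assumes "distinct (A @ e # B1 @ B2)"
  shows "row_steps (replicate (length B2) 1) (A @ e # B1 @ B2, Q @ [e]) = (A @ e # B2 @ B1, Q @ [e]) \<and>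
    pull_back (replicate (length B2) 1) (A @ e # B1 @ B2, Q @ [e]) x = x(e := x e + sum_list (map x B2))"
  using assms
proof (induction B2 arbitrary: B1 rule: rev_induct)
  case (snoc z B)
  have "ins_after e z (A @ e # B1 @ B) = A @ e # (z # B1) @ B"
    using snoc.prems by (simp add: ins_after_append)
  moreover have "butlast (A @ e # B1 @ B @ [z]) = A @ e # B1 @ B"
    by (metis append_Cons append_assoc butlast_snoc)
  moreover have "last (A @ e # B1 @ B @ [z]) = z" by simp
  ultimately have st: "row_step 1 (A @ e # B1 @ B @ [z], Q @ [e]) = (A @ e # (z # B1) @ B, Q @ [e])"
    "winner 1 (A @ e # B1 @ B @ [z], Q @ [e]) = e" "loser 1 (A @ e # B1 @ B @ [z], Q @ [e]) = z"
    by simp_all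
  have IH: "row_steps (replicate (length B) 1) (A @ e # (z # B1) @ B, Q @ [e]) = (A @ e # B @ z # B1, Q @ [e])"
    "pull_back (replicate (length B) 1) (A @ e # (z # B1) @ B, Q @ [e]) x = x(e := x e + sum_list (map x B))"
    using snoc.IH[of "z # B1"] snoc.prems by auto
  have l: "length (B @ [z]) = Suc (length B)" by simp
  show ?case unfolding l replicate.simps row_steps.simps pull_back.simps st IH Let_def
    using snoc.prems by auto
qed simp

text \<open>The loser \<open>e\<close> is put back behind the winner \<open>u\<close>, where it
  already stood: a loop of length one in the Rauzy diagram.\<close>

lemma repeat_top_wins:
  fixes x :: "nat \<Rightarrow> real"
  assumes "u \<noteq> e" "u \<notin> set P"
  shows "row_steps (replicate m 0) (Q @ [u], P @ [u, e]) = (Q @ [u], P @ [u, e]) \<and>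
    pull_back (replicate m 0) (Q @ [u], P @ [u, e]) x = x(u := x u + real m * x e)"
proof (induction m)
  case (Suc m)
  have "butlast (P @ [u, e]) = P @ [u]" by (simp add: butlast_append)
  then have "row_step 0 (Q @ [u], P @ [u, e]) = (Q @ [u], P @ [u, e])"
    using assms by (simp add: ins_after_append)
  then show ?case using Suc assms by (simp add: Let_def algebra_simps fun_eq_iff)
qed simp

text \<open>After \<open>length B\<close> wins of \<open>e\<close> the top row is back. In the loop
  \<open>B\<close> has \<open>n - 1\<close> letters, whence the exponent of the last factor of
  \<open>gamma\<close>.\<close>

lemma full_rotations:
  fixes x :: "nat \<Rightarrow> real"
  assumes "distinct (e # B)"
  shows "row_steps (replicate (c * length B) 1) (e # B, Q @ [e]) = (e # B, Q @ [e]) \<and>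
    pull_back (replicate (c * length B) 1) (e # B, Q @ [e]) x = x(e := x e + real c * sum_list (map x B))"
proof (induction c)
  case (Suc c)
  note r = rotate_top[of "[]" e "[]" B Q, simplified]
  have m: "map (x(e := v)) B = map x B" for v using assms by (auto intro!: map_cong)
  have "replicate (Suc c * length B) (1::nat) = replicate (length B) 1 @ replicate (c * length B) 1"
    by (simp add: replicate_add)
  moreover have "distinct (e # B)" by fact
  ultimately show ?case using r Suc m[of "x e + real c * sum_list (map x B)"]
    by (simp add: row_steps_append pull_back_append algebra_simps del: fun_upd_apply)
      (simp add: fun_eq_iff)
qed simp

text \<open>The pairs in the bottom row; along the loop they travel one at a time from the end of
  the row to the place behind \<open>n\<close>.\<close>

definition pairs :: "nat \<Rightarrow> nat \<Rightarrow> nat list" where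
  "pairs i j = concat (map (\<lambda>k. [2 * k + 1, 2 * k]) [i..<j])"

lemma pairs_Suc: "i \<le> j \<Longrightarrow> pairs i (Suc j) = pairs i j @ [2 * j + 1, 2 * j]"
  by (simp add: pairs_def)

lemma pairs_Cons: "i < j \<Longrightarrow> pairs i j = [2 * i + 1, 2 * i] @ pairs (Suc i) j"
  by (simp add: pairs_def upt_conv_Cons)

lemma set_pairs: "set (pairs i j) = {2 * i..<2 * j}"
proof (induction j)
  case 0 then show ?case by (simp add: pairs_def)
next
  case (Suc j)
  show ?case
  proof (cases "i \<le> j")
    case True then show ?thesis using Suc by (auto simp: pairs_Suc)
  next
    case False then show ?thesis by (simp add: pairs_def)
  qed
qed

lemma distinct_pairs: "distinct (pairs i j)"
proof (induction j)
  case 0 then show ?case by (simp add: pairs_def)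
next
  case (Suc j)
  show ?case
  proof (cases "i \<le> j")
    case True then show ?thesis using Suc by (auto simp: pairs_Suc set_pairs)
  next
    case False then show ?thesis by (simp add: pairs_def)
  qed
qed

lemma bot_row_pairs: "bot_row n = n # pairs 1 (n div 2) @ [1]"
  by (simp add: bot_row_def pairs_def)

text \<open>Applied with \<open>e = 2 * k\<close> and \<open>u = 2 * k + 1\<close>. The first wins
  of \<open>e\<close> bring \<open>u\<close> to the end of the top row; there \<open>u\<close> beats
  \<open>e\<close> exactly \<open>a\<close> times without changing the rows; the next win of
  \<open>e\<close> restores the top row; finally \<open>n\<close> beats \<open>e\<close> and then
  \<open>u\<close>, which puts the pair behind \<open>n\<close>.\<close>

lemma gamma_dot_stage:
  fixes a :: nat and x :: "nat \<Rightarrow> real"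
  assumes d: "distinct (A @ e # u # R @ [n])" and uP: "u \<notin> set P" "u \<notin> set Q" "u \<noteq> 1"
  defines "ws \<equiv> replicate (Suc (length R)) 1 @ replicate a 0 @ [1] @ [0, 0]"
  shows "row_steps ws (A @ e # u # R @ [n], n # P @ [1] @ Q @ [u, e]) =
      (A @ e # u # R @ [n], n # [u, e] @ P @ [1] @ Q)"
    and "pull_back ws (A @ e # u # R @ [n], n # P @ [1] @ Q @ [u, e]) x =
      x(n := x n + x u + x e, u := x u + a * (x e + x u),
        e := x e + x u + (sum_list (map x R) + x n + x u + x e))"
proof -
  let ?r0 = "(A @ e # u # R @ [n], n # P @ [1] @ Q @ [u, e])"
  let ?r1 = "((A @ e # R @ [n]) @ [u], (n # P @ [1] @ Q) @ [u, e])"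
  let ?p1 = "replicate (Suc (length R)) (1::nat)"
  have 1: "row_steps ?p1 ?r0 = ?r1"
     "pull_back ?p1 ?r0 y = y(e := y e + sum_list (map y (R @ [n])))" for y
    using rotate_top[of A e "[u]" "R @ [n]" "n # P @ [1] @ Q @ [u]"] d by auto
  have 2: "row_steps (replicate a 0) ?r1 = ?r1"
     "pull_back (replicate a 0) ?r1 y = y(u := y u + real a * y e)" for y
    using repeat_top_wins[of u e "n # P @ [1] @ Q" a "A @ e # R @ [n]"] d uP by auto
  have "butlast (A @ e # R @ [n, u]) = A @ e # R @ [n]" by (simp add: butlast_append)
  then have s3: "row_step 1 ?r1 = ?r0" "winner 1 ?r1 = e" "loser 1 ?r1 = u"
    using ins_after_append[of e A u "R @ [n]"] d by auto
  let ?r4 = "(A @ e # u # R @ [n], n # e # P @ [1] @ Q @ [u])"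
  let ?r5 = "(A @ e # u # R @ [n], n # u # e # P @ [1] @ Q)"
  have "butlast (n # P @ [1] @ Q @ [u, e]) = n # P @ [1] @ Q @ [u]" by (simp add: butlast_append)
  then have s4: "row_step 0 ?r0 = ?r4" "winner 0 ?r0 = n" "loser 0 ?r0 = e" by auto
  have "butlast (n # e # P @ [1] @ Q @ [u]) = n # e # P @ [1] @ Q" by (simp add: butlast_append)
  then have s5: "row_step 0 ?r4 = ?r5" "winner 0 ?r4 = n" "loser 0 ?r4 = u" by auto
  have ws: "ws = ?p1 @ replicate a 0 @ [1, 0, 0]" by (simp add: ws_def)
  have tail: "row_steps ([1, 0, 0]) ?r1 = ?r5"
    by (simp only: row_steps.simps s3 s4 s5)
  have "pull_back ([1, 0, 0]) ?r1 x =
      (x(n := x n + x u, n := x n + x u + x e, e := x e + x u))"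
    using d by (simp only: pull_back.simps row_steps.simps s3 s4 s5 Let_def)
      (simp add: fun_eq_iff)
  then have tail': "pull_back ([1, 0, 0]) ?r1 x = x(n := x n + x u + x e, e := x e + x u)" by simp
  show "row_steps ws ?r0 = (A @ e # u # R @ [n], n # [u, e] @ P @ [1] @ Q)"
    unfolding ws row_steps_append 1 2 tail by simp
  have R: "map (x(n := v1, e := v2, u := v3)) R = map x R" for v1 v2 v3
    using d by (auto intro!: map_cong)
  show "pull_back ws ?r0 x =
      x(n := x n + x u + x e, u := x u + a * (x e + x u),
        e := x e + x u + (sum_list (map x R) + x n + x u + x e))"
    unfolding ws pull_back_append row_steps_append 1 2 tail'
    using d R by (auto simp: fun_eq_iff)
qed

text \<open>The pairs are treated from the last to the first, \<open>t\<close> of them in all.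
  Pulling back runs through the path in reverse, so the vector met by the first \<open>t\<close>
  stages has already been changed by stage \<open>Suc t\<close>.\<close>

lemma gamma_dots:
  fixes a n h :: nat and x :: "nat \<Rightarrow> real"
  assumes n: "n = 2 * h" and "h \<ge> 2" and "t < h"
  defines "ws \<equiv> concat (map (\<lambda>i. gamma_dot n (n - 2 * i) a) [1..<Suc t])"
  defines "r \<equiv> (top_row n, n # 1 # pairs 1 h)"
  shows "row_steps ws r = (top_row n, n # pairs (h - t) h @ [1] @ pairs 1 (h - t))
    \<and> (\<forall>i\<le>n. pull_back ws r x i =
      (if i = n then sum x {2 * (h - t)..n}
       else if i < 2 * (h - t) then x i
       else if even i then x i + x (i + 1) + sum x {2 * (h - t)..n}
       else x i + a * (x (i - 1) + x i)))"
  using \<open>t < h\<close> unfolding ws_def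
proof (induction t arbitrary: x)
  case 0
  show ?case by (auto simp: r_def n pairs_def)
next
  case (Suc t)
  define k where "k = h - Suc t"
  have k: "1 \<le> k" "h - t = Suc k" "k < h" "n - 2 * Suc t = 2 * k" "h - Suc t = k"
    using Suc.prems by (auto simp: k_def n)
  let ?path = "concat (map (\<lambda>i. gamma_dot n (n - 2 * i) a) [1..<Suc t])"
  note IH = Suc.IH[OF Suc_lessD[OF Suc.prems]]
  have r1: "row_steps ?path r = (top_row n, n # pairs (Suc k) h @ [1] @ pairs 1 k @ [2 * k + 1, 2 * k])"
    using IH k(1) by (simp add: k pairs_Suc)
  have top: "top_row n = [1..<2 * k] @ 2 * k # (2 * k + 1) # [2 * k + 2..<n] @ [n]"
  proof -
    have "[1..<n + 1] = [1..<2 * k] @ [2 * k..<n + 1]"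
      using k upt_add_eq_append[of 1 "2 * k" "n + 1 - 2 * k"] by (simp add: n del: upt_Suc)
    moreover have "[2 * k..<n + 1] = 2 * k # (2 * k + 1) # [2 * k + 2..<n + 1]"
      using k by (simp add: upt_conv_Cons n del: upt_Suc)
    ultimately show ?thesis using k by (simp add: top_row_def n)
  qed
  have pk: "gamma_dot n (n - 2 * Suc t) a =
      replicate (Suc (length [2 * k + 2..<n])) 1 @ replicate a 0 @ [1] @ [0, 0]"
  proof -
    have "n - 1 - 2 * k = Suc (length [2 * k + 2..<n])" using k(3) n by simp
    then show ?thesis unfolding gamma_dot_def k(4) by (simp only:)
  qed
  have split: "concat (map (\<lambda>i. gamma_dot n (n - 2 * i) a) [1..<Suc (Suc t)]) =
      ?path @ gamma_dot n (n - 2 * Suc t) a"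
    by simp
  let ?P = "replicate (Suc (length [2 * k + 2..<n])) 1 @ replicate a 0 @ [1] @ [0, 0]"
  have dd: "distinct ([1..<2 * k] @ 2 * k # (2 * k + 1) # [2 * k + 2..<n] @ [n])"
    unfolding top[symmetric] by (simp add: top_row_def)
  have stage: "row_steps ?P (row_steps ?path r) =
      (top_row n, n # [2 * k + 1, 2 * k] @ pairs (Suc k) h @ [1] @ pairs 1 k)"
    "pull_back ?P (row_steps ?path r) x =
      x(n := x n + x (2 * k + 1) + x (2 * k), 2 * k + 1 := x (2 * k + 1) + a * (x (2 * k) + x (2 * k + 1)),
        2 * k := x (2 * k) + x (2 * k + 1) + (sum_list (map x [2 * k + 2..<n]) + x n + x (2 * k + 1) + x (2 * k)))"
    unfolding r1 top
    by (intro gamma_dot_stage[OF dd]; use k in \<open>auto simp: set_pairs n\<close>)+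
  have rows: "row_steps (concat (map (\<lambda>i. gamma_dot n (n - 2 * i) a) [1..<Suc (Suc t)])) r =
      (top_row n, n # pairs (h - Suc t) h @ [1] @ pairs 1 (h - Suc t))"
  proof -
    have e: "row_steps (?path @ ?P) r = row_steps ?P (row_steps ?path r)" by (rule row_steps_append)
    show ?thesis unfolding split pk e stage k(5) using pairs_Cons[OF k(3)] by simp
  qed
  define y where "y = pull_back ?P (row_steps ?path r) x"
  have S: "sum x {2 * k..n} = x (2 * k) + x (2 * k + 1) + (sum_list (map x [2 * k + 2..<n]) + x n)"
  proof -
    have "sum_list (map x [2 * k + 2..<n]) = sum x {2 * k + 2..<n}"
      by (simp add: interv_sum_list_conv_sum_set_nat)
    moreover have "{2 * k..n} = insert (2 * k) (insert (2 * k + 1) (insert n {2 * k + 2..<n}))"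
      using k by (auto simp: n)
    ultimately show ?thesis using k by (simp add: n)
  qed
  have yo: "y i = x i" if "i \<noteq> n" "i \<noteq> 2 * k + 1" "i \<noteq> 2 * k" for i
    unfolding y_def stage using that by simp
  have yn: "y n = x n + x (2 * k + 1) + x (2 * k)" and yu: "y (2 * k + 1) = x (2 * k + 1) + a * (x (2 * k) + x (2 * k + 1))"
    and ye: "y (2 * k) = x (2 * k) + x (2 * k + 1) + sum x {2 * k..n}"
    unfolding y_def stage S using k by (auto simp: n)
  \<comment> \<open>The letter \<open>n\<close> has taken over the lengths of the pair at
    \<open>2 * k\<close>, so the sum of \<open>y\<close> over the shorter range is that of
    \<open>x\<close> over the longer one; the rows of earlier stages thus end up with the full
    sum.\<close>
  have Sy: "sum y {2 * Suc k..n} = sum x {2 * k..n}"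
  proof -
    have e: "{2 * Suc k..n} = insert n {2 * k + 2..<n}" using k by (auto simp: n)
    have "sum y {2 * k + 2..<n} = sum x {2 * k + 2..<n}" using yo by (intro sum.cong) auto
    then show ?thesis unfolding e S using yn by (simp add: interv_sum_list_conv_sum_set_nat)
  qed
  have "pull_back (?path @ ?P) r x i =
      (if i = n then sum x {2 * k..n}
       else if i < 2 * k then x i
       else if even i then x i + x (i + 1) + sum x {2 * k..n}
       else x i + a * (x (i - 1) + x i))" if i: "i \<le> n" for i
  proof -
    have "pull_back (?path @ ?P) r x i = pull_back ?path r y i"
      unfolding pull_back_append y_def ..
    also have "\<dots> = (if i = n then sum y {2 * (Suc k)..n}
       else if i < 2 * (Suc k) then y i
       else if even i then y i + y (i + 1) + sum y {2 * (Suc k)..n}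
       else y i + a * (y (i - 1) + y i))"
      using IH[of y] i unfolding k(2) by blast
    also have "\<dots> = (if i = n then sum x {2 * k..n}
       else if i < 2 * k then x i
       else if even i then x i + x (i + 1) + sum x {2 * k..n}
       else x i + a * (x (i - 1) + x i))"
    proof -
      have "i = n \<or> i < 2 * k \<or> i = 2 * k \<or> i = 2 * k + 1 \<or> (2 * Suc k \<le> i \<and> i \<noteq> n)" by arith
      then consider "i = n" | "i < 2 * k" | "i = 2 * k" | "i = 2 * k + 1" | "2 * Suc k \<le> i" "i \<noteq> n" by blast
      then show ?thesis
      proof cases
        case 5
        have "y i = x i" using 5 by (intro yo) auto
        moreover have "y (i + 1) = x (i + 1)" if "even i"
          using 5 i that n by (intro yo) (auto elim!: evenE)
        moreover have "y (i - 1) = x (i - 1)" if "odd i"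
        proof -
          have "i \<noteq> 2 * Suc k" using that by auto
          then show ?thesis using 5 i by (intro yo) auto
        qed
        ultimately show ?thesis using 5 Sy by auto
      qed (use Sy yo yu ye k n in \<open>auto\<close>)
    qed
    finally show ?thesis .
  qed
  then show ?case using rows unfolding split pk k(5) by blast
qed

section \<open>The transition matrix of the loop\<close>

lemma sum_Theta_split:
  fixes n :: nat and f :: "nat \<Rightarrow> real"
  assumes "n \<ge> 2" shows "sum f {1..n} = f 1 + sum f {2..n}"
  using assms by (simp add: sum.atLeast_Suc_atMost numeral_2_eq_2)

lemma mat_vec_Theta:
  fixes x :: "nat \<Rightarrow> real"
  assumes n: "even n" "n \<ge> 4" and i: "i \<in> {1..n}"
  shows "mat_vec n (Theta n a c) x i =
    (if i = 1 then x 1 + c * sum x {2..n}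
     else if i = n then x 1 + (c + 1) * sum x {2..n}
     else if even i then x i + x (i + 1) + sum x {2..n}
     else x i + a * (x (i - 1) + x i))"
proof -
  have tail: "sum (\<lambda>k. Theta n a c i k * x k) {2..n} =
    (if i = 1 then c * sum x {2..n}
     else if i = n then (c + 1) * sum x {2..n}
     else if even i then x i + x (i + 1) + sum x {2..n}
     else x i + a * (x (i - 1) + x i))"
  proof -
    consider "i = 1" | "i = n" "i \<noteq> 1" | "i \<noteq> n" "i \<noteq> 1" "even i" | "i \<noteq> n" "i \<noteq> 1" "odd i" by blast
    then show ?thesis
    proof cases
      case 1 then show ?thesis by (auto simp: Theta_def sum_distrib_left intro!: sum.cong)
    next
      case 2 then show ?thesis by (auto simp: Theta_def sum_distrib_left intro!: sum.cong)
    next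
      case 3
      then have r: "i \<in> {2..n}" "i + 1 \<in> {2..n}" using i n by (auto)
      have "sum (\<lambda>k. Theta n a c i k * x k) {2..n} =
        sum (\<lambda>k. x k + ((if k = i then x k else 0) + (if k = i + 1 then x k else 0))) {2..n}"
        using 3 by (intro sum.cong) (auto simp: Theta_def)
      then show ?thesis using 3 r by (simp add: sum.distrib)
    next
      case 4
      then have r: "i \<in> {2..n}" "i - 1 \<in> {2..n}" "i - 1 \<noteq> i" using i by (auto elim!: oddE)
      have "sum (\<lambda>k. Theta n a c i k * x k) {2..n} =
        sum (\<lambda>k. (if k = i then (a + 1) * x k else 0) + (if k = i - 1 then a * x k else 0)) {2..n}"
        using 4 r by (intro sum.cong) (auto simp: Theta_def)
      then show ?thesis using 4 r by (simp add: sum.distrib algebra_simps)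
    qed
  qed
  have "mat_vec n (Theta n a c) x i = Theta n a c i 1 * x 1 + sum (\<lambda>k. Theta n a c i k * x k) {2..n}"
    unfolding mat_vec_def using n by (intro sum_Theta_split) auto
  then show ?thesis unfolding tail using i by (cases "i = 2") (auto simp: Theta_def)
qed

text \<open>The initial 0 moves the letter 1 from the end of the bottom row to the place behind
  \<open>n\<close>, the stages bring all pairs in front of it again, and the final rotations change
  only the length of 1.\<close>

lemma gamma_loop:
  fixes x :: "nat \<Rightarrow> real"
  assumes "even n" "n \<ge> 4"
  defines "r \<equiv> (top_row n, bot_row n)"
  shows "row_steps (gamma n a c) r = r"
    and "i \<in> {1..n} \<Longrightarrow> pull_back (gamma n a c) r x i = mat_vec n (Theta n a c) x i"
proof -
  obtain h where h: "n = 2 * h" "h \<ge> 2" using assms by (auto elim!: evenE)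
  let ?dots = "concat (map (\<lambda>i. gamma_dot n (n - 2 * i) a) [1..<n div 2])"
  let ?r1 = "(top_row n, n # 1 # pairs 1 h)"
  have last_top: "last (top_row (2 * h)) = 2 * h" using h by (simp add: top_row_def)
  have s0: "row_step 0 r = ?r1" "winner 0 r = n" "loser 0 r = 1"
    using h last_top by (auto simp: r_def bot_row_pairs)
  have dots: "row_steps ?dots ?r1 = r"
    "\<forall>i\<le>n. pull_back ?dots ?r1 y i = (if i = n then sum y {2..n}
       else if i < 2 then y i
       else if even i then y i + y (i + 1) + sum y {2..n}
       else y i + a * (y (i - 1) + y i))" for y :: "nat \<Rightarrow> real"
    using gamma_dots[OF h, of "h - 1" a y] h by (auto simp: r_def bot_row_pairs pairs_def)
  have top: "top_row n = 1 # [2..<n + 1]"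
  proof -
    have "[1..<n + 1] = 1 # [Suc 1..<n + 1]" using h by (intro upt_conv_Cons) simp
    then show ?thesis by (simp only: top_row_def Suc_1)
  qed
  have r: "r = (1 # [2..<n + 1], (n # pairs 1 h) @ [1])"
    using h unfolding r_def top by (simp add: bot_row_pairs)
  have rot: "row_steps (replicate (c * (n - 1)) 1) r = r"
    "pull_back (replicate (c * (n - 1)) 1) r x = x(1 := x 1 + c * sum x {2..n})"
    using full_rotations[of 1 "[2..<n + 1]" c "n # pairs 1 h" x] h
    unfolding r by (auto simp: interv_sum_list_conv_sum_set_nat atLeastLessThanSuc_atLeastAtMost simp del: upt_Suc)
  have g: "gamma n a c = 0 # ?dots @ replicate (c * (n - 1)) 1" by (simp add: gamma_def)
  show "row_steps (gamma n a c) r = r"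
    unfolding g row_steps.simps row_steps_append s0 dots rot ..
  show "pull_back (gamma n a c) r x i = mat_vec n (Theta n a c) x i" if i: "i \<in> {1..n}"
  proof -
    define z where "z = x(1 := x 1 + c * sum x {2..n})"
    have z: "sum z {2..n} = sum x {2..n}" unfolding z_def by (intro sum.cong) auto
    define y where "y = pull_back ?dots ?r1 z"
    \<comment> \<open>The initial 0 is pulled back last: \<open>n\<close> receives the length of 1,
      which already contains \<open>c * sum x {2..n}\<close>. Hence the entries \<open>c + 1\<close>
      in row \<open>n\<close>.\<close>
    have "pull_back (gamma n a c) r x = y(n := y n + y 1)"
      unfolding g pull_back.simps pull_back_append s0 dots rot Let_def y_def z_def ..
    moreover have "y i = (if i = n then sum x {2..n}
       else if i < 2 then z i
       else if even i then z i + z (i + 1) + sum x {2..n}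
       else z i + a * (z (i - 1) + z i))" if "i \<in> {1..n}" for i
      using dots(2)[of z] that unfolding y_def z by auto
    ultimately show ?thesis
      using i h unfolding mat_vec_Theta[OF assms(1,2) i]
      by (auto simp: z_def algebra_simps elim!: oddE)
  qed
qed

section \<open>The matrix product\<close>

lemma theta_prod_cong:
  "(\<And>i. i \<in> {1..n} \<Longrightarrow> u i = v i) \<Longrightarrow> r \<in> {1..n} \<Longrightarrow> theta_prod n a c m u r = theta_prod n a c m v r"
proof (induction m arbitrary: u v)
  case (Suc m)
  have "mat_vec n M u = mat_vec n M v" for M
    using Suc.prems(1) by (auto simp: mat_vec_def fun_eq_iff intro!: sum.cong)
  then show ?case by simp
qed simp

locale theta_seq =
  fixes n p :: nat and a c :: "nat \<Rightarrow> nat"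
  assumes n: "even n" "n \<ge> 4" and p: "p \<ge> n + 1" and c1: "c 1 > 0"
    and a: "\<And>k. k \<ge> 1 \<Longrightarrow> a k = p * c k"
    and c: "\<And>k. k \<ge> 1 \<Longrightarrow> c (k + 1) = p * a k"
begin

declare One_nat_def [simp del]

abbreviation "\<Theta> m \<equiv> Theta n (a m) (c m)"

definition C :: "nat \<Rightarrow> nat \<Rightarrow> nat \<Rightarrow> real" where
  "C m j = theta_prod n a c m (std_basis j)"

definition N :: "nat \<Rightarrow> nat \<Rightarrow> real" where
  "N m j = (\<Sum>r=1..n. C m j r)"

definition ev :: "nat set" where "ev = {i. even i \<and> 2 \<le> i \<and> i < n}"

lemma ev_finite [simp]: "finite ev"
  by (rule finite_subset[of _ "{..n}"]) (auto simp: ev_def)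

lemma ev_Suc: "e \<in> ev \<Longrightarrow> e + 1 < n"
  using n(1) by (auto simp: ev_def elim!: evenE)

lemma ev_D: "e \<in> ev \<Longrightarrow> even e \<and> 2 \<le> e \<and> e < n" by (simp add: ev_def)

lemma index_cases:
  assumes "j \<in> {1..n}"
  obtains "j = 1" | "j = n" | "j \<in> ev" | e where "e \<in> ev" "j = e + 1"
proof -
  have "j - 1 \<in> ev \<and> j = j - 1 + 1" if "j \<noteq> 1" "j \<noteq> n" "odd j"
    using that assms by (auto simp: ev_def elim!: oddE)
  moreover have "j \<in> ev" if "j \<noteq> n" "even j"
    using that assms by (auto simp: ev_def elim!: evenE)
  ultimately show thesis using that by blast
qed

lemma sum_split:
  fixes f :: "nat \<Rightarrow> real"
  shows "sum f {1..n} = f 1 + f n + sum f ev + (\<Sum>e\<in>ev. f (e + 1))"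
proof -
  have eq: "{1..n} = insert 1 (insert n (ev \<union> Suc ` ev))"
  proof (intro equalityI subsetI)
    fix x assume "x \<in> {1..n}"
    then show "x \<in> insert 1 (insert n (ev \<union> Suc ` ev))" by (cases rule: index_cases) auto
  next
    fix x assume "x \<in> insert 1 (insert n (ev \<union> Suc ` ev))"
    then show "x \<in> {1..n}" using n by (auto simp: ev_def)
  qed
  have d: "ev \<inter> Suc ` ev = {}" by (auto simp: ev_def)
  have "1 \<notin> insert n (ev \<union> Suc ` ev)" "n \<notin> ev \<union> Suc ` ev"
    using n by (auto simp: ev_def)
  then have "sum f {1..n} = f 1 + (f n + sum f (ev \<union> Suc ` ev))"
    unfolding eq by simp
  also have "sum f (ev \<union> Suc ` ev) = sum f ev + sum f (Suc ` ev)"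
    using d by (intro sum.union_disjoint) auto
  also have "sum f (Suc ` ev) = (\<Sum>e\<in>ev. f (e + 1))"
    by (simp add: sum.reindex flip: Suc_eq_plus1)
  finally show ?thesis by simp
qed

lemma C_0: "C 0 j r = (if r = j then 1 else 0)"
  by (simp add: C_def std_basis_def)

lemma mat_vec_std_basis:
  assumes "j \<in> {1..n}" shows "mat_vec n M (std_basis j) i = M i j"
proof -
  have "mat_vec n M (std_basis j) i = (\<Sum>k=1..n. if k = j then M i k else 0)"
    unfolding mat_vec_def std_basis_def by (intro sum.cong) auto
  then show ?thesis using assms by simp
qed

lemma theta_prod_expand:
  "r \<in> {1..n} \<Longrightarrow> theta_prod n a c m v r = (\<Sum>j=1..n. v j * C m j r)"
proof (induction m arbitrary: v)
  case 0
  have "(\<Sum>j=1..n. v j * C 0 j r) = (\<Sum>j=1..n. if r = j then v j else 0)"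
    by (intro sum.cong) (auto simp: C_0)
  then show ?case using 0 by simp
next
  case (Suc m)
  note IH = Suc.IH[OF Suc.prems]
  have C': "C (Suc m) j r = (\<Sum>i=1..n. \<Theta> (Suc m) i j * C m i r)" if "j \<in> {1..n}" for j
  proof -
    have "C (Suc m) j r = theta_prod n a c m (mat_vec n (\<Theta> (Suc m)) (std_basis j)) r"
      by (simp add: C_def)
    also have "\<dots> = (\<Sum>i=1..n. mat_vec n (\<Theta> (Suc m)) (std_basis j) i * C m i r)" by (rule IH)
    finally show ?thesis unfolding mat_vec_std_basis[OF that] .
  qed
  have "theta_prod n a c (Suc m) v r = theta_prod n a c m (mat_vec n (\<Theta> (Suc m)) v) r" by simp
  also have "\<dots> = (\<Sum>i=1..n. mat_vec n (\<Theta> (Suc m)) v i * C m i r)" by (rule IH)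
  also have "\<dots> = (\<Sum>i=1..n. \<Sum>k=1..n. \<Theta> (Suc m) i k * v k * C m i r)"
    unfolding mat_vec_def sum_distrib_right ..
  also have "\<dots> = (\<Sum>k=1..n. \<Sum>i=1..n. \<Theta> (Suc m) i k * v k * C m i r)"
    by (rule sum.swap)
  also have "\<dots> = (\<Sum>k=1..n. v k * C (Suc m) k r)"
    by (intro sum.cong) (auto simp: C' sum_distrib_left algebra_simps)
  finally show ?case .
qed

text \<open>The new factor stands on the right, so the new columns are combinations of the old ones,
  with coefficients from a column of the new factor. The column sums inherit this recursion.\<close>

lemma C_Suc:
  assumes j: "j \<in> {1..n}" and r: "r \<in> {1..n}"
  shows "C (Suc m) j r = (\<Sum>i=1..n. \<Theta> (Suc m) i j * C m i r)"
proof -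
  have "C (Suc m) j r = theta_prod n a c m (mat_vec n (\<Theta> (Suc m)) (std_basis j)) r"
    by (simp add: C_def)
  also have "\<dots> = (\<Sum>i=1..n. mat_vec n (\<Theta> (Suc m)) (std_basis j) i * C m i r)"
    by (rule theta_prod_expand[OF r])
  finally show ?thesis unfolding mat_vec_std_basis[OF j] .
qed

lemma N_Suc:
  assumes j: "j \<in> {1..n}" shows "N (Suc m) j = (\<Sum>i=1..n. \<Theta> (Suc m) i j * N m i)"
proof -
  have "N (Suc m) j = (\<Sum>r=1..n. \<Sum>i=1..n. \<Theta> (Suc m) i j * C m i r)"
    unfolding N_def by (intro sum.cong) (auto simp: C_Suc[OF j])
  also have "\<dots> = (\<Sum>i=1..n. \<Sum>r=1..n. \<Theta> (Suc m) i j * C m i r)" by (rule sum.swap)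
  finally show ?thesis by (simp add: N_def sum_distrib_left)
qed

lemma Theta_nonneg: "0 \<le> \<Theta> m i j"
  by (auto simp: Theta_def)

lemma C_nonneg: "j \<in> {1..n} \<Longrightarrow> r \<in> {1..n} \<Longrightarrow> 0 \<le> C m j r"
proof (induction m arbitrary: j)
  case 0 then show ?case by (simp add: C_0)
next
  case (Suc m)
  then show ?case unfolding C_Suc[OF Suc.prems]
    by (intro sum_nonneg mult_nonneg_nonneg Theta_nonneg) auto
qed

lemma C_le_N: "j \<in> {1..n} \<Longrightarrow> r \<in> {1..n} \<Longrightarrow> C m j r \<le> N m j"
  unfolding N_def by (rule member_le_sum) (auto intro: C_nonneg)

lemma N_0: "j \<in> {1..n} \<Longrightarrow> N 0 j = 1"
  by (simp add: N_def C_0)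

lemma index_n [simp]: "1 \<in> {1..n}" "n \<in> {1..n}" "e \<in> ev \<Longrightarrow> e \<in> {1..n}" "e \<in> ev \<Longrightarrow> e + 1 \<in> {1..n}"
  using n ev_Suc[of e] by (auto simp: ev_def)

lemma index_bounds [simp]: "1 \<le> n" "e \<in> ev \<Longrightarrow> 1 \<le> e" "e \<in> ev \<Longrightarrow> e \<le> n" "e \<in> ev \<Longrightarrow> e + 1 \<le> n"
  using n ev_Suc[of e] by (auto simp: ev_def)

section \<open>Recursion of the column sums\<close>

lemma N_1: "N (Suc m) 1 = N m 1 + N m n"
proof -
  have "(\<Sum>e\<in>ev. \<Theta> (Suc m) e 1 * N m e) = 0"
    by (intro sum.neutral) (auto simp: Theta_def ev_def)
  moreover have "(\<Sum>e\<in>ev. \<Theta> (Suc m) (e + 1) 1 * N m (e + 1)) = 0"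
    using n by (intro sum.neutral) (auto simp: Theta_def ev_def)
  ultimately show ?thesis using n unfolding N_Suc[OF index_n(1)] sum_split by (simp add: Theta_def)
qed

lemma N_n: "N (Suc m) n = c (Suc m) * (N m 1 + N m n) + N m n + sum (N m) ev"
proof -
  have "(\<Sum>e\<in>ev. \<Theta> (Suc m) e n * N m e) = sum (N m) ev"
    using n by (intro sum.cong) (auto simp: Theta_def ev_def)
  moreover have "(\<Sum>e\<in>ev. \<Theta> (Suc m) (e + 1) n * N m (e + 1)) = 0"
    using n by (intro sum.neutral) (auto simp: Theta_def ev_def)
  ultimately show ?thesis using n unfolding N_Suc[OF index_n(2)] sum_split by (simp add: Theta_def algebra_simps)
qed

text \<open>Column \<open>e\<close> of the matrix exceeds column \<open>n\<close> only by 1 in row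
  \<open>e\<close> and by \<open>a\<close> in row \<open>e + 1\<close>; so the whole new sum
  \<open>N (Suc m) n\<close> can be split off.\<close>

lemma N_even:
  assumes e: "e \<in> ev" shows "N (Suc m) e = N (Suc m) n + N m e + a (Suc m) * N m (e + 1)"
proof -
  have "(\<Sum>i\<in>ev. \<Theta> (Suc m) i e * N m i) = (\<Sum>i\<in>ev. N m i + (if i = e then N m i else 0))"
    using ev_D[OF e] n by (intro sum.cong) (auto simp: Theta_def ev_def)
  then have 1: "(\<Sum>i\<in>ev. \<Theta> (Suc m) i e * N m i) = sum (N m) ev + N m e"
    using e by (simp add: sum.distrib)
  have "(\<Sum>i\<in>ev. \<Theta> (Suc m) (i + 1) e * N m (i + 1)) = (\<Sum>i\<in>ev. if i = e then a (Suc m) * N m (i + 1) else 0)"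
    using ev_D[OF e] n by (intro sum.cong) (auto simp: Theta_def ev_def)
  then have 2: "(\<Sum>i\<in>ev. \<Theta> (Suc m) (i + 1) e * N m (i + 1)) = a (Suc m) * N m (e + 1)"
    using e by simp
  show ?thesis using ev_D[OF e] n unfolding N_n unfolding N_Suc[OF index_n(3)[OF e]] sum_split 1 2
    by (simp add: Theta_def algebra_simps)
qed

lemma N_odd:
  assumes e: "e \<in> ev" shows "N (Suc m) (e + 1) = N (Suc m) n + N m e + (real (a (Suc m)) + 1) * N m (e + 1)"
proof -
  have "(\<Sum>i\<in>ev. \<Theta> (Suc m) i (e + 1) * N m i) = (\<Sum>i\<in>ev. N m i + (if i = e then N m i else 0))"
    using ev_D[OF e] n by (intro sum.cong) (auto simp: Theta_def ev_def)
  then have 1: "(\<Sum>i\<in>ev. \<Theta> (Suc m) i (e + 1) * N m i) = sum (N m) ev + N m e"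
    using e by (simp add: sum.distrib)
  have "(\<Sum>i\<in>ev. \<Theta> (Suc m) (i + 1) (e + 1) * N m (i + 1)) =
      (\<Sum>i\<in>ev. if i = e then (real (a (Suc m)) + 1) * N m (i + 1) else 0)"
    using ev_D[OF e] n by (intro sum.cong) (auto simp: Theta_def ev_def)
  then have 2: "(\<Sum>i\<in>ev. \<Theta> (Suc m) (i + 1) (e + 1) * N m (i + 1)) = (real (a (Suc m)) + 1) * N m (e + 1)"
    using e by simp
  show ?thesis using ev_D[OF e] n unfolding N_n unfolding N_Suc[OF index_n(4)[OF e]] sum_split 1 2
    by (simp add: Theta_def algebra_simps)
qed

section \<open>Growth of the column sums\<close>

lemma c_formula: "c (Suc m) = c 1 * p ^ (2 * m)"
proof (induction m)
  case (Suc m)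
  have "c (Suc (Suc m)) = p * (p * c (Suc m))" using a[of "Suc m"] c[of "Suc m", unfolded Suc_eq_plus1[symmetric]] by simp
  then show ?case by (simp add: Suc)
qed (simp add: One_nat_def)

lemma p5: "5 \<le> p" "5 \<le> real p" using p n by simp_all

lemma c_ge: "real (c (Suc m)) \<ge> real p ^ (2 * m)"
proof -
  have "p ^ (2 * m) \<le> c (Suc m)" using c1 by (simp add: c_formula)
  then show ?thesis by (metis of_nat_le_iff of_nat_power)
qed

lemma c_ge_1: "real (c (Suc m)) \<ge> 1"
proof -
  have "1 \<le> real p ^ (2 * m)" using p5 by (intro one_le_power) simp
  then show ?thesis using c_ge[of m] by linarith
qed

lemma a_eq: "real (a (Suc m)) = p * c (Suc m)"
  using a[of "Suc m"] by simp

lemma N_nonneg: "j \<in> {1..n} \<Longrightarrow> 0 \<le> N m j"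
  unfolding N_def by (intro sum_nonneg C_nonneg) auto

lemma N_nonneg_simps [simp]: "0 \<le> N m 1" "0 \<le> N m n" "e \<in> ev \<Longrightarrow> 0 \<le> N m e" "e \<in> ev \<Longrightarrow> 0 \<le> N m (e + 1)"
  by (intro N_nonneg; simp)+

lemma sum_ev_nonneg: "0 \<le> sum (N m) ev"
  by (intro sum_nonneg N_nonneg) simp

lemma N_n_ge: "c (Suc m) * N m 1 + c (Suc m) * N m n + N m n \<le> N (Suc m) n"
  unfolding N_n using sum_ev_nonneg[of m] by (simp add: algebra_simps)

lemma c_N_le: "c (Suc m) * N m n \<le> N (Suc m) n"
proof -
  have "0 \<le> c (Suc m) * N m 1" "0 \<le> N m n" by simp_all
  then show ?thesis using N_n_ge[of m] by linarith
qed

lemma N_n_mono: "N m n \<le> N (Suc m) n"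
proof -
  have "0 \<le> c (Suc m) * N m 1" "0 \<le> c (Suc m) * N m n"
    using N_nonneg[of 1 m] N_nonneg[of n m] by (auto intro!: mult_nonneg_nonneg)
  then show ?thesis using N_n_ge[of m] by linarith
qed

lemma N_n_ge_1: "1 \<le> N m n"
proof (induction m)
  case 0 then show ?case using n by (simp add: N_0)
next
  case (Suc m) then show ?case using N_n_mono[of m] by simp
qed

lemma N_Suc_ge:
  assumes "j \<in> {1..n}" shows "N m n \<le> N (Suc m) j"
  using assms
proof (cases rule: index_cases)
  case 1 then show ?thesis using N_nonneg[of 1 m] by (simp add: N_1)
next
  case 2 then show ?thesis using N_n_mono by simp
next
  case 3
  have "0 \<le> a (Suc m) * N m (j + 1)" using 3 by (intro mult_nonneg_nonneg N_nonneg) auto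
  then show ?thesis unfolding N_even[OF 3] using N_n_mono[of m] N_nonneg_simps(3)[OF 3, of m] by linarith
next
  case (4 e)
  have "0 \<le> (real (a (Suc m)) + 1) * N m (e + 1)" using 4 by (intro mult_nonneg_nonneg N_nonneg) auto
  then show ?thesis unfolding 4(2) N_odd[OF 4(1)] using N_n_mono[of m] N_nonneg_simps(3)[OF 4(1), of m] by linarith
qed

lemma N_pos: "j \<in> {1..n} \<Longrightarrow> 1 \<le> N m j"
  using N_Suc_ge[of j] N_n_ge_1 by (cases m) (auto simp: N_0 intro: order_trans)

lemma N_large: "j \<in> {1..n} \<Longrightarrow> 2 ^ m \<le> N (Suc (Suc m)) j"
proof -
  assume j: "j \<in> {1..n}"
  have "(2::real) ^ m \<le> real p ^ m" using p5 by (intro power_mono) auto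
  also have "\<dots> \<le> real p ^ (2 * m)" using p5 by (intro power_increasing) auto
  also have "\<dots> \<le> real (c (Suc m)) * 1" using c_ge by simp
  also have "\<dots> \<le> real (c (Suc m)) * N m n" using N_n_ge_1 by (intro mult_left_mono) auto
  also have "\<dots> \<le> N (Suc m) n"
    by (rule c_N_le)
  also have "\<dots> \<le> N (Suc (Suc m)) j" using N_Suc_ge[OF j] .
  finally show ?thesis .
qed

lemma N_inverse_tendsto: "j \<in> {1..n} \<Longrightarrow> (\<lambda>m. inverse (N m j)) \<longlonglongrightarrow> 0"
proof -
  assume j: "j \<in> {1..n}"
  have "(\<lambda>m. (1/2::real) ^ m) \<longlonglongrightarrow> 0" by (intro LIMSEQ_power_zero) simp
  then have "(\<lambda>m. inverse (N (m + 2) j)) \<longlonglongrightarrow> 0"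
  proof (rule tendsto_sandwich[OF _ _ tendsto_const, rotated 2])
    show "\<forall>\<^sub>F m in sequentially. 0 \<le> inverse (N (m + 2) j)"
      using N_nonneg[OF j] by (intro always_eventually allI) simp
    show "\<forall>\<^sub>F m in sequentially. inverse (N (m + 2) j) \<le> (1/2) ^ m"
      using N_large[OF j] by (intro always_eventually allI)
        (simp add: power_one_over inverse_eq_divide frac_le)
  qed
  then show ?thesis by (rule LIMSEQ_offset)
qed

text \<open>Column 1 never gets a large coefficient: its new sum is \<open>N m 1 + N m n\<close>,
  and one block later column \<open>n\<close> receives a multiple by \<open>c\<close> of that value.
  The factor \<open>p ^ 2\<close> pays for the shift of the index by one.\<close>

lemma N_1_le: "N m 1 \<le> N m n * (p ^ 2 * (1 / p ^ 2) ^ m)"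
proof (cases m)
  case 0 then show ?thesis using n p5 by (simp add: N_0 one_le_power)
next
  case (Suc m')
  have "c (Suc m') * N (Suc m') 1 \<le> N (Suc m') n"
    using N_n_ge[of m'] N_n_ge_1[of m'] by (simp add: N_1 algebra_simps)
  moreover have "real p ^ (2 * m') * N (Suc m') 1 \<le> c (Suc m') * N (Suc m') 1"
    using c_ge N_nonneg[of 1 "Suc m'"] by (intro mult_right_mono) auto
  ultimately have "real p ^ (2 * m') * N (Suc m') 1 \<le> N (Suc m') n" by linarith
  moreover have "real p ^ 2 * (1 / p ^ 2) ^ Suc m' = 1 / real p ^ (2 * m')"
    using p5 by (simp add: power_one_over power_mult)
  ultimately show ?thesis using Suc p5 by (simp add: field_simps)
qed

lemma N_even_le_odd: "e \<in> ev \<Longrightarrow> N m e \<le> N m (e + 1)"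
proof (cases m)
  case 0
  then show "e \<in> ev \<Longrightarrow> ?thesis" using index_n by (simp only: N_0 order_refl)
next
  case (Suc m')
  assume e: "e \<in> ev"
  show ?thesis unfolding Suc N_even[OF e] N_odd[OF e] using N_nonneg_simps(4)[OF e, of m']
    by (simp add: distrib_right)
qed

text \<open>While \<open>N m n\<close> grows at least by the factor \<open>c\<close>, column
  \<open>e + 1\<close> gains at most \<open>(p + 2) * c\<close>, since
  \<open>p * c + 2 <= (p + 2) * c\<close>; the added \<open>N (Suc m) n\<close> raises the rate to
  \<open>p + 3\<close>.\<close>

lemma N_odd_le: "e \<in> ev \<Longrightarrow> N m (e + 1) \<le> (p + 3) ^ m * N m n"
proof (induction m)
  case 0 then show ?case using index_n by (simp only: N_0) simp
next
  case (Suc m)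
  let ?c = "real (c (Suc m))" and ?q = "real (p + 3) ^ m"
  have q: "1 \<le> ?q" by (intro one_le_power) simp
  have "N (Suc m) (e + 1) \<le> N (Suc m) n + (p * ?c + 2) * N m (e + 1)"
    unfolding N_odd[OF Suc.prems] a_eq using N_even_le_odd[OF Suc.prems, of m] by (simp add: distrib_right)
  also have "\<dots> \<le> N (Suc m) n + ((p + 2) * ?c) * N m (e + 1)"
  proof (intro add_left_mono mult_right_mono)
    show "p * ?c + 2 \<le> (p + 2) * ?c" using c_ge_1[of m] by (simp add: algebra_simps)
  qed (rule N_nonneg_simps(4)[OF Suc.prems])
  also have "\<dots> \<le> N (Suc m) n + ((p + 2) * ?c) * (?q * N m n)"
    using Suc by (intro add_left_mono mult_left_mono) auto
  also have "\<dots> = N (Suc m) n + ((p + 2) * ?q) * (?c * N m n)" by simp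
  also have "\<dots> \<le> N (Suc m) n + ((p + 2) * ?q) * N (Suc m) n"
    using c_N_le[of m] by (intro add_left_mono mult_left_mono) auto
  also have "\<dots> \<le> ?q * N (Suc m) n + ((p + 2) * ?q) * N (Suc m) n"
    using q N_n_ge_1[of "Suc m"] mult_right_mono[of 1 ?q "N (Suc m) n"] by simp
  also have "\<dots> = (p + 3) ^ Suc m * N (Suc m) n" by (simp add: algebra_simps)
  finally show ?case .
qed

section \<open>Summable error terms\<close>

definition q :: real where "q = (p + 3) / p ^ 2"

text \<open>\<open>q\<close> compares the upper growth rate \<open>p + 3\<close> of
  \<open>N m (e + 1) / N m n\<close> with the rate \<open>p ^ 2\<close> of \<open>c\<close>. As it
  also dominates \<open>1 / p ^ 2\<close>, the decay rate of \<open>N m 1 / N m n\<close>, one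
  geometric series serves both error sources.\<close>

lemma q_bounds: "0 < q" "q < 1" "1 / p ^ 2 \<le> q"
proof -
  have "5 * real p \<le> real p * real p" using p5 by (intro mult_right_mono) auto
  then have "real p + 3 < real p ^ 2" using p5 unfolding power2_eq_square by linarith
  then show "0 < q" "q < 1" "1 / p ^ 2 \<le> q" using p5 unfolding q_def
    by (auto simp: divide_less_eq intro!: divide_right_mono)
qed

text \<open>The share of the new column sum \<open>N (Suc m) n\<close> that does not come from the
  old column \<open>n\<close>.\<close>

definition \<delta> :: "nat \<Rightarrow> real" where
  "\<delta> m = (c (Suc m) * N m 1 + sum (N m) ev) / N (Suc m) n"

lemma \<delta>_nonneg: "0 \<le> \<delta> m"
  unfolding \<delta>_def using N_nonneg[of 1 m] sum_ev_nonneg[of m] N_nonneg[of n "Suc m"]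
  by (intro divide_nonneg_nonneg add_nonneg_nonneg mult_nonneg_nonneg) auto

lemma N_1_ratio: "N m 1 / N m n \<le> p ^ 2 * q ^ m"
proof -
  have "N m 1 / N m n \<le> p ^ 2 * (1 / p ^ 2) ^ m"
    using N_1_le[of m] N_n_ge_1[of m] by (simp add: divide_le_eq mult.commute)
  also have "\<dots> \<le> p ^ 2 * q ^ m"
    using q_bounds by (intro mult_left_mono power_mono) auto
  finally show ?thesis .
qed

lemma \<delta>_le: "\<delta> m \<le> (n + p ^ 2) * q ^ m"
proof -
  let ?c = "real (c (Suc m))"
  have pos: "0 < ?c" "0 < N m n" "0 < N (Suc m) n" using c_ge_1[of m] N_n_ge_1[of m] N_n_ge_1[of "Suc m"] by linarith+
  have cN: "?c * N m n \<le> N (Suc m) n"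
    by (rule c_N_le)
  have "?c * N m 1 / N (Suc m) n \<le> ?c * N m 1 / (?c * N m n)"
    using cN pos N_nonneg[of 1 m] by (intro divide_left_mono mult_nonneg_nonneg) auto
  also have "\<dots> = N m 1 / N m n" using pos by simp
  finally have 1: "?c * N m 1 / N (Suc m) n \<le> p ^ 2 * q ^ m" using N_1_ratio[of m] by simp
  have "sum (N m) ev \<le> (\<Sum>e\<in>ev. (p + 3) ^ m * N m n)"
    using N_even_le_odd N_odd_le by (intro sum_mono) (blast intro: order_trans)
  also have "\<dots> = card ev * ((p + 3) ^ m * N m n)" by simp
  also have "\<dots> \<le> n * ((p + 3) ^ m * N m n)"
  proof (intro mult_right_mono)
    have "card ev \<le> card {1..n}" by (intro card_mono) (auto simp: ev_def)
    then show "real (card ev) \<le> real n" by simp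
  qed (use pos in auto)
  finally have "sum (N m) ev / N (Suc m) n \<le> n * ((p + 3) ^ m * N m n) / (?c * N m n)"
    using cN pos sum_ev_nonneg by (intro frac_le) auto
  also have "\<dots> = n * ((p + 3) ^ m / ?c)" using pos by simp
  also have "\<dots> \<le> n * ((p + 3) ^ m / real p ^ (2 * m))"
    using c_ge[of m] p5 pos by (intro mult_left_mono divide_left_mono mult_pos_pos) auto
  also have "\<dots> = n * q ^ m" by (simp add: q_def power_divide power_mult)
  finally show ?thesis using 1 by (simp add: \<delta>_def add_divide_distrib algebra_simps)
qed

lemma summable_q: "summable (\<lambda>m. K * q ^ m)"
  using q_bounds by (intro summable_mult summable_geometric) auto

lemma summable_\<delta>: "summable \<delta>"
  by (rule summable_comparison_test'[OF summable_q[of "n + p ^ 2"]])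
    (use \<delta>_le \<delta>_nonneg in auto)

lemma summable_N_1_ratio: "summable (\<lambda>m. N m 1 / N m n)"
  by (rule summable_comparison_test'[OF summable_q[of "p ^ 2"]])
    (use N_1_ratio N_nonneg in auto)

text \<open>Once \<open>\<delta> m < 1/2\<close>, more than half of \<open>N (Suc m) n\<close> is
  \<open>(c + 1) * N m n\<close>, which is at most \<open>2 * c * N m n\<close>; hence the factor
  4.\<close>

lemma N_n_le_ev: "\<forall>\<^sub>F m in sequentially. N (Suc m) n \<le> 4 * real (c (Suc m)) * N m n"
proof -
  have "\<forall>\<^sub>F m in sequentially. \<delta> m < 1/2"
    using summable_LIMSEQ_zero[OF summable_\<delta>] by (rule order_tendstoD) simp
  then show ?thesis
  proof eventually_elim
    case (elim m)
    then have "c (Suc m) * N m 1 + sum (N m) ev < N (Suc m) n / 2"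
      using N_n_ge_1[of "Suc m"] by (simp add: \<delta>_def divide_less_eq)
    then have "N (Suc m) n \<le> 2 * (c (Suc m) * N m n + N m n)"
      using N_n[of m] by (simp add: algebra_simps)
    moreover have "N m n \<le> c (Suc m) * N m n"
      using c_ge_1[of m] N_n_ge_1[of m] mult_right_mono[of 1 "real (c (Suc m))" "N m n"] by simp
    ultimately have "N (Suc m) n \<le> 4 * (c (Suc m) * N m n)" by (simp add: One_nat_def)
    then show ?case by (simp add: mult.assoc)
  qed
qed

lemma N_even_ge: "e \<in> ev \<Longrightarrow> real p * c (Suc m) * N m (e + 1) \<le> N (Suc m) e"
  using N_nonneg[of e m] N_nonneg[of n "Suc m"] by (simp add: N_even a_eq)

text \<open>Column \<open>e\<close> receives \<open>a = p * c\<close> times the old column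
  \<open>e + 1\<close>, whereas column \<open>n\<close> grows at most by \<open>4 * c\<close>: the
  ratio shrinks by \<open>4 / p\<close>, and \<open>p >= 5\<close> keeps this below 1.\<close>

lemma ratio_n_odd_ev:
  assumes e: "e \<in> ev"
  shows "\<forall>\<^sub>F m in sequentially. N (Suc m) n / N (Suc m) e \<le> 4/5 * (N m n / N m (e + 1))"
  using N_n_le_ev
proof eventually_elim
  case (elim m)
  have pos: "1 \<le> N m (e + 1)" "1 \<le> N (Suc m) e" "1 \<le> N m n" using N_pos index_n e by auto
  have "N (Suc m) n / N (Suc m) e \<le> (4 * c (Suc m) * N m n) / (real p * c (Suc m) * N m (e + 1))"
    using elim N_even_ge[OF e, of m] pos c_ge_1[of m] p5
    by (intro frac_le) (auto intro!: mult_pos_pos)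
  also have "\<dots> = 4 / p * (N m n / N m (e + 1))"
    using pos c_ge_1[of m] by (simp add: field_simps)
  also have "\<dots> \<le> 4 / 5 * (N m n / N m (e + 1))"
    using p5 pos by (intro mult_right_mono frac_le) auto
  finally show ?case .
qed

lemma summable_n_odd:
  assumes e: "e \<in> ev" shows "summable (\<lambda>m. N m n / N m (e + 1))"
proof -
  obtain M where M: "\<And>m. m \<ge> M \<Longrightarrow> N (Suc m) n / N (Suc m) e \<le> 4/5 * (N m n / N m (e + 1))"
    using ratio_n_odd_ev[OF e] by (auto simp: eventually_sequentially)
  show ?thesis
  proof (rule summable_ratio_test[of "4/5" M])
    fix m assume "M \<le> m"
    have pos: "1 \<le> N m (e + 1)" "1 \<le> N (Suc m) (e + 1)" "1 \<le> N (Suc m) e" "1 \<le> N m n" "1 \<le> N (Suc m) n"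
      using N_pos index_n e by auto
    have "N (Suc m) n / N (Suc m) (e + 1) \<le> N (Suc m) n / N (Suc m) e"
      using N_even_le_odd[OF e, of "Suc m"] pos by (intro divide_left_mono) auto
    then have "N (Suc m) n / N (Suc m) (e + 1) \<le> 4/5 * (N m n / N m (e + 1))"
      using M[OF \<open>M \<le> m\<close>] by linarith
    then show "norm (N (Suc m) n / N (Suc m) (e + 1)) \<le> 4/5 * norm (N m n / N m (e + 1))"
      using pos by simp
  qed simp
qed

text \<open>The share of the new column \<open>e\<close> that does not come from the old column
  \<open>e + 1\<close>. The new column \<open>e + 1\<close> has the same remainder and a sum at
  least as large, so its share is bounded as well.\<close>

definition \<epsilon> :: "nat \<Rightarrow> nat \<Rightarrow> real" where
  "\<epsilon> e m = (N (Suc m) n + N m e) / N (Suc m) e"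

lemma \<epsilon>_nonneg: "e \<in> ev \<Longrightarrow> 0 \<le> \<epsilon> e m"
  unfolding \<epsilon>_def by (intro divide_nonneg_nonneg add_nonneg_nonneg N_nonneg) auto

lemma summable_\<epsilon>:
  assumes e: "e \<in> ev" shows "summable (\<epsilon> e)"
proof (rule summable_comparison_test_ev)
  show "\<forall>\<^sub>F m in sequentially. norm (\<epsilon> e m) \<le> 4/5 * (N m n / N m (e + 1)) + 1 * q ^ m"
    using ratio_n_odd_ev[OF e]
  proof eventually_elim
    case (elim m)
    have pos: "1 \<le> N m (e + 1)" "1 \<le> N (Suc m) e" "0 \<le> N m e" using N_pos N_nonneg index_n e by auto
    have "N m e / N (Suc m) e \<le> N m (e + 1) / (real p * c (Suc m) * N m (e + 1))"
      using N_even_ge[OF e, of m] N_even_le_odd[OF e, of m] pos c_ge_1[of m] p5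
      by (intro frac_le) (auto intro!: mult_pos_pos)
    also have "\<dots> = 1 / (real p * c (Suc m))" using pos by simp
    also have "\<dots> \<le> 1 / (1 * real p ^ (2 * m))"
    proof (intro divide_left_mono)
      show "1 * real p ^ (2 * m) \<le> real p * c (Suc m)"
        using c_ge[of m] p5 by (intro mult_mono) auto
      show "0 < real p * c (Suc m) * (1 * real p ^ (2 * m))"
        using p5 c_ge_1[of m] by (intro mult_pos_pos) auto
    qed simp
    also have "\<dots> = (1 / p ^ 2) ^ m" by (simp add: power_one_over power_mult)
    also have "\<dots> \<le> q ^ m" using q_bounds by (intro power_mono) auto
    finally show ?case using elim \<epsilon>_nonneg[OF e, of m] by (simp add: \<epsilon>_def add_divide_distrib)
  qed
  show "summable (\<lambda>m. 4/5 * (N m n / N m (e + 1)) + 1 * q ^ m)"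
    by (intro summable_add summable_q summable_mult summable_n_odd e)
qed

definition \<eta> :: "nat \<Rightarrow> real" where
  "\<eta> m = \<delta> m + N m 1 / N m n + (\<Sum>e\<in>ev. \<epsilon> e m)"

lemma summable_\<eta>: "summable \<eta>"
  unfolding \<eta>_def by (intro summable_add summable_\<delta> summable_N_1_ratio summable_sum summable_\<epsilon>)

lemma \<eta>_ge: "\<delta> m \<le> \<eta> m" "N m 1 / N m n \<le> \<eta> m" "e \<in> ev \<Longrightarrow> \<epsilon> e m \<le> \<eta> m" "0 \<le> \<eta> m"
proof -
  have 1: "0 \<le> N m 1 / N m n" using N_nonneg by simp
  have 2: "0 \<le> (\<Sum>e\<in>ev. \<epsilon> e m)" by (intro sum_nonneg \<epsilon>_nonneg)
  show "\<delta> m \<le> \<eta> m" "N m 1 / N m n \<le> \<eta> m" "0 \<le> \<eta> m"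
    using 1 2 \<delta>_nonneg[of m] by (auto simp: \<eta>_def)
  show "\<epsilon> e m \<le> \<eta> m" if "e \<in> ev"
  proof -
    have "\<epsilon> e m \<le> (\<Sum>e\<in>ev. \<epsilon> e m)" using that \<epsilon>_nonneg by (intro member_le_sum) auto
    then show ?thesis unfolding \<eta>_def using 1 \<delta>_nonneg[of m] by linarith
  qed
qed

section \<open>Dominant columns and convergence of the directions\<close>

definition head :: "nat \<Rightarrow> nat" where
  "head j = (if j = 1 \<or> j = n then n else if even j then j + 1 else j)"

lemma head_simps [simp]: "head 1 = n" "head n = n" "e \<in> ev \<Longrightarrow> head e = e + 1" "e \<in> ev \<Longrightarrow> head (e + 1) = e + 1"
  using ev_D[of e] ev_Suc[of e] by (auto simp: head_def)

lemma head_index: "j \<in> {1..n} \<Longrightarrow> head j \<in> {1..n}"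
  by (erule index_cases) (simp_all only: head_simps index_n)

lemma head_hd: "j \<in> {1..n} \<Longrightarrow> head (head j) = head j"
  by (erule index_cases) (simp_all only: head_simps)

text \<open>Apart from the old column of its head, column 1 receives only \<open>N m 1\<close>,
  column \<open>n\<close> the numerator of \<open>\<delta> m\<close>, and columns \<open>e\<close>
  and \<open>e + 1\<close> that of \<open>\<epsilon> e m\<close>. Both \<open>dir_step\<close> and
  \<open>off_step\<close> rest on this bound.\<close>

lemma head_share:
  assumes "j \<in> {1..n}"
  shows "N (Suc m) j - \<Theta> (Suc m) (head j) j * N m (head j) \<le> \<eta> m * N (Suc m) j"
  using assms
proof (cases rule: index_cases)
  case 1
  have pos: "1 \<le> N m 1" "1 \<le> N m n" using N_pos index_n by auto
  have "N m 1 = N m 1 / N m n * N m n" using pos by simp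
  also have "\<dots> \<le> \<eta> m * N (Suc m) 1"
    using \<eta>_ge(2)[of m] \<eta>_ge(4)[of m] pos N_1[of m] by (intro mult_mono) auto
  finally show ?thesis unfolding 1 using n N_1[of m] by (simp add: Theta_def)
next
  case 2
  have pos: "1 \<le> N (Suc m) n" using N_pos index_n by auto
  have "c (Suc m) * N m 1 + sum (N m) ev = \<delta> m * N (Suc m) n" using pos by (simp add: \<delta>_def)
  also have "\<dots> \<le> \<eta> m * N (Suc m) n" using \<eta>_ge(1) pos by (intro mult_right_mono) auto
  finally show ?thesis unfolding 2 using n N_n[of m] by (simp add: Theta_def algebra_simps)
next
  case 3
  have pos: "1 \<le> N (Suc m) j" using N_pos assms by auto
  have "N (Suc m) n + N m j = \<epsilon> j m * N (Suc m) j" using pos by (simp add: \<epsilon>_def)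
  also have "\<dots> \<le> \<eta> m * N (Suc m) j" using \<eta>_ge(3)[OF 3] pos by (intro mult_right_mono) auto
  finally show ?thesis using N_even[OF 3, of m] ev_D[OF 3] ev_Suc[OF 3]
    unfolding head_simps(3)[OF 3] by (simp add: Theta_def)
next
  case (4 e)
  have pos: "1 \<le> N (Suc m) e" using N_pos 4 by auto
  have "N (Suc m) n + N m e = \<epsilon> e m * N (Suc m) e" using pos by (simp add: \<epsilon>_def)
  also have "\<dots> \<le> \<eta> m * N (Suc m) (e + 1)"
    using \<eta>_ge(3)[OF 4(1)] \<eta>_ge(4) pos N_even_le_odd[OF 4(1)] by (intro mult_mono) auto
  finally show ?thesis using N_odd[OF 4(1), of m] ev_D[OF 4(1)] ev_Suc[OF 4(1)]
    unfolding 4(2) head_simps(4)[OF 4(1)] by (simp add: Theta_def)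
qed

definition dir :: "nat \<Rightarrow> nat \<Rightarrow> nat \<Rightarrow> real" where
  "dir m j r = C m j r / N m j"

lemma dir_normalize: "dir m j = normalize_vec n (theta_prod n a c m (std_basis j))"
  by (simp add: fun_eq_iff dir_def normalize_vec_def N_def C_def)

lemma dir_bounds: "j \<in> {1..n} \<Longrightarrow> r \<in> {1..n} \<Longrightarrow> 0 \<le> dir m j r \<and> dir m j r \<le> 1"
  unfolding dir_def using C_nonneg[of j r m] C_le_N[of j r m] N_pos[of j m] by (auto simp: divide_le_eq)

lemma dir_sum: "j \<in> {1..n} \<Longrightarrow> (\<Sum>r=1..n. dir m j r) = 1"
  unfolding dir_def sum_divide_distrib[symmetric] N_def[symmetric] using N_pos[of j m] by auto

text \<open>The new direction is a convex combination of old ones in which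
  \<open>dir m (head j)\<close> has weight at least \<open>1 - \<eta> m\<close>.\<close>

lemma dir_step:
  assumes j: "j \<in> {1..n}" and r: "r \<in> {1..n}"
  shows "\<bar>dir (Suc m) j r - dir m (head j) r\<bar> \<le> \<eta> m"
proof -
  let ?h = "head j" and ?t = "\<Theta> (Suc m) (head j) j"
  have h: "?h \<in> {1..n}" by (rule head_index[OF j])
  define Y where "Y = (\<Sum>i\<in>{1..n} - {?h}. \<Theta> (Suc m) i j * C m i r)"
  define Z where "Z = (\<Sum>i\<in>{1..n} - {?h}. \<Theta> (Suc m) i j * N m i)"
  have C: "C (Suc m) j r = ?t * C m ?h r + Y" unfolding C_Suc[OF j r] Y_def
    using h by (simp add: sum.remove)
  have Z: "N (Suc m) j = ?t * N m ?h + Z" unfolding N_Suc[OF j] Z_def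
    using h by (simp add: sum.remove)
  have Y0: "0 \<le> Y" unfolding Y_def by (intro sum_nonneg mult_nonneg_nonneg Theta_nonneg C_nonneg) (use r in auto)
  have YZ: "Y \<le> Z" unfolding Y_def Z_def by (intro sum_mono mult_left_mono Theta_nonneg C_le_N) (use r in auto)
  have pos: "0 < N (Suc m) j" "0 < N m ?h" using N_pos[OF j, of "Suc m"] N_pos[OF h, of m] by linarith+
  have d: "0 \<le> dir m ?h r" "dir m ?h r \<le> 1" using dir_bounds[OF h r] by auto
  have "dir (Suc m) j r - dir m ?h r = (Y - dir m ?h r * Z) / N (Suc m) j"
  proof -
    have "C m ?h r = dir m ?h r * N m ?h" using pos by (simp add: dir_def)
    then have "C (Suc m) j r - dir m ?h r * N (Suc m) j = Y - dir m ?h r * Z"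
      unfolding C Z by (simp add: algebra_simps)
    then show ?thesis using pos unfolding dir_def[of "Suc m"] by (simp add: field_simps)
  qed
  moreover have "0 \<le> dir m ?h r * Z" "dir m ?h r * Z \<le> Z"
    using d Y0 YZ by (auto intro!: mult_nonneg_nonneg mult_left_le_one_le)
  then have "\<bar>Y - dir m ?h r * Z\<bar> \<le> Z" using Y0 YZ by linarith
  moreover have "Z \<le> \<eta> m * N (Suc m) j" using head_share[OF j, of m] Z by simp
  ultimately show ?thesis using pos by (simp add: divide_le_eq)
qed

definition L :: "nat \<Rightarrow> nat \<Rightarrow> real" where "L j r = lim (\<lambda>m. dir m j r)"

lemma dir_tendsto_head:
  assumes j: "j \<in> {1..n}" "head j = j" and r: "r \<in> {1..n}"
  shows "(\<lambda>m. dir m j r) \<longlonglongrightarrow> L j r"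
proof -
  have "summable (\<lambda>m. dir (Suc m) j r - dir m j r)"
    by (rule summable_comparison_test'[OF summable_\<eta>]) (use dir_step[OF j(1) r] j in auto)
  then have "convergent (\<lambda>m. \<Sum>k<m. dir (Suc k) j r - dir k j r)"
    by (simp add: summable_iff_convergent)
  then have "convergent (\<lambda>m. dir m j r - dir 0 j r)"
    by (simp add: sum_lessThan_telescope[of "\<lambda>m. dir m j r"])
  then have "convergent (\<lambda>m. dir m j r)"
    using convergent_add[OF _ convergent_const, of "\<lambda>m. dir m j r - dir 0 j r" "dir 0 j r"] by simp
  then show ?thesis by (simp add: L_def convergent_LIMSEQ_iff)
qed

text \<open>Column 1 and the even columns are not compared with themselves: they follow their head
  with a delay of one block, so all columns of a class share one limit.\<close>

lemma dir_tendsto: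
  assumes j: "j \<in> {1..n}" and r: "r \<in> {1..n}"
  shows "(\<lambda>m. dir m j r) \<longlonglongrightarrow> L (head j) r"
proof -
  have 1: "(\<lambda>m. dir m (head j) r) \<longlonglongrightarrow> L (head j) r"
    by (rule dir_tendsto_head[OF head_index[OF j] head_hd[OF j] r])
  have "(\<lambda>m. dir (Suc m) j r - dir m (head j) r) \<longlonglongrightarrow> 0"
    by (rule Lim_null_comparison[OF _ summable_LIMSEQ_zero[OF summable_\<eta>]])
      (use dir_step[OF j r] in auto)
  then have "(\<lambda>m. (dir (Suc m) j r - dir m (head j) r) + dir m (head j) r) \<longlonglongrightarrow> 0 + L (head j) r"
    by (intro tendsto_add 1)
  then show ?thesis by (simp add: filterlim_sequentially_Suc[of "\<lambda>m. dir m j r"])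
qed

lemma L_bounds: "j \<in> {1..n} \<Longrightarrow> head j = j \<Longrightarrow> r \<in> {1..n} \<Longrightarrow> 0 \<le> L j r \<and> L j r \<le> 1"
  using dir_tendsto_head[of j r] dir_bounds[of j r]
  by (auto intro: LIMSEQ_le_const LIMSEQ_le_const2)

lemma L_sum: "j \<in> {1..n} \<Longrightarrow> head j = j \<Longrightarrow> (\<Sum>r=1..n. L j r) = 1"
proof -
  assume j: "j \<in> {1..n}" "head j = j"
  have "(\<lambda>m. \<Sum>r=1..n. dir m j r) \<longlonglongrightarrow> (\<Sum>r=1..n. L j r)"
    by (intro tendsto_sum dir_tendsto_head j) auto
  then show ?thesis unfolding dir_sum[OF j(1)] by (simp add: LIMSEQ_const_iff)
qed

section \<open>Mass inside and outside a class\<close>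

definition mass :: "nat \<Rightarrow> (nat \<Rightarrow> real) \<Rightarrow> real" where
  "mass k x = (\<Sum>i=1..n. N k i * x i)"

definition off :: "nat \<Rightarrow> nat \<Rightarrow> (nat \<Rightarrow> real) \<Rightarrow> real" where
  "off j k x = (\<Sum>i\<in>{i\<in>{1..n}. head i \<noteq> j}. N k i * x i)"

text \<open>With \<open>N k i\<close> read as the number of floors of letter \<open>i\<close> after
  \<open>k\<close> blocks, \<open>mass\<close> is the total mass of a weight vector; a block only
  regroups it.\<close>

lemma mass_step:
  assumes y: "\<And>i. i \<in> {1..n} \<Longrightarrow> y i = mat_vec n (\<Theta> (Suc k)) x i"
  shows "mass k y = mass (Suc k) x"
proof -
  have "mass k y = (\<Sum>i=1..n. \<Sum>l=1..n. N k i * (\<Theta> (Suc k) i l * x l))"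
    unfolding mass_def by (intro sum.cong) (auto simp: y mat_vec_def sum_distrib_left)
  also have "\<dots> = (\<Sum>l=1..n. \<Sum>i=1..n. N k i * (\<Theta> (Suc k) i l * x l))" by (rule sum.swap)
  also have "\<dots> = mass (Suc k) x"
    unfolding mass_def by (intro sum.cong) (auto simp: N_Suc sum_distrib_right sum_distrib_left mult_ac)
  finally show ?thesis .
qed

text \<open>One block earlier, mass outside the class of \<open>j\<close> has two sources: the later
  columns outside the class, counted in full, and the columns of the class, whose part not inherited
  from the head is at most the share \<open>\<eta> k\<close>.\<close>

lemma off_step:
  assumes x: "\<And>i. i \<in> {1..n} \<Longrightarrow> 0 \<le> x i"
    and y: "\<And>i. i \<in> {1..n} \<Longrightarrow> y i = mat_vec n (\<Theta> (Suc k)) x i"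
  shows "off j k y \<le> off j (Suc k) x + \<eta> k * mass (Suc k) x"
proof -
  let ?B = "{i\<in>{1..n}. head i \<noteq> j}"
  have col: "(\<Sum>i\<in>?B. N k i * \<Theta> (Suc k) i l) \<le> (if head l \<noteq> j then N (Suc k) l else 0) + \<eta> k * N (Suc k) l"
    if l: "l \<in> {1..n}" for l
  proof -
    have nn: "0 \<le> N k i * \<Theta> (Suc k) i l" if "i \<in> {1..n}" for i
      using that by (intro mult_nonneg_nonneg N_nonneg Theta_nonneg)
    have e: "0 \<le> \<eta> k * N (Suc k) l" using \<eta>_ge(4) N_nonneg l by simp
    show ?thesis
    proof (cases "head l = j")
      case False
      have "(\<Sum>i\<in>?B. N k i * \<Theta> (Suc k) i l) \<le> (\<Sum>i=1..n. N k i * \<Theta> (Suc k) i l)"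
        using nn by (intro sum_mono2) auto
      then show ?thesis using False e by (simp add: N_Suc[OF l] mult.commute)
    next
      case True
      have h: "head l \<in> {1..n}" by (rule head_index[OF l])
      have "(\<Sum>i\<in>?B. N k i * \<Theta> (Suc k) i l) \<le> (\<Sum>i\<in>{1..n} - {head l}. N k i * \<Theta> (Suc k) i l)"
        using nn head_hd[OF l] True by (intro sum_mono2) auto
      also have "\<dots> = N (Suc k) l - \<Theta> (Suc k) (head l) l * N k (head l)"
        using h by (simp add: N_Suc[OF l] sum_diff1 mult.commute)
      also have "\<dots> \<le> \<eta> k * N (Suc k) l" by (rule head_share[OF l])
      finally show ?thesis using True by simp
    qed
  qed
  have "off j k y = (\<Sum>i\<in>?B. \<Sum>l=1..n. N k i * (\<Theta> (Suc k) i l * x l))"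
    unfolding off_def by (intro sum.cong) (auto simp: y mat_vec_def sum_distrib_left)
  also have "\<dots> = (\<Sum>l=1..n. \<Sum>i\<in>?B. N k i * (\<Theta> (Suc k) i l * x l))" by (rule sum.swap)
  also have "\<dots> = (\<Sum>l=1..n. (\<Sum>i\<in>?B. N k i * \<Theta> (Suc k) i l) * x l)"
    by (simp add: sum_distrib_right mult.assoc)
  also have "\<dots> \<le> (\<Sum>l=1..n. ((if head l \<noteq> j then N (Suc k) l else 0) + \<eta> k * N (Suc k) l) * x l)"
    using col x by (intro sum_mono mult_right_mono) auto
  also have "\<dots> = (\<Sum>l=1..n. if head l \<noteq> j then N (Suc k) l * x l else 0) + \<eta> k * mass (Suc k) x"
    unfolding mass_def sum_distrib_left sum.distrib[symmetric] by (intro sum.cong) (auto simp: algebra_simps)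
  also have "(\<Sum>l=1..n. if head l \<noteq> j then N (Suc k) l * x l else 0) = off j (Suc k) x"
    unfolding off_def by (subst sum.inter_filter) auto
  finally show ?thesis .
qed

lemma mass_const:
  assumes "\<And>k i. k < m \<Longrightarrow> i \<in> {1..n} \<Longrightarrow> x k i = mat_vec n (\<Theta> (Suc k)) (x (Suc k)) i"
    and "k \<le> m"
  shows "mass k (x k) = mass m (x m)"
  using \<open>k \<le> m\<close>
proof (induction rule: inc_induct)
  case (step k)
  then show ?case using mass_step[of "x k" k "x (Suc k)"] assms(1)[of k] by simp
qed simp

text \<open>Going back from level \<open>m\<close>, the losses of \<open>off_step\<close> add up to
  a partial sum of the summable \<open>\<eta>\<close>. This makes the estimate uniform in
  \<open>m\<close>, since for \<open>dir m j\<close> the value at level \<open>m\<close> is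
  0.\<close>

lemma off_bound:
  assumes x: "\<And>k i. k < m \<Longrightarrow> i \<in> {1..n} \<Longrightarrow> x k i = mat_vec n (\<Theta> (Suc k)) (x (Suc k)) i"
    and nn: "\<And>k i. k \<le> m \<Longrightarrow> i \<in> {1..n} \<Longrightarrow> 0 \<le> x k i"
    and "k \<le> m" and one: "mass m (x m) = 1"
  shows "off j k (x k) \<le> off j m (x m) + (\<Sum>l=k..<m. \<eta> l)"
  using \<open>k \<le> m\<close>
proof (induction rule: inc_induct)
  case (step k)
  have "off j k (x k) \<le> off j (Suc k) (x (Suc k)) + \<eta> k * mass (Suc k) (x (Suc k))"
    using step by (intro off_step x nn) auto
  also have "mass (Suc k) (x (Suc k)) = 1"
    using mass_const[of m x "Suc k"] x one step by simp
  finally show ?case using step by (simp add: sum.atLeast_Suc_lessThan)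
qed simp

lemma theta_prod_chain:
  assumes "\<And>k i. k < m \<Longrightarrow> i \<in> {1..n} \<Longrightarrow> x k i = mat_vec n (\<Theta> (Suc k)) (x (Suc k)) i"
    and i: "i \<in> {1..n}"
  shows "x 0 i = theta_prod n a c m (x m) i"
  using assms(1)
proof (induction m)
  case (Suc m)
  have "x 0 i = theta_prod n a c m (x m) i" using Suc by simp
  also have "\<dots> = theta_prod n a c m (mat_vec n (\<Theta> (Suc m)) (x (Suc m))) i"
    using Suc.prems i by (intro theta_prod_cong) auto
  finally show ?case by simp
qed simp

end

section \<open>The ergodic measures\<close>

lemma rv_step_type:
  assumes "rv_type (tp, bt, lam) = Some e"
  shows "rv_step (tp, bt, lam) = (fst (row_step e (tp, bt)), snd (row_step e (tp, bt)),
      lam(winner e (tp, bt) := lam (winner e (tp, bt)) - lam (loser e (tp, bt))))"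
    and "lam (loser e (tp, bt)) < lam (winner e (tp, bt))"
  using assms by (auto simp: rv_type_def rv_step_def Let_def split: if_splits)

lemma row_step_shape:
  assumes "distinct r1" "distinct r2" "set r1 = set r2" "last r1 \<noteq> last r2" "r1 \<noteq> []"
  shows "\<exists>A P Q. r1 = A @ [last r1] \<and> r2 = P @ last r1 # Q @ [last r2] \<and>
    ins_after (last r1) (last r2) (butlast r2) = P @ last r1 # last r2 # Q"
proof -
  have ne: "r2 \<noteq> []" using assms by auto
  have "last r1 \<in> set r2" using assms by (metis last_in_set)
  then have "last r1 \<in> set (butlast r2)"
    using assms(4) ne by (metis append_butlast_last_id in_set_conv_decomp_last rotate1.simps(2) set_ConsD set_rotate1)
  then obtain P Q where PQ: "butlast r2 = P @ last r1 # Q" "last r1 \<notin> set P"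
    by (meson split_list_first)
  have "r2 = P @ last r1 # Q @ [last r2]"
    using append_butlast_last_id[OF ne] PQ by simp
  moreover have "r1 = butlast r1 @ [last r1]" using assms(5) by simp
  ultimately show ?thesis using PQ ins_after_append[OF PQ(2)] by metis
qed

section \<open>Rauzy induction of an interval exchange as a tower\<close>

locale rauzy_iet =
  fixes tp0 bt0 :: "nat list" and lam0 :: "nat \<Rightarrow> real"
  assumes dist0: "distinct tp0" "distinct bt0" and set0: "set bt0 = set tp0" and ne0: "tp0 \<noteq> []"
    and pos0: "\<And>i. i \<in> set tp0 \<Longrightarrow> 0 < lam0 i" and sum0: "sum_list (map lam0 tp0) = 1"
    and path_defined: "\<And>k. rauzy_path tp0 bt0 lam0 k \<noteq> None"
begin

definition "row_pair k = (let s = (rv_step ^^ k) (tp0, bt0, lam0) in (fst s, fst (snd s)))"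
definition "tp k = fst (row_pair k)"
definition "bt k = snd (row_pair k)"
definition "lam k = snd (snd ((rv_step ^^ k) (tp0, bt0, lam0)))"
definition "letter k = the (rauzy_path tp0 bt0 lam0 k)"
definition "w k = winner (letter k) (row_pair k)"
definition "l k = loser (letter k) (row_pair k)"
definition "b k i = ts (tp k) (lam k) i"
definition "d k i = ts (bt k) (lam k) i"

lemma state: "(rv_step ^^ k) (tp0, bt0, lam0) = (tp k, bt k, lam k)"
  by (simp add: tp_def bt_def lam_def row_pair_def Let_def)

lemma row_pair: "row_pair k = (tp k, bt k)"
  by (simp add: tp_def bt_def)

lemma init: "tp 0 = tp0" "bt 0 = bt0" "lam 0 = lam0"
  using state[of 0] by simp_all

lemma type: "rv_type (tp k, bt k, lam k) = Some (letter k)"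
  using path_defined[of k] by (auto simp: letter_def rauzy_path_def state)

lemma rows_Suc: "row_pair (Suc k) = row_step (letter k) (row_pair k)"
  and lam_Suc: "lam (Suc k) = (lam k)(w k := lam k (w k) - lam k (l k))"
  and lam_less: "lam k (l k) < lam k (w k)"
proof -
  have "(tp (Suc k), bt (Suc k), lam (Suc k)) = rv_step (tp k, bt k, lam k)"
    using state[of "Suc k"] state[of k] by simp
  then show "row_pair (Suc k) = row_step (letter k) (row_pair k)"
    "lam (Suc k) = (lam k)(w k := lam k (w k) - lam k (l k))"
    using rv_step_type(1)[OF type[of k]] by (auto simp: row_pair w_def l_def)
  show "lam k (l k) < lam k (w k)"
    using rv_step_type(2)[OF type[of k]] by (simp add: w_def l_def row_pair)
qed

lemma wl: "w k \<noteq> l k"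
  using lam_less[of k] by auto

lemma last_neq: "last (tp k) \<noteq> last (bt k)"
  using wl[of k] by (auto simp: w_def l_def row_pair split: if_splits)

lemma valid: "distinct (tp k) \<and> distinct (bt k) \<and> set (tp k) = set tp0 \<and> set (bt k) = set tp0 \<and>
  (\<forall>i\<in>set tp0. 0 < lam k i)"
proof (induction k)
  case 0 then show ?case using dist0 set0 pos0 by (simp add: init)
next
  case (Suc k)
  then have ne: "tp k \<noteq> []" "bt k \<noteq> []" using ne0 by auto
  then have "l k \<in> set tp0" "w k \<in> set tp0" using Suc by (auto simp: l_def w_def row_pair)
  then have "\<forall>i\<in>set tp0. 0 < lam (Suc k) i" using Suc lam_less[of k] by (auto simp: lam_Suc)
  moreover have "distinct (tp (Suc k)) \<and> distinct (bt (Suc k)) \<and> set (tp (Suc k)) = set tp0 \<and> set (bt (Suc k)) = set tp0"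
  proof (cases "letter k = 0")
    case True
    obtain A P Q where s: "bt k = P @ last (tp k) # Q @ [last (bt k)]"
      "ins_after (last (tp k)) (last (bt k)) (butlast (bt k)) = P @ last (tp k) # last (bt k) # Q"
      using row_step_shape[of "tp k" "bt k"] Suc ne last_neq[of k] by blast
    have "tp (Suc k) = tp k" "bt (Suc k) = P @ last (tp k) # last (bt k) # Q"
      using True rows_Suc[of k] s(2) by (auto simp: row_pair)
    moreover have "distinct (P @ last (tp k) # Q @ [last (bt k)])" "set (P @ last (tp k) # Q @ [last (bt k)]) = set tp0"
      using Suc s(1) by metis+
    ultimately show ?thesis using Suc by auto
  next
    case False
    obtain A P Q where s: "tp k = P @ last (bt k) # Q @ [last (tp k)]"
      "ins_after (last (bt k)) (last (tp k)) (butlast (tp k)) = P @ last (bt k) # last (tp k) # Q"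
      using row_step_shape[of "bt k" "tp k"] Suc ne last_neq[of k] by metis
    have "bt (Suc k) = bt k" "tp (Suc k) = P @ last (bt k) # last (tp k) # Q"
      using False rows_Suc[of k] s(2) by (auto simp: row_pair)
    moreover have "distinct (P @ last (bt k) # Q @ [last (tp k)])" "set (P @ last (bt k) # Q @ [last (tp k)]) = set tp0"
      using Suc s(1) by metis+
    ultimately show ?thesis using Suc by auto
  qed
  ultimately show ?case by blast
qed

lemma rows_ne: "tp k \<noteq> []" "bt k \<noteq> []"
  using valid[of k] ne0 by auto

lemma wI: "w k \<in> set tp0" and lI: "l k \<in> set tp0"
  using rows_ne[of k] valid[of k] by (auto simp: l_def w_def row_pair)

lemma tower_step:
  "((\<forall>i\<in>set tp0. b (Suc k) i = b k i) \<and> (\<forall>i\<in>set tp0 - {l k}. d (Suc k) i = d k i) \<and>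
     d (Suc k) (l k) = d k (w k) + lam (Suc k) (w k) \<and>
     d k (l k) = b k (w k) + lam (Suc k) (w k)) \<or>
   ((\<forall>i\<in>set tp0. d (Suc k) i = d k i) \<and> (\<forall>i\<in>set tp0 - {l k}. b (Suc k) i = b k i) \<and>
     b (Suc k) (l k) = b k (w k) + lam (Suc k) (w k) \<and>
     b k (l k) = d k (w k) + lam (Suc k) (w k))"
proof (cases "letter k = 0")
  case True
  then have wl': "w k = last (tp k)" "l k = last (bt k)" by (simp_all add: w_def l_def row_pair)
  obtain A P Q where s: "tp k = A @ [w k]" "bt k = P @ w k # Q @ [l k]"
      "ins_after (w k) (l k) (butlast (bt k)) = P @ w k # l k # Q"
    using row_step_shape[of "tp k" "bt k"] valid[of k] rows_ne[of k] last_neq[of k] unfolding wl' by blast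
  have rs: "tp (Suc k) = tp k" "bt (Suc k) = P @ w k # l k # Q"
    using True rows_Suc[of k] s(3) wl' by (auto simp: row_pair)
  note st = ts_rauzy_step[OF s(1,2) rs(2) _ _ _ lam_Suc[of k]]
  show ?thesis using st valid[of k] unfolding b_def d_def rs(1) by simp
next
  case False
  then have wl': "w k = last (bt k)" "l k = last (tp k)" by (simp_all add: w_def l_def row_pair)
  obtain A P Q where s: "bt k = A @ [w k]" "tp k = P @ w k # Q @ [l k]"
      "ins_after (w k) (l k) (butlast (tp k)) = P @ w k # l k # Q"
    using row_step_shape[of "bt k" "tp k"] valid[of k] rows_ne[of k] last_neq[of k] unfolding wl' by metis
  have rs: "bt (Suc k) = bt k" "tp (Suc k) = P @ w k # l k # Q"
    using False rows_Suc[of k] s(3) wl' by (auto simp: row_pair)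
  note st = ts_rauzy_step[OF s(1,2) rs(2) _ _ _ lam_Suc[of k]]
  show ?thesis using st valid[of k] unfolding b_def d_def rs(1) by simp
qed

lemma domain_partition:
  "(\<Union>i\<in>set tp0. {b 0 i..<b 0 i + lam 0 i}) = {0..<1}"
  "disjoint_family_on (\<lambda>i. {b 0 i..<b 0 i + lam 0 i}) (set tp0)"
  using Xint_partition[of tp0 lam0] dist0 pos0 sum0
  by (simp_all add: b_def init Xint_def[abs_def])

lemma image_partition:
  "(\<Union>i\<in>set tp0. {d 0 i..<d 0 i + lam 0 i}) = {0..<1}"
  "disjoint_family_on (\<lambda>i. {d 0 i..<d 0 i + lam 0 i}) (set tp0)"
proof -
  have "sum_list (map lam0 bt0) = sum_list (map lam0 tp0)"
    using dist0 set0 by (simp add: sum_list_distinct_conv_sum_set)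
  then show "(\<Union>i\<in>set tp0. {d 0 i..<d 0 i + lam 0 i}) = {0..<1}"
    "disjoint_family_on (\<lambda>i. {d 0 i..<d 0 i + lam 0 i}) (set tp0)"
    using Xint_partition[of bt0 lam0] dist0 pos0 sum0 set0
    by (simp_all add: d_def init Xint_def[abs_def])
qed

lemma iet_map_eq:
  assumes "i \<in> set tp0" "x \<in> {b 0 i..<b 0 i + lam 0 i}"
  shows "iet_map tp0 bt0 lam0 x = x + (d 0 i - b 0 i)"
proof -
  have "(\<Sum>j\<in>set tp0. indicator (Xint tp0 lam0 j) x * (ts bt0 lam0 j - ts tp0 lam0 j)) =
      (\<Sum>j\<in>set tp0. if j = i then d 0 j - b 0 j else 0)"
  proof (rule sum.cong)
    fix j assume j: "j \<in> set tp0"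
    have "x \<notin> {b 0 j..<b 0 j + lam 0 j}" if "j \<noteq> i"
      using domain_partition(2) assms j that unfolding disjoint_family_on_def by blast
    then show "indicator (Xint tp0 lam0 j) x * (ts bt0 lam0 j - ts tp0 lam0 j) =
        (if j = i then d 0 j - b 0 j else 0)"
      using assms by (auto simp: Xint_def b_def d_def init)
  qed simp
  then show ?thesis using assms(1) by (simp add: iet_map_def)
qed

text \<open>The recursion in the direction from new to old, as in \<open>pull_back\<close>; it
  covers the lengths as well as the weights \<open>sub k y\<close>.\<close>

definition chain :: "(nat \<Rightarrow> nat \<Rightarrow> real) \<Rightarrow> bool" where
  "chain y \<longleftrightarrow> (\<forall>k. y k = (y (Suc k))(w k := y (Suc k) (w k) + y (Suc k) (l k)))"

lemma chain_lam: "chain lam"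
  unfolding chain_def
proof
  fix k show "lam k = (lam (Suc k))(w k := lam (Suc k) (w k) + lam (Suc k) (l k))"
    using wl[of k] by (auto simp: lam_Suc fun_eq_iff)
qed

lemma chain_pull_back:
  assumes "chain y" "\<And>k. k < length es \<Longrightarrow> letter (K + k) = es ! k"
  shows "y K = pull_back es (row_pair K) (y (K + length es)) \<and> row_pair (K + length es) = row_steps es (row_pair K)"
  using assms(2)
proof (induction es arbitrary: K)
  case (Cons e es)
  have e: "letter K = e" using Cons.prems[of 0] by simp
  have IH: "y (Suc K) = pull_back es (row_pair (Suc K)) (y (Suc K + length es)) \<and>
      row_pair (Suc K + length es) = row_steps es (row_pair (Suc K))"
  proof (rule Cons.IH)
    show "letter (Suc K + k) = es ! k" if "k < length es" for k using Cons.prems[of "Suc k"] that by simp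
  qed
  have "y K = (y (Suc K))(w K := y (Suc K) (w K) + y (Suc K) (l K))"
    using assms(1) unfolding chain_def by blast
  then show ?case using IH e by (simp add: rows_Suc Let_def w_def l_def)
qed simp

lemma chain_decreasing:
  assumes "chain y" "\<And>k i. i \<in> set tp0 \<Longrightarrow> 0 \<le> y k i" "i \<in> set tp0"
  shows "decseq (\<lambda>k. y k i)"
proof (rule decseq_SucI)
  fix k
  have "y k i = ((y (Suc k))(w k := y (Suc k) (w k) + y (Suc k) (l k))) i"
    using assms(1) unfolding chain_def by metis
  then show "y (Suc k) i \<le> y k i" using assms(2)[OF lI, of "Suc k" k] by simp
qed

end

section \<open>The blocks of the path\<close>

locale gamma_iet = theta_seq n p a c + rauzy_iet "top_row n" "bot_row n" lam0
  for n p :: nat and a c :: "nat \<Rightarrow> nat" and lam0 :: "nat \<Rightarrow> real" +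
  assumes path: "k < length (concat (map (\<lambda>k. gamma n (a k) (c k)) [1..<m + 1])) \<Longrightarrow>
    rauzy_path (top_row n) (bot_row n) lam0 k = Some (concat (map (\<lambda>k. gamma n (a k) (c k)) [1..<m + 1]) ! k)"
begin

definition "word m = concat (map (\<lambda>k. gamma n (a k) (c k)) [1..<m + 1])"

abbreviation "I \<equiv> {1..n}"

lemma set_top: "set (top_row n) = I"
  by (auto simp: top_row_def)

definition "B m = length (word m)"

lemma word_Suc: "word (Suc m) = word m @ gamma n (a (Suc m)) (c (Suc m))"
  by (simp add: word_def flip: Suc_eq_plus1)

lemma letter_block:
  "k < length (gamma n (a (Suc m)) (c (Suc m))) \<Longrightarrow> letter (B m + k) = gamma n (a (Suc m)) (c (Suc m)) ! k"
  using path[of "B m + k" "Suc m", folded word_def] by (simp add: letter_def B_def word_Suc nth_append)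

lemma B_Suc: "B (Suc m) = B m + length (gamma n (a (Suc m)) (c (Suc m)))"
  by (simp add: B_def word_Suc)

lemma B_ge: "m \<le> B m"
proof (induction m)
  case (Suc m)
  have "1 \<le> length (gamma n (a (Suc m)) (c (Suc m)))" by (simp add: gamma_def)
  then show ?case using Suc by (simp add: B_Suc)
qed simp

lemma rows_B: "row_pair (B m) = (top_row n, bot_row n)"
proof (induction m)
  case 0 then show ?case by (simp add: row_pair init B_def word_def)
next
  case (Suc m)
  then show ?case
    using chain_pull_back[OF chain_lam letter_block] gamma_loop(1)[OF n] by (simp add: B_Suc)
qed

lemma chain_block:
  assumes "chain y" "i \<in> I"
  shows "y (B m) i = mat_vec n (\<Theta> (Suc m)) (y (B (Suc m))) i"
  using chain_pull_back[OF assms(1) letter_block] gamma_loop(2)[OF n assms(2)]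
  by (simp add: B_Suc rows_B)

lemma B_0: "B 0 = 0" by (simp add: B_def word_def)

lemma chain_mass:
  assumes "chain y" shows "mass m (y (B m)) = sum (y 0) I"
proof -
  have "mass 0 (y (B 0)) = mass m (y (B m))"
    by (rule mass_const) (auto intro: chain_block[OF assms])
  then show ?thesis by (simp add: mass_def N_0 B_0)
qed

text \<open>At the end of a block, conservation of mass gives \<open>N m i * y (B m) i <= 1\<close>,
  and the column sums are unbounded; between block ends the entries cannot increase.\<close>

lemma chain_small:
  assumes y: "chain y" and nn: "\<And>k i. i \<in> I \<Longrightarrow> 0 \<le> y k i" and s: "sum (y 0) I = 1" and i: "i \<in> I"
  shows "(\<lambda>k. y k i) \<longlonglongrightarrow> 0"
proof -
  have dec: "decseq (\<lambda>k. y k i)"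
    using chain_decreasing[OF y] nn i by (simp add: set_top)
  have le: "y (B m) i \<le> inverse (N m i)" for m
  proof -
    have "N m i * y (B m) i \<le> mass m (y (B m))"
      unfolding mass_def using i nn N_nonneg by (intro member_le_sum) auto
    then show ?thesis using N_pos[OF i, of m] by (simp add: chain_mass[OF y] s field_simps)
  qed
  show ?thesis
  proof (rule order_tendstoI)
    fix e :: real assume "e < 0"
    then show "\<forall>\<^sub>F k in sequentially. e < y k i"
      using nn[OF i] by (intro always_eventually allI) (rule less_le_trans)
  next
    fix e :: real assume "0 < e"
    then have "\<forall>\<^sub>F m in sequentially. inverse (N m i) < e"
      using N_inverse_tendsto[OF i] by (rule order_tendstoD(2)[rotated])
    then obtain m where "inverse (N m i) < e" by (auto simp: eventually_sequentially)
    then have "y (B m) i < e" using le[of m] by linarith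
    then have "y k i < e" if "B m \<le> k" for k
      using decseqD[OF dec that] by linarith
    then show "\<forall>\<^sub>F k in sequentially. y k i < e" by (auto simp: eventually_sequentially)
  qed
qed

abbreviation "T \<equiv> iet_map (top_row n) (bot_row n) lam0"

lemma lam_pos: "i \<in> I \<Longrightarrow> 0 < lam k i"
  using valid[of k] by (simp add: set_top)

lemma sum_lam: "sum (lam 0) I = 1"
  using sum0 dist0(1) by (simp add: init set_top sum_list_distinct_conv_sum_set)

text \<open>The assumption \<open>small\<close> is \<open>chain_small\<close> for the lengths
  themselves, which form a chain of total mass 1.\<close>

sublocale tower I lam b d w l T
proof
  show "finite I" by simp
  show "0 < lam k i" if "i \<in> I" for i k using lam_pos[OF that] .
  show "w k \<in> I" "l k \<in> I" "w k \<noteq> l k" for k using wI lI wl by (auto simp: set_top)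
  show "lam (Suc k) = (lam k)(w k := lam k (w k) - lam k (l k))" for k by (rule lam_Suc)
  show "T x = x + (d 0 i - b 0 i)" if "i \<in> I" "x \<in> {b 0 i..<b 0 i + lam 0 i}" for i x
    using iet_map_eq[of i x] that by (simp add: set_top)
  show "(\<lambda>k. lam k i) \<longlonglongrightarrow> 0" if "i \<in> I" for i
  proof (rule chain_small[OF chain_lam _ sum_lam that])
    show "0 \<le> lam k i" if "i \<in> I" for k i using lam_pos[OF that, of k] by simp
  qed
qed (use tower_step domain_partition image_partition in \<open>simp_all add: set_top\<close>)

lemma chain_sub: "chain (\<lambda>k. sub k y)"
  unfolding chain_def
proof
  fix k show "sub k y = (sub (Suc k) y)(w k := sub (Suc k) y (w k) + sub (Suc k) y (l k))"
    using wl[of k] by (auto simp: fun_eq_iff)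
qed

lemma start_from_sub:
  assumes "r \<in> I" shows "y r = (\<Sum>i\<in>I. sub (B m) y i * C m i r)"
proof -
  have "sub (B 0) y r = theta_prod n a c m (sub (B m) y) r"
    by (rule theta_prod_chain[of m "\<lambda>k. sub (B k) y"]) (use chain_block[OF chain_sub] assms in auto)
  then show ?thesis using assms by (simp add: B_0 theta_prod_expand)
qed

definition tail :: "nat \<Rightarrow> real" where "tail k = (\<Sum>l. \<eta> (l + k))"

lemma tail_tendsto: "tail \<longlonglongrightarrow> 0"
  unfolding tail_def using suminf_exist_split2[OF summable_\<eta>] by simp

lemma sum_\<eta>_le_tail: "k \<le> m \<Longrightarrow> (\<Sum>l=k..<m. \<eta> l) \<le> tail k"
proof -
  assume "k \<le> m"
  then have "(\<Sum>l=k..<m. \<eta> l) = (\<Sum>l<m - k. \<eta> (l + k))"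
    using sum.shift_bounds_nat_ivl[of \<eta> 0 k "m - k"] by (simp add: atLeast0LessThan)
  also have "\<dots> \<le> tail k" unfolding tail_def
    using summable_ignore_initial_segment[OF summable_\<eta>, of k] \<eta>_ge(4) by (intro sum_le_suminf) auto
  finally show ?thesis .
qed

section \<open>The limit measures, their ergodicity and distinctness\<close>

context
  fixes j assumes j: "j \<in> I" "head j = j"
begin

text \<open>\<open>dir m j\<close> is the start vector whose weights at the end of block
  \<open>m\<close> sit on the letter \<open>j\<close> alone. Up to that level the weights are
  nonnegative, and going back to block \<open>k\<close> moves at most \<open>tail k\<close> of the
  mass out of the class, whatever \<open>m\<close> is.\<close>

lemma sub_dir:
  assumes "k \<le> m"
  shows "i \<in> I \<Longrightarrow> 0 \<le> sub (B k) (dir m j) i"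
    and "k' \<le> B m \<Longrightarrow> i \<in> I \<Longrightarrow> 0 \<le> sub k' (dir m j) i"
    and "off j k (sub (B k) (dir m j)) \<le> tail k"
proof -
  \<comment> \<open>The letter \<open>j\<close> counts \<open>N m j\<close> times in the mass at
    level \<open>m\<close>, so this scaling gives total mass 1.\<close>
  define x where "x = (\<lambda>i. std_basis j i / N m j)"
  have Np: "0 < N m j" using N_pos[OF j(1), of m] by simp
  have x0: "\<forall>i\<in>I. 0 \<le> x i" using Np by (simp add: x_def std_basis_def)
  obtain y where y: "sub (B m) y = x" "\<And>k i. k \<le> B m \<Longrightarrow> i \<in> I \<Longrightarrow> 0 \<le> sub k y i"
    using sub_surj[of "B m" x] x0 by blast
  have y_dir: "dir m j r = y r" if "r \<in> I" for r
  proof -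
    have "y r = (\<Sum>i\<in>I. x i * C m i r)" using start_from_sub[OF that, of y m] y(1) by simp
    also have "\<dots> = (\<Sum>i\<in>I. if i = j then C m i r / N m i else 0)"
      by (intro sum.cong) (auto simp: x_def std_basis_def)
    finally show ?thesis using j(1) by (simp add: dir_def)
  qed
  have sub_eq: "sub k (dir m j) i = sub k y i" if "i \<in> I" for k i
    using y_dir that by (rule sub_cong)
  show nn: "0 \<le> sub k' (dir m j) i" if "k' \<le> B m" "i \<in> I" for k' i
    using y(2)[OF that] sub_eq[OF that(2)] by simp
  have Bmono: "B k \<le> B m" if "k \<le> m" for k m
    using that by (induction rule: dec_induct) (auto simp: B_Suc)
  show "0 \<le> sub (B k) (dir m j) i" if "i \<in> I"
    using nn Bmono[OF assms] that by blast
  have x_eq: "sub (B m) (dir m j) i = x i" if "i \<in> I" for i using sub_eq[OF that] y(1) by simp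
  have "mass m (sub (B m) (dir m j)) = sum (dir m j) I"
    using chain_mass[OF chain_sub] by simp
  also have "\<dots> = 1" by (rule dir_sum[OF j(1)])
  finally have one: "mass m (sub (B m) (dir m j)) = 1" .
  have "off j m (sub (B m) (dir m j)) = 0"
    unfolding off_def
  proof (intro sum.neutral ballI)
    fix i assume i: "i \<in> {i \<in> I. head i \<noteq> j}"
    then have "i \<noteq> j" "i \<in> I" using j by auto
    then show "N m i * sub (B m) (dir m j) i = 0" by (simp add: x_eq x_def std_basis_def)
  qed
  moreover have "off j k (sub (B k) (dir m j)) \<le> off j m (sub (B m) (dir m j)) + (\<Sum>l=k..<m. \<eta> l)"
  proof (rule off_bound[where x = "\<lambda>k. sub (B k) (dir m j)"])
    show "sub (B k) (dir m j) i = mat_vec n (\<Theta> (Suc k)) (sub (B (Suc k)) (dir m j)) i" if "i \<in> I" for k i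
      using chain_block[OF chain_sub that] .
    show "mass m (sub (B m) (dir m j)) = 1" "k \<le> m" by fact+
    show "0 \<le> sub (B k) (dir m j) i" if "k \<le> m" "i \<in> I" for k i
      using nn[OF Bmono] that by blast
  qed
  ultimately show "off j k (sub (B k) (dir m j)) \<le> tail k" using sum_\<eta>_le_tail[OF assms] by linarith
qed

lemma sub_dir_tendsto: "i \<in> I \<Longrightarrow> (\<lambda>m. sub k (dir m j) i) \<longlonglongrightarrow> sub k (L j) i"
  by (rule sub_tendsto) (auto intro: dir_tendsto_head j)

text \<open>Every fixed level \<open>k\<close> is at most \<open>B m\<close> for large
  \<open>m\<close>, so the weights of \<open>dir m j\<close> at level \<open>k\<close> are
  eventually nonnegative.\<close>

lemma sub_L_nonneg: "i \<in> I \<Longrightarrow> 0 \<le> sub k (L j) i"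
proof (rule LIMSEQ_le_const[OF sub_dir_tendsto])
  assume i: "i \<in> I"
  show "\<exists>M. \<forall>m\<ge>M. 0 \<le> sub k (dir m j) i"
    using sub_dir(2)[OF order_refl _ i] B_ge by (meson order_trans)
qed

lemma off_L: "off j k (sub (B k) (L j)) \<le> tail k"
proof (rule LIMSEQ_le_const2)
  show "(\<lambda>m. off j k (sub (B k) (dir m j))) \<longlonglongrightarrow> off j k (sub (B k) (L j))"
    unfolding off_def by (intro tendsto_sum tendsto_mult tendsto_const sub_dir_tendsto) auto
  show "\<exists>M. \<forall>m\<ge>M. off j k (sub (B k) (dir m j)) \<le> tail k" using sub_dir(3) by blast
qed

lemma off_L_nonneg: "0 \<le> off j k (sub (B k) (L j))"
  unfolding off_def by (intro sum_nonneg mult_nonneg_nonneg N_nonneg sub_L_nonneg) auto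

lemma off_L_tendsto: "(\<lambda>k. off j k (sub (B k) (L j))) \<longlonglongrightarrow> 0"
  by (rule tendsto_sandwich[OF _ _ tendsto_const tail_tendsto]) (use off_L off_L_nonneg in auto)

lemma measure_L: "\<exists>M. inv_prob T M \<and> (\<forall>i\<in>I. measure M {b 0 i..<b 0 i + lam 0 i} = L j i)"
proof (rule exists_inv_prob)
  show "(\<Sum>i\<in>I. L j i) = 1" by (rule L_sum[OF j])
  show "(\<lambda>k. sub k (L j) i) \<longlonglongrightarrow> 0" if "i \<in> I" for i
    by (rule chain_small[OF chain_sub _ _ that]) (use L_sum[OF j] sub_L_nonneg in auto)
qed (rule sub_L_nonneg)

text \<open>At each block end \<open>y\<close> is a convex combination of the directions
  \<open>dir m i\<close> with coefficients \<open>v i\<close>. Domination bounds the coefficients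
  outside the class of \<open>j\<close> by \<open>K\<close> times a quantity tending to 0, and the
  directions inside the class all tend to \<open>L j\<close>.\<close>

lemma dominated_eq_L:
  assumes nn: "\<And>k i. i \<in> I \<Longrightarrow> 0 \<le> sub k y i" and s: "sum y I = 1"
    and dominated: "\<And>k i. i \<in> I \<Longrightarrow> sub k y i \<le> K * sub k (L j) i" and r: "r \<in> I"
  shows "y r = L j r"
proof -
  let ?D = "\<lambda>m. (\<Sum>i\<in>{i\<in>I. head i = j}. \<bar>dir m i r - L j r\<bar>)"
  have bound: "\<bar>y r - L j r\<bar> \<le> ?D m + K * off j m (sub (B m) (L j))" for m
  proof -
    define v where "v i = N m i * sub (B m) y i" for i
    have v0: "0 \<le> v i" if "i \<in> I" for i unfolding v_def using that nn N_nonneg by (intro mult_nonneg_nonneg)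
    have v1: "sum v I = 1" using chain_mass[OF chain_sub, of m y] s by (simp add: mass_def v_def)
    have vle: "v i \<le> 1" if "i \<in> I" for i
      unfolding v1[symmetric] using that v0 by (intro member_le_sum) auto
    have "y r = (\<Sum>i\<in>I. v i * dir m i r)"
    proof -
      have "y r = (\<Sum>i\<in>I. sub (B m) y i * C m i r)" by (rule start_from_sub[OF r])
      also have "\<dots> = (\<Sum>i\<in>I. v i * dir m i r)"
      proof (intro sum.cong refl)
        fix i assume "i \<in> I"
        then have "N m i \<noteq> 0" using N_pos[of i m] by auto
        then show "sub (B m) y i * C m i r = v i * dir m i r" by (simp add: v_def dir_def)
      qed
      finally show ?thesis .
    qed
    moreover have "L j r = (\<Sum>i\<in>I. v i * L j r)" using v1 by (simp add: sum_distrib_right[symmetric])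
    ultimately have "y r - L j r = (\<Sum>i\<in>I. v i * (dir m i r - L j r))"
      by (simp add: sum_subtractf algebra_simps)
    then have "\<bar>y r - L j r\<bar> \<le> (\<Sum>i\<in>I. v i * \<bar>dir m i r - L j r\<bar>)"
      using sum_abs[of "\<lambda>i. v i * (dir m i r - L j r)" I] v0 by (simp add: abs_mult)
    also have "\<dots> \<le> (\<Sum>i\<in>I. (if head i = j then \<bar>dir m i r - L j r\<bar> else 0) +
        K * (if head i \<noteq> j then N m i * sub (B m) (L j) i else 0))"
    proof (intro sum_mono)
      fix i assume i: "i \<in> I"
      have "\<bar>dir m i r - L j r\<bar> \<le> 1" using dir_bounds[OF i r, of m] L_bounds[OF j r] by auto
      then have "v i * \<bar>dir m i r - L j r\<bar> \<le> v i" using v0[OF i] by (simp add: mult_left_le)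
      moreover have "v i \<le> N m i * (K * sub (B m) (L j) i)"
        unfolding v_def using dominated[OF i] N_nonneg[OF i] by (intro mult_left_mono) auto
      moreover have "v i * \<bar>dir m i r - L j r\<bar> \<le> \<bar>dir m i r - L j r\<bar>"
        using vle[OF i] v0[OF i] by (simp add: mult_left_le_one_le)
      ultimately show "v i * \<bar>dir m i r - L j r\<bar> \<le> (if head i = j then \<bar>dir m i r - L j r\<bar> else 0) +
        K * (if head i \<noteq> j then N m i * sub (B m) (L j) i else 0)" by (auto simp: algebra_simps)
    qed
    also have "\<dots> = ?D m + K * off j m (sub (B m) (L j))"
      unfolding off_def sum.distrib sum_distrib_left[symmetric]
      by (simp only: sum.inter_filter finite_atLeastAtMost)
    finally show ?thesis .
  qed
  have "(\<lambda>m. ?D m + K * off j m (sub (B m) (L j))) \<longlonglongrightarrow> 0 + K * 0"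
  proof (intro tendsto_add tendsto_mult tendsto_const off_L_tendsto tendsto_null_sum)
    fix i assume "i \<in> {i \<in> I. head i = j}"
    then have "(\<lambda>m. dir m i r) \<longlonglongrightarrow> L j r" using dir_tendsto[of i r] r by auto
    then show "(\<lambda>m. \<bar>dir m i r - L j r\<bar>) \<longlonglongrightarrow> 0" by (simp add: LIM_zero tendsto_rabs_zero)
  qed
  then have "\<bar>y r - L j r\<bar> \<le> 0 + K * 0" using bound by (intro LIMSEQ_le_const) auto
  then show ?thesis by simp
qed

text \<open>The conditional measure on an invariant set \<open>A\<close> of positive mass is
  invariant and at most \<open>1 / measure M A\<close> times \<open>M\<close>, so it has the vector
  \<open>L j\<close> and equals \<open>M\<close>; evaluated on \<open>A\<close> this gives mass
  1.\<close>

lemma ergodic_L: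
  assumes M: "inv_prob T M" and M_vec: "\<And>i. i \<in> I \<Longrightarrow> measure M {b 0 i..<b 0 i + lam 0 i} = L j i"
  shows "ergodic_inv_prob T M"
  unfolding ergodic_inv_prob_def
proof (intro conjI M ballI impI)
  fix A assume A: "A \<in> sets M" "T -` A \<inter> space M = A"
  interpret prob_space M using M by (simp add: inv_prob_def)
  have TM: "T \<in> measurable M M" using M by (simp add: inv_prob_def)
  show "emeasure M A = 0 \<or> emeasure M A = 1"
  proof (rule disjCI)
    assume "emeasure M A \<noteq> 1"
    show "emeasure M A = 0"
    proof (rule ccontr)
      assume nz: "emeasure M A \<noteq> 0"
      define P where "P = uniform_measure M A"
      have PA: "emeasure P X = emeasure M (A \<inter> X) / emeasure M A" if "X \<in> sets M" for X
        unfolding P_def using A(1) that by (rule emeasure_uniform_measure)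
      have sP: "sets P = sets M" "space P = space M" by (simp_all add: P_def)
      have mA: "0 < measure M A" using nz by (simp add: emeasure_eq_measure zero_less_measure_iff)
      have prP: "prob_space P" unfolding P_def using nz by (rule prob_space_uniform_measure) simp
      have "inv_prob T P"
        unfolding inv_prob_def
      proof (intro conjI prP ballI)
        show "sets P = sets (restrict_space borel {0..<1})" using M sP by (simp add: inv_prob_def)
        show "T \<in> measurable P P" using TM measurable_cong_sets[OF sP(1) sP(1)] by blast
        fix X assume "X \<in> sets P"
        then have X: "X \<in> sets M" by (simp add: sP)
        have "A \<inter> (T -` X \<inter> space M) = T -` (A \<inter> X) \<inter> space M" using A(2) by auto
        moreover have "emeasure M (T -` (A \<inter> X) \<inter> space M) = emeasure M (A \<inter> X)"
          using M sets.Int[OF A(1) X] unfolding inv_prob_def by blast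
        ultimately show "emeasure P (T -` X \<inter> space P) = emeasure P X"
          using PA[OF X] PA[OF measurable_sets[OF TM X]] by (simp only: sP)
      qed
      have le: "measure P X \<le> 1 / measure M A * measure M X" if X: "X \<in> sets M" for X
      proof -
        interpret P: prob_space P by (rule prP)
        have "measure P X = measure M (A \<inter> X) / measure M A"
          using PA[OF X] mA by (simp add: P.emeasure_eq_measure emeasure_eq_measure divide_ennreal)
        moreover have "measure M (A \<inter> X) \<le> measure M X" using X by (intro finite_measure_mono) auto
        ultimately show ?thesis using mA by (simp add: divide_right_mono)
      qed
      define y where "y i = measure P {b 0 i..<b 0 i + lam 0 i}" for i
      have sub_y: "sub k y i = measure P {b k i..<b k i + lam k i}" if "i \<in> I" for k i
        using measure_base[OF \<open>inv_prob T P\<close> that] unfolding y_def by simp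
      have sub_LM: "sub k (L j) i = measure M {b k i..<b k i + lam k i}" if "i \<in> I" for k i
        using measure_base[where k = k, OF M that] sub_cong[where k = k, OF M_vec that] by simp
      have int: "{b k i..<b k i + lam k i} \<in> sets M" if "i \<in> I" for k i
        using fl_bounds[OF base_fl[OF that, of k]] by (intro interval_in_\<nu>[OF M]) auto
      have "sum y I = measure P (\<Union>i\<in>I. {b 0 i..<b 0 i + lam 0 i})"
      proof -
        interpret P: prob_space P by (rule prP)
        show ?thesis unfolding y_def
          using dom(2) int sP by (intro P.finite_measure_finite_Union[symmetric]) auto
      qed
      also have "\<dots> = 1"
        unfolding dom(1) using prob_space.prob_space[OF prP] space_\<nu>[OF \<open>inv_prob T P\<close>] by simp
      finally have s: "sum y I = 1" .
      have "y r = L j r" if "r \<in> I" for r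
      proof (rule dominated_eq_L[where K = "1 / measure M A", OF _ s _ that])
        show "0 \<le> sub k y i" if "i \<in> I" for k i using sub_y[OF that] by simp
        show "sub k y i \<le> 1 / measure M A * sub k (L j) i" if "i \<in> I" for k i
          unfolding sub_y[OF that] sub_LM[OF that] by (rule le[OF int[OF that]])
      qed
      then have "P = M"
        using M_vec by (intro inv_prob_eqI[OF \<open>inv_prob T P\<close> M]) (auto simp: y_def)
      then have "emeasure M A = emeasure M (A \<inter> A) / emeasure M A" using PA[OF A(1)] by simp
      also have "\<dots> = 1" using nz by (simp add: divide_eq_1_ennreal emeasure_eq_measure)
      finally show False using \<open>emeasure M A \<noteq> 1\<close> by simp
    qed
  qed
qed

end

text \<open>No letter belongs to two classes. If the vectors agreed, the total mass 1 would at every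
  level be covered by the mass outside the class of \<open>i\<close> and the mass outside that of
  \<open>j\<close>, but both tend to 0.\<close>

lemma L_distinct:
  assumes i: "i \<in> I" "head i = i" and j: "j \<in> I" "head j = j" and eq: "\<And>r. r \<in> I \<Longrightarrow> L i r = L j r"
  shows "i = j"
proof (rule ccontr)
  assume "i \<noteq> j"
  have "1 \<le> off i k (sub (B k) (L i)) + off j k (sub (B k) (L j))" for k
  proof -
    have sub_eq: "sub (B k) (L i) r = sub (B k) (L j) r" if "r \<in> I" for r
      using eq that by (rule sub_cong)
    have "1 = mass k (sub (B k) (L i))" using chain_mass[OF chain_sub, of k "L i"] L_sum[OF i] by simp
    also have "\<dots> \<le> (\<Sum>r\<in>I. (if head r \<noteq> i then N k r * sub (B k) (L i) r else 0) +
        (if head r \<noteq> j then N k r * sub (B k) (L j) r else 0))"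
      unfolding mass_def
    proof (intro sum_mono)
      fix r assume r: "r \<in> I"
      have "0 \<le> N k r * sub (B k) (L i) r" using N_nonneg[OF r] sub_L_nonneg[OF i r] by simp
      then show "N k r * sub (B k) (L i) r \<le> (if head r \<noteq> i then N k r * sub (B k) (L i) r else 0) +
        (if head r \<noteq> j then N k r * sub (B k) (L j) r else 0)"
        using \<open>i \<noteq> j\<close> sub_eq[OF r] by auto
    qed
    also have "\<dots> = off i k (sub (B k) (L i)) + off j k (sub (B k) (L j))"
      unfolding off_def sum.distrib by (simp only: sum.inter_filter finite_atLeastAtMost)
    finally show ?thesis .
  qed
  moreover have "(\<lambda>k. off i k (sub (B k) (L i)) + off j k (sub (B k) (L j))) \<longlonglongrightarrow> 0 + 0"
    by (intro tendsto_add off_L_tendsto i j)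
  ultimately have "(1::real) \<le> 0 + 0" by (intro LIMSEQ_le_const) auto
  then show False by simp
qed

end

theorem theorem1:
  fixes n p c1 :: nat and a c :: "nat \<Rightarrow> nat" and lam :: "nat \<Rightarrow> real"
  assumes "even n" and "n \<ge> 4" and "p \<ge> n + 1" and "c1 > 0"
    and "c 1 = c1"
    and "\<And>k. k \<ge> 1 \<Longrightarrow> a k = p * c k"
    and "\<And>k. k \<ge> 1 \<Longrightarrow> c (k + 1) = p * a k"
    and "\<And>i. i \<in> {1..n} \<Longrightarrow> lam i > 0"
    and "(\<Sum>i=1..n. lam i) = 1"
    and "\<And>m k. k < length (concat (map (\<lambda>k. gamma n (a k) (c k)) [1..<m+1])) \<Longrightarrow>
           rauzy_path (top_row n) (bot_row n) lam k
             = Some (concat (map (\<lambda>k. gamma n (a k) (c k)) [1..<m+1]) ! k)"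
  defines "S \<equiv> {j. odd j \<and> 3 \<le> j \<and> j \<le> n - 1} \<union> {n}"
    and "T \<equiv> iet_map (top_row n) (bot_row n) lam"
  shows "\<exists>L :: nat \<Rightarrow> nat \<Rightarrow> real.
           (\<forall>j\<in>S. \<forall>i\<in>{1..n}.
              (\<lambda>m. normalize_vec n (theta_prod n a c m (std_basis j)) i) \<longlonglongrightarrow> L j i)
         \<and> \<not> uniquely_ergodic T
         \<and> (\<exists>\<mu> :: nat \<Rightarrow> real measure.
              inj_on \<mu> S \<and>
              (\<forall>j\<in>S. ergodic_inv_prob T (\<mu> j) \<and>
                 (\<forall>i\<in>{1..n}. measure (\<mu> j) (Xint (top_row n) lam i) = L j i)))"
proof -
  define word where "word m = concat (map (\<lambda>k. gamma n (a k) (c k)) [1..<m + 1])" for m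
  have len: "m \<le> length (word m)" for m
  proof (induction m)
    case (Suc m)
    have "1 \<le> length (gamma n (a (Suc m)) (c (Suc m)))" by (simp add: gamma_def)
    then show ?case using Suc by (simp add: word_def)
  qed simp
  have set_top: "set (top_row n) = {1..n}" by (auto simp: top_row_def)
  have "2 * (n div 2) = n" using assms(1) by simp
  then have bot: "distinct (bot_row n)" "set (bot_row n) = set (top_row n)"
    using assms(2) unfolding bot_row_pairs set_top by (auto simp: distinct_pairs set_pairs)
  interpret gamma_iet n p a c lam
  proof unfold_locales
    \<comment> \<open>The word of \<open>Suc k\<close> blocks has more than \<open>k\<close>
      letters, so the type of step \<open>k\<close> is prescribed and no tie occurs.\<close>
    show "rauzy_path (top_row n) (bot_row n) lam k \<noteq> None" for k
      using assms(10)[of k "Suc k"] len[of "Suc k"] by (simp add: word_def)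
    show "sum_list (map lam (top_row n)) = 1"
      using assms(9) by (simp add: top_row_def interv_sum_list_conv_sum_set_nat atLeastLessThanSuc_atLeastAtMost del: upt_Suc)
    show "rauzy_path (top_row n) (bot_row n) lam k = Some (concat (map (\<lambda>k. gamma n (a k) (c k)) [1..<m+1]) ! k)"
      if "k < length (concat (map (\<lambda>k. gamma n (a k) (c k)) [1..<m+1]))" for k m
      using assms(10) that .
  qed (use assms bot set_top in \<open>auto simp: top_row_def\<close>)
  let ?X = "\<lambda>i. Xint (top_row n) lam i"
  \<comment> \<open>Since \<open>n\<close> is even, \<open>S\<close> picks from each class the one
    index that is its own head.\<close>
  have S: "j \<in> I" "head j = j" if "j \<in> S" for j
    using that assms(1,2) by (auto simp: S_def head_def)
  have X: "{b 0 i..<b 0 i + rauzy_iet.lam (top_row n) (bot_row n) lam 0 i} = ?X i" for i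
    by (simp add: Xint_def b_def init)
  have "\<exists>M. \<forall>j\<in>S. inv_prob T (M j) \<and> (\<forall>i\<in>I. measure (M j) (?X i) = L j i)"
    using measure_L[OF S] unfolding X T_def by (intro bchoice) blast
  then obtain \<mu> where \<mu>: "\<And>j. j \<in> S \<Longrightarrow> inv_prob T (\<mu> j)"
    "\<And>j i. j \<in> S \<Longrightarrow> i \<in> I \<Longrightarrow> measure (\<mu> j) (?X i) = L j i" by blast
  have erg: "ergodic_inv_prob T (\<mu> j)" if "j \<in> S" for j
    using ergodic_L[OF S[OF that], of "\<mu> j"] \<mu>[OF that] unfolding X T_def by blast
  have inj: "inj_on \<mu> S"
  proof (rule inj_onI)
    fix i j assume ij: "i \<in> S" "j \<in> S" "\<mu> i = \<mu> j"
    then have "L i r = L j r" if "r \<in> I" for r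
      using \<mu>(2)[OF ij(1) that] \<mu>(2)[OF ij(2) that] by simp
    then show "i = j" using L_distinct S ij by blast
  qed
  \<comment> \<open>Two different invariant measures suffice against unique ergodicity; 3 and
    \<open>n\<close> index two of them.\<close>
  have "3 \<in> S" "n \<in> S" "3 \<noteq> n" using assms(1,2) by (auto simp: S_def)
  then have "\<mu> 3 \<noteq> \<mu> n" "inv_prob T (\<mu> 3)" "inv_prob T (\<mu> n)" using inj \<mu>(1) by (auto dest: inj_onD)
  then have "\<not> uniquely_ergodic T" unfolding uniquely_ergodic_def by metis
  moreover have "\<forall>j\<in>S. \<forall>i\<in>I. (\<lambda>m. normalize_vec n (theta_prod n a c m (std_basis j)) i) \<longlonglongrightarrow> L j i"
    using dir_tendsto_head S unfolding dir_normalize by blast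
  ultimately show ?thesis using inj erg \<mu>(2) by blast
qed

end
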